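(* Let $k\ge3$ and let $\nu$ be a fixed positive integer. Then there exist polynomials $Q^*_{j,k}(X)$ ($j\ge2$) of degree at most $k-1$, with $Q^*_{2,k}$ of degree exactly $k-1$, such that, as $x\to\infty$, $$M_{\omega^k}(x):=\sum_{n\le x}\mu(n)\omega(n)^k=\frac{xQ^*_{2,k}(\log\log x)}{\log^2x}+\sum_{j=3}^{\nu}\frac{xQ^*_{j,k}(\log\log x)}{\log^jx}+O_\nu\!\left(\frac{x(\log\log x)^{k\nu+2k}}{\log^{\nu+1}x}\right)$$ (the sum over $j$ being empty if $\nu<3$).
   Context: $\mu$ is the Möbius function and $\omega(n)$ the number of distinct prime factors of $n$. Implied constants may depend on $k$ and $\nu$. *)

theory Defs
  imports
    Complex_Main
    "HOL-Computational_Algebra.Computational_Algebra"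
    "HOL-Library.Landau_Symbols"
begin

definition omega :: "nat \<Rightarrow> nat" where
  "omega n = card (prime_factors n)"

definition moebius_mu :: "nat \<Rightarrow> int" where
  "moebius_mu n = (if squarefree n then (- 1) ^ card (prime_factors n) else 0)"

definition M_omega_pow :: "nat \<Rightarrow> real \<Rightarrow> real" where
  "M_omega_pow k x =
     (\<Sum>n | 1 \<le> n \<and> real n \<le> x. of_int (moebius_mu n) * real (omega n) ^ k)"

end

theory Submission
  imports Defs "HOL-Complex_Analysis.Complex_Analysis" "HOL-Number_Theory.Prime_Powers" "HOL-Probability.Probability"
    "HOL-Real_Asymp.Real_Asymp"
begin

text \<open>
  Put \<open>y = ln x\<close>. The function \<open>exp (- y) * M_omega_pow k (exp y)\<close> has the Laplace transform \<open>A (1 + w) / (1 + w)\<close>, where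
  \<open>A\<close> is the Dirichlet series of \<open>\<mu>(n) \<omega>(n) ^ k\<close>. On squarefree numbers \<open>\<omega>\<close> agrees with the completely additive \<open>\<Omega>\<close>, and
  multiplication by \<open>\<Omega>\<close> is a derivation of the ring of arithmetic functions. Hence \<open>A\<close> is \<open>1 / \<zeta>\<close> times a polynomial of
  degree \<open>k\<close> in \<open>ln \<zeta>\<close> whose coefficients are holomorphic for \<open>Re s > 1/2\<close>.

  Near \<open>w = 0\<close> the transform is therefore a combination of terms \<open>w ^ m * ln w ^ i\<close> with \<open>1 \<le> m\<close> and \<open>i \<le> k\<close>, and such a term
  corresponds to \<open>q (ln y) / y ^ (m + 1)\<close> for a polynomial \<open>q\<close> of degree \<open>i - 1\<close>; only \<open>m = 1\<close>, \<open>i = k\<close> contributes to the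
  leading coefficient of \<open>Q 2\<close>. Away from \<open>w = 0\<close>, the 3-4-1 inequality and Cauchy's estimates show that all derivatives of
  the transform are \<open>O(\<bar>Im w\<bar> ^ \<epsilon>)\<close> up to the line \<open>Re w = 0\<close>. So after subtraction of the main terms and multiplication by
  \<open>y ^ N\<close> (that is, \<open>N\<close>-fold differentiation of the transform) one has good bounds for the transform on \<open>Re w = 1 / y\<close>, and
  Gaussian smoothing turns them into a pointwise bound. No contour integral is needed.
\<close>

section \<open>Dirichlet series\<close>

text \<open>The argument uses no zero-free region: \<open>1 / zeta\<close> is controlled only to the
  right of \<open>Re s = 1\<close>, which leaves no room for Cauchy's estimates there. Its
  derivatives are obtained instead from those of \<open>zeta\<close>. Growth below every positive
  power is the right notion because it is preserved by sums, products and derivatives. Gaussian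
  smoothing at a polynomially small scale is wasteful: it loses a power of \<open>y\<close>
  depending on \<open>k\<close> and \<open>\<nu>\<close>. The loss is made good by expanding the
  transform to an order \<open>V\<close> far beyond \<open>\<nu>\<close>; the surplus terms are
  absorbed by the error term at the very end. This is legitimate because the polynomial attached to
  \<open>w ^ m * Ln w ^ i\<close> does not depend on how far the expansion is carried. The formal
  inverse transforms of the main terms are not integrable at \<open>y = 0\<close>. Only after
  multiplication by \<open>y ^ N\<close> are they genuine Laplace integrals, so all comparisons are
  made between \<open>N\<close>-th derivatives.\<close>

definition dser :: "(nat \<Rightarrow> complex) \<Rightarrow> complex \<Rightarrow> complex" where
  "dser a s = (\<Sum>n. a n * of_nat n powr (-s))"

text \<open>Here and in \<open>dser\<close> the index 0 is harmless: \<open>0 powr s = 0\<close>, so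
  \<open>a 0\<close> never contributes. Convergence is required for every
  \<open>\<sigma> > c\<close> but not at \<open>c\<close>, which makes the notion stable under
  logarithmic weights.\<close>

definition abs_conv :: "(nat \<Rightarrow> complex) \<Rightarrow> real \<Rightarrow> bool" where
  "abs_conv a c \<longleftrightarrow> (\<forall>\<sigma>>c. summable (\<lambda>n. norm (a n) * real n powr (-\<sigma>)))"

lemma norm_nat_powr [simp]: "norm (of_nat n powr s :: complex) = real n powr Re s"
  by (metis Re_complex_of_real Reals_of_nat norm_powr_real_powr of_nat_0_le_iff of_real_of_nat_eq)

lemma abs_conv_mono:
  assumes "abs_conv b c" "\<And>n. n \<ge> 1 \<Longrightarrow> norm (a n) \<le> C * norm (b n)"
  shows "abs_conv a c"
  unfolding abs_conv_def
proof (intro allI impI)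
  fix \<sigma> assume "\<sigma> > c"
  hence "summable (\<lambda>n. C * (norm (b n) * real n powr (-\<sigma>)))"
    using assms(1) by (intro summable_mult) (auto simp: abs_conv_def)
  thus "summable (\<lambda>n. norm (a n) * real n powr (-\<sigma>))"
  proof (rule summable_comparison_test[rotated], intro exI[of _ 0] allI impI)
    fix n :: nat
    show "norm (norm (a n) * real n powr (-\<sigma>)) \<le> C * (norm (b n) * real n powr (-\<sigma>))"
      using assms(2)[of n] by (cases "n = 0") (auto simp: mult.assoc [symmetric] intro!: mult_right_mono)
  qed
qed

lemma abs_conv_one: "abs_conv (\<lambda>_. 1) 1"
  by (auto simp: abs_conv_def summable_real_powr_iff)

lemma abs_conv_ln_power:
  assumes "abs_conv a c"
  shows "abs_conv (\<lambda>n. a n * of_real (ln (real n)) ^ k) c"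
  unfolding abs_conv_def
proof (intro allI impI)
  fix \<sigma> assume \<sigma>: "\<sigma> > c"
  \<comment> \<open>Half of the margin \<open>\<sigma> - c\<close> absorbs the power of the
    logarithm.\<close>
  define e where "e = (\<sigma> - c) / 2"
  have e: "e > 0" "\<sigma> - e > c" using \<sigma> by (auto simp: e_def field_simps)
  have "((\<lambda>x::real. ln x ^ k * x powr (-e)) \<longlongrightarrow> 0) at_top"
    using e by real_asymp
  hence "(\<lambda>n. ln (real n) ^ k * real n powr (-e)) \<longlonglongrightarrow> 0"
    by (rule filterlim_compose) (rule filterlim_real_sequentially)
  hence "Bseq (\<lambda>n. ln (real n) ^ k * real n powr (-e))"
    by (intro convergent_imp_Bseq) (auto simp: convergent_def)
  then obtain C where C: "\<And>n. norm (ln (real n) ^ k * real n powr (-e)) \<le> C"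
    by (auto simp: Bseq_def)
  have "summable (\<lambda>n. C * (norm (a n) * real n powr (-(\<sigma>-e))))"
    using assms e by (intro summable_mult) (auto simp: abs_conv_def)
  thus "summable (\<lambda>n. norm (a n * of_real (ln (real n)) ^ k) * real n powr (-\<sigma>))"
  proof (rule summable_comparison_test[rotated], intro exI[of _ 0] allI impI)
    fix n :: nat
    have "norm (norm (a n * of_real (ln (real n)) ^ k) * real n powr (-\<sigma>)) =
       norm (a n) * real n powr (-(\<sigma>-e)) * norm (ln (real n) ^ k * real n powr (-e))"
      by (simp add: norm_mult norm_power powr_add [symmetric] power_abs abs_mult)
    also have "\<dots> \<le> norm (a n) * real n powr (-(\<sigma>-e)) * C"
      by (intro mult_left_mono C) auto
    finally show "norm (norm (a n * of_real (ln (real n)) ^ k) * real n powr (-\<sigma>)) \<le> C * (norm (a n) * real n powr (-(\<sigma>-e)))"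
      by (simp add: mult_ac)
  qed
qed

lemma abs_conv_ln_bound:
  assumes "\<And>n. n \<ge> 1 \<Longrightarrow> norm (a n) \<le> C * ln (real n) ^ k"
  shows "abs_conv a 1"
  by (rule abs_conv_mono[OF abs_conv_ln_power[OF abs_conv_one, of k], of _ C])
     (use assms in \<open>auto simp: norm_mult norm_power\<close>)

lemma abs_conv_add:
  assumes "abs_conv a c" "abs_conv b c"
  shows "abs_conv (\<lambda>n. a n + b n) c"
  unfolding abs_conv_def
proof (intro allI impI)
  fix \<sigma> assume "\<sigma> > c"
  hence "summable (\<lambda>n. norm (a n) * real n powr (-\<sigma>) + norm (b n) * real n powr (-\<sigma>))"
    using assms by (intro summable_add) (auto simp: abs_conv_def)
  thus "summable (\<lambda>n. norm (a n + b n) * real n powr (-\<sigma>))"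
    by (rule summable_comparison_test[rotated])
       (auto intro!: exI[of _ 0] mult_right_mono norm_triangle_ineq simp: distrib_right [symmetric])
qed

lemma dser_summable:
  assumes "abs_conv a c" "Re s > c"
  shows "summable (\<lambda>n. norm (a n * of_nat n powr (-s)))"
  using assms by (simp add: abs_conv_def norm_mult)

lemma dser_sums:
  assumes "abs_conv a c" "Re s > c"
  shows "(\<lambda>n. a n * of_nat n powr (-s)) sums dser a s"
  unfolding dser_def by (rule summable_sums, rule summable_norm_cancel, rule dser_summable[OF assms])

lemma dser_has_sum:
  assumes "abs_conv a c" "Re s > c"
  shows "((\<lambda>n. a n * of_nat n powr (-s)) has_sum dser a s) UNIV"
  by (rule norm_summable_imp_has_sum[OF dser_summable[OF assms] dser_sums[OF assms]])

lemma norm_dser_le: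
  assumes "abs_conv a c" "\<sigma> > c" "Re s \<ge> \<sigma>"
  shows "norm (dser a s) \<le> (\<Sum>n. norm (a n) * real n powr (-\<sigma>))"
proof -
  have "norm (dser a s) \<le> (\<Sum>n. norm (a n * of_nat n powr (-s)))"
    unfolding dser_def by (rule summable_norm, rule dser_summable) (use assms in auto)
  also have "\<dots> \<le> (\<Sum>n. norm (a n) * real n powr (-\<sigma>))"
  proof (rule suminf_le)
    fix n :: nat
    show "norm (a n * of_nat n powr (-s)) \<le> norm (a n) * real n powr (-\<sigma>)"
      using assms(3) by (cases "n = 0") (auto simp: norm_mult intro!: mult_left_mono powr_mono)
  qed (use assms in \<open>auto simp: abs_conv_def norm_mult\<close>)
  finally show ?thesis .
qed

text \<open>Termwise differentiation. Only the series itself has to be dominated locally uniformly;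
  holomorphy of the terms takes care of the derived series.\<close>

lemma has_field_derivative_dser:
  assumes "abs_conv a c" "Re s > c"
  shows "(dser a has_field_derivative dser (\<lambda>n. - of_real (ln (real n)) * a n) s) (at s)"
proof -
  let ?S = "{s. Re s > c}"
  have op: "open ?S" by (rule open_halfspace_Re_gt)
  have "\<exists>g g'. \<forall>x\<in>?S. ((\<lambda>n. a n * of_nat n powr (-x)) sums g x) \<and>
      ((\<lambda>n. (- of_real (ln (real n)) * a n) * of_nat n powr (-x)) sums g' x) \<and> (g has_field_derivative g' x) (at x)"
  proof (rule series_and_derivative_comparison_complex[OF op])
    fix n x assume "x \<in> ?S"
    show "((\<lambda>x. a n * of_nat n powr (-x)) has_field_derivative (- of_real (ln (real n)) * a n) * of_nat n powr (-x)) (at x)"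
    proof (cases "n = 0")
      case False
      hence "((\<lambda>x. of_nat n powr (-x)) has_field_derivative (- of_real (ln (real n)) * of_nat n powr (-x))) (at x)"
        by (auto intro!: derivative_eq_intros simp: powr_def Ln_of_nat)
      from DERIV_cmult[OF this, of "a n"] show ?thesis by (simp add: mult_ac)
    qed auto
  next
    fix x assume x: "x \<in> ?S"
    define d where "d = (Re x - c) / 2"
    have d: "d > 0" "Re x - d > c" using x by (auto simp: d_def field_simps)
    show "\<exists>d h. 0 < d \<and> summable h \<and> range h \<subseteq> \<real>\<^sub>\<ge>\<^sub>0 \<and>
        (\<forall>\<^sub>F n in sequentially. \<forall>y\<in>ball x d \<inter> ?S. cmod (a n * of_nat n powr (-y)) \<le> cmod (h n))"
    proof (intro exI conjI)
      show "d > 0" by fact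
      show "summable (\<lambda>n. of_real (norm (a n) * real n powr (-(Re x - d))) :: complex)"
        using assms(1) d by (intro summable_of_real) (auto simp: abs_conv_def)
      show "range (\<lambda>n. of_real (norm (a n) * real n powr (-(Re x - d))) :: complex) \<subseteq> \<real>\<^sub>\<ge>\<^sub>0"
        by (auto simp: nonneg_Reals_of_real_iff simp del: of_real_mult)
      show "\<forall>\<^sub>F n in sequentially. \<forall>y\<in>ball x d \<inter> ?S. cmod (a n * of_nat n powr (-y)) \<le> 
         cmod (of_real (norm (a n) * real n powr (-(Re x - d))))"
      proof (rule eventually_mono[OF eventually_gt_at_top[of 0]], intro ballI)
        fix n :: nat and y assume n: "n > 0" and y: "y \<in> ball x d \<inter> ?S"
        have "\<bar>Re (x - y)\<bar> \<le> norm (x - y)" by (rule abs_Re_le_cmod)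
        hence "Re y \<ge> Re x - d" using y by (auto simp: dist_norm)
        thus "cmod (a n * of_nat n powr (-y)) \<le> cmod (of_real (norm (a n) * real n powr (-(Re x - d))))"
          using n by (auto simp: norm_mult intro!: mult_left_mono powr_mono)
      qed
    qed
  qed
  then obtain g g' where g: "\<And>x. x \<in> ?S \<Longrightarrow> (\<lambda>n. a n * of_nat n powr (-x)) sums g x"
     "\<And>x. x \<in> ?S \<Longrightarrow> (\<lambda>n. (- of_real (ln (real n)) * a n) * of_nat n powr (-x)) sums g' x"
     "\<And>x. x \<in> ?S \<Longrightarrow> (g has_field_derivative g' x) (at x)" by blast
  have "dser a x = g x" if "x \<in> ?S" for x
    using g(1)[OF that] by (simp add: dser_def sums_iff)
  moreover have "dser (\<lambda>n. - of_real (ln (real n)) * a n) s = g' s"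
    using g(2)[of s] assms by (simp add: dser_def sums_iff)
  ultimately show ?thesis
    using has_field_derivative_transform_within_open[OF g(3)[of s] op] assms(2) by auto
qed

lemma holomorphic_dser: "abs_conv a c \<Longrightarrow> dser a holomorphic_on {s. Re s > c}"
  using has_field_derivative_dser[of a c]
  by (subst holomorphic_on_open) (auto simp: open_halfspace_Re_gt)

lemma dser_add:
  assumes "abs_conv a c" "abs_conv b c" "Re s > c"
  shows "dser (\<lambda>n. a n + b n) s = dser a s + dser b s"
  using sums_add[OF dser_sums[OF assms(1,3)] dser_sums[OF assms(2,3)]]
  by (simp add: dser_def sums_iff distrib_right)

lemma dser_mult_sums:
  assumes "abs_conv a c" "abs_conv b c" "Re s > c"
    and e: "\<And>n. n \<ge> 1 \<Longrightarrow> e n = (\<Sum>d | d dvd n. a d * b (n div d))"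
  shows "(\<lambda>n. e n * of_nat n powr (-s)) sums (dser a s * dser b s)"
proof -
  define f where "f = (\<lambda>a n. a n * (of_nat n :: complex) powr (-s))"
  have fa: "(f a has_sum dser a s) UNIV" "(\<lambda>n. norm (f a n)) summable_on UNIV"
    unfolding f_def using dser_has_sum[OF assms(1,3)] dser_summable[OF assms(1,3)]
    by (auto intro!: norm_summable_imp_summable_on)
  have fb: "(f b has_sum dser b s) UNIV" "(\<lambda>n. norm (f b n)) summable_on UNIV"
    unfolding f_def using dser_has_sum[OF assms(2,3)] dser_summable[OF assms(2,3)]
    by (auto intro!: norm_summable_imp_summable_on)
  have summ: "(\<lambda>z. norm (case z of (x,y) \<Rightarrow> f a x * f b y)) summable_on UNIV \<times> UNIV"
    unfolding Infinite_Sum.abs_summable_on_Sigma_iff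
    using fa(2) fb(2) by (auto simp: norm_mult infsum_cmult_right' abs_mult infsum_nonneg intro!: summable_on_cmult_right summable_on_cmult_left)
  have "((\<lambda>(x,y). f a x * f b y) has_sum (dser a s * dser b s)) (UNIV \<times> UNIV)"
  proof (rule has_sum_SigmaI)
    show "((\<lambda>y. case (x, y) of (x, y) \<Rightarrow> f a x * f b y) has_sum f a x * dser b s) UNIV" for x
      using has_sum_cmult_right[OF fb(1)] by simp
    show "((\<lambda>x. f a x * dser b s) has_sum dser a s * dser b s) UNIV"
      by (rule has_sum_cmult_left[OF fa(1)])
    show "(\<lambda>(x, y). f a x * f b y) summable_on UNIV \<times> UNIV"
      by (rule abs_summable_summable[OF summ])
  qed
  \<comment> \<open>Pairs with a zero entry contribute 0. On positive pairs \<open>(x, y)\<close>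
    corresponds to \<open>(x * y, x)\<close>, a product together with one of its divisors, and
    absolute convergence permits grouping by the product.\<close>
  also have "?this \<longleftrightarrow> ((\<lambda>(x,y). f a x * f b y) has_sum (dser a s * dser b s)) ({1..} \<times> {1..})"
    by (rule has_sum_cong_neutral) (auto simp: f_def not_le)
  also have "\<dots> \<longleftrightarrow> ((\<lambda>(n,d). f a d * f b (n div d)) has_sum (dser a s * dser b s)) (SIGMA n:{1..}. {d. d dvd n})"
    by (rule has_sum_reindex_bij_witness[of _ "\<lambda>(n,d). (d, n div d)" "\<lambda>(x,y). (x * y, x)"])
       (auto simp: Suc_le_eq elim!: dvdE)
  finally have "((\<lambda>n. \<Sum>d | d dvd n. f a d * f b (n div d)) has_sum (dser a s * dser b s)) {1..}"
    by (rule has_sum_SigmaD) auto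
  also have "?this \<longleftrightarrow> (f e has_sum (dser a s * dser b s)) UNIV"
  proof (rule has_sum_cong_neutral)
    fix n :: nat assume "n \<in> {1..} \<inter> UNIV"
    hence n: "n \<ge> 1" by auto
    have "(\<Sum>d | d dvd n. f a d * f b (n div d)) = (\<Sum>d | d dvd n. a d * b (n div d) * of_nat n powr (-s))"
    proof (rule sum.cong)
      fix d assume "d \<in> {d. d dvd n}"
      then obtain m where m: "n = d * m" by auto
      with n have "d > 0" "m > 0" by auto
      have "(of_nat n :: complex) powr (-s) = of_nat d powr (-s) * of_nat m powr (-s)"
        by (simp add: m powr_times_real)
      thus "f a d * f b (n div d) = a d * b (n div d) * of_nat n powr (-s)"
        using \<open>d > 0\<close> by (simp add: f_def m)
    qed auto
    thus "(\<Sum>d | d dvd n. f a d * f b (n div d)) = f e n"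
      using e[OF n] by (simp add: f_def sum_distrib_right)
  qed (auto simp: f_def)
  finally show ?thesis
    using has_sum_imp_sums[of "f e"] by (simp add: f_def)
qed

lemma dser_mult:
  assumes "abs_conv a c" "abs_conv b c" "Re s > c"
    and "\<And>n. n \<ge> 1 \<Longrightarrow> e n = (\<Sum>d | d dvd n. a d * b (n div d))"
  shows "dser a s * dser b s = dser e s"
  using dser_mult_sums[OF assms] by (simp add: dser_def sums_iff)

lemma dser_eq_1: "dser (\<lambda>n. if n = 1 then 1 else 0) s = 1"
proof -
  have "(\<lambda>n. (if n = 1 then 1 else 0) * of_nat n powr (-s) :: complex) sums (\<Sum>n\<in>{1}. (if n = 1 then 1 else 0) * of_nat n powr (-s))"
    by (rule sums_finite) auto
  thus ?thesis by (simp add: dser_def sums_iff)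
qed

lemma dser_eq_0: "dser (\<lambda>n. 0) s = 0"
  by (simp add: dser_def)

lemma dser_cong: "(\<And>n. n \<ge> 1 \<Longrightarrow> a n = b n) \<Longrightarrow> dser a s = dser b s"
  unfolding dser_def by (intro suminf_cong) (metis less_one linorder_not_less mult_zero_right of_nat_0 powr_0)


section \<open>Multiplication by the number of prime factors as a derivation\<close>

definition big_omega :: "nat \<Rightarrow> nat" where "big_omega n = size (prime_factorization n)"

lemma big_omega_1 [simp]: "big_omega 1 = 0" "big_omega (Suc 0) = 0" by (simp_all add: big_omega_def)

lemma big_omega_mult: "m > 0 \<Longrightarrow> n > 0 \<Longrightarrow> big_omega (m * n) = big_omega m + big_omega n"
  by (simp add: big_omega_def prime_factorization_mult)

lemma big_omega_prime_power: "prime p \<Longrightarrow> big_omega (p ^ k) = k"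
  by (simp add: big_omega_def prime_factorization_prime_power)

lemma two_power_big_omega_le: "n > 0 \<Longrightarrow> 2 ^ big_omega n \<le> n"
proof -
  assume n: "n > 0"
  have "(\<forall>p\<in>#M. p \<ge> 2) \<Longrightarrow> 2 ^ size M \<le> prod_mset M" for M :: "nat multiset"
    by (induction M) (auto intro!: mult_mono)
  from this[of "prime_factorization n"] show ?thesis
    using n by (auto simp: big_omega_def prod_mset_prime_factorization_nat in_prime_factors_iff prime_ge_2_nat)
qed

lemma big_omega_le_ln:
  assumes "n > 0" shows "real (big_omega n) \<le> 2 * ln (real n)"
proof -
  have "real (big_omega n) * ln 2 = ln (real (2 ^ big_omega n))" by (simp add: ln_realpow)
  also have "\<dots> \<le> ln (real n)"
    using two_power_big_omega_le[OF assms] assms by (subst ln_le_cancel_iff) (auto simp del: of_nat_power)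
  finally have "real (big_omega n) * ln 2 \<le> ln (real n)" .
  moreover have "ln (2::real) \<ge> 1/2" using ln2_ge_two_thirds by simp
  hence "real (big_omega n) * (1/2) \<le> real (big_omega n) * ln 2" by (intro mult_left_mono) auto
  ultimately show ?thesis by simp
qed

lemma omega_eq_big_omega: 
  assumes "squarefree n" shows "omega n = big_omega n"
proof -
  have n: "n \<noteq> 0" using assms by (metis not_squarefree_0)
  have "big_omega n = (\<Sum>p\<in>prime_factors n. multiplicity p n)"
    by (auto simp: big_omega_def size_multiset_overloaded_eq count_prime_factorization intro!: sum.cong)
  also have "\<dots> = (\<Sum>p\<in>prime_factors n. 1)"
    using assms squarefree_factorial_semiring'[OF n] by (intro sum.cong) auto
  finally show ?thesis by (simp add: omega_def)
qed

lemma moebius_mu_prime_mult: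
  assumes "prime p" "\<not> p dvd d" "d > 0"
  shows "moebius_mu (p * d) = - moebius_mu d"
proof -
  have cop: "coprime p d" using assms by (simp add: prime_imp_coprime)
  have "prime_factors (p * d) = insert p (prime_factors d)"
    using assms by (subst prime_factors_product) (auto simp: prime_prime_factors)
  moreover have "squarefree (p * d) \<longleftrightarrow> squarefree d"
    using assms by (auto simp: squarefree_mult_coprime[OF cop] squarefree_prime dest: squarefree_multD)
  ultimately show ?thesis using assms by (auto simp: moebius_mu_def in_prime_factors_iff)
qed

text \<open>For \<open>n > 1\<close> fix a prime \<open>p\<close> dividing \<open>n\<close>. The
  squarefree divisors fall into pairs \<open>d\<close>, \<open>p * d\<close> with \<open>p\<close>
  not dividing \<open>d\<close>, and the two values cancel.\<close>

lemma sum_moebius_mu_divisors: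
  assumes "n \<ge> 1"
  shows "(\<Sum>d | d dvd n. moebius_mu d) = (if n = 1 then 1 else 0)"
proof (cases "n = 1")
  case False
  then obtain p where p: "prime p" "p dvd n" using prime_factor_nat by blast
  define T where "T = {d. d dvd n \<and> squarefree d \<and> \<not> p dvd d}"
  have fin: "finite {d. d dvd n}" using assms by auto
  have T: "finite T" by (rule finite_subset[OF _ fin]) (auto simp: T_def)
  have T0: "d > 0" if "d \<in> T" for d using that by (auto simp: T_def intro!: Nat.gr0I)
  have "(\<Sum>d | d dvd n. moebius_mu d) = (\<Sum>d \<in> T \<union> (*) p ` T. moebius_mu d)"
  proof (intro sum.mono_neutral_right ballI)
    show "T \<union> (*) p ` T \<subseteq> {d. d dvd n}"
    proof
      fix x assume "x \<in> T \<union> (*) p ` T"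
      then consider "x \<in> T" | d where "d \<in> T" "x = p * d" by auto
      thus "x \<in> {d. d dvd n}"
      proof cases
        case 2
        hence "coprime p d" using p by (auto simp: T_def prime_imp_coprime)
        thus ?thesis using 2 p by (auto simp: T_def divides_mult)
      qed (auto simp: T_def)
    qed
    fix d assume d: "d \<in> {d. d dvd n} - (T \<union> (*) p ` T)"
    show "moebius_mu d = 0"
    proof (rule ccontr)
      assume nz: "moebius_mu d \<noteq> 0"
      hence sq: "squarefree d" by (auto simp: moebius_mu_def split: if_splits)
      with d have "p dvd d" by (auto simp: T_def)
      then obtain e where e: "d = p * e" by auto
      have "\<not> p dvd e"
      proof
        assume "p dvd e"
        hence "p ^ 2 dvd d" by (auto simp: e power2_eq_square)
        with sq have "is_unit p" by (auto simp: squarefree_def)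
        with p show False by auto
      qed
      hence "e \<in> T" using d sq by (auto simp: T_def e dest: squarefree_multD intro: dvd_trans)
      thus False using d e by auto
    qed
  qed (use fin in auto)
  also have "\<dots> = (\<Sum>d\<in>T. moebius_mu d) + (\<Sum>d\<in>(*) p ` T. moebius_mu d)"
    by (rule sum.union_disjoint) (use T in \<open>auto simp: T_def\<close>)
  also have "(\<Sum>d\<in>(*) p ` T. moebius_mu d) = (\<Sum>d\<in>T. moebius_mu (p * d))"
    using p by (subst sum.reindex) (auto simp: inj_on_def)
  also have "\<dots> = (\<Sum>d\<in>T. - moebius_mu d)"
    using p T0 by (intro sum.cong moebius_mu_prime_mult) (auto simp: T_def)
  finally show ?thesis using False by (simp add: sum_negf)
qed (auto simp: moebius_mu_def)

text \<open>A prime of multiplicity \<open>r\<close> in \<open>n\<close> has exactly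
  \<open>r\<close> powers that are divisors of \<open>n\<close>. So \<open>big_omega\<close> is the
  convolution of the indicator of the prime powers with 1, which says what the derivation does to
  \<open>zeta\<close>.\<close>

lemma sum_primepow_divisors:
  assumes "n \<ge> 1"
  shows "(\<Sum>d | d dvd n. if primepow d then 1 else 0 :: nat) = big_omega n"
proof -
  have "(\<Sum>d | d dvd n. if primepow d then 1 else 0 :: nat) = (\<Sum>d\<in>primepow_factors n. 1)"
    using assms by (intro sum.mono_neutral_cong_right) (auto simp: primepow_factors_def)
  also have "\<dots> = (\<Sum>p\<in>#prime_factorization n. 1)"
    using assms sum_prime_factorization_conv_sum_primepow_factors[of n "\<lambda>_. 1::nat"] by simp
  finally show ?thesis by (simp add: big_omega_def)
qed

lemma abs_conv_big_omega_power:
  assumes "abs_conv a c"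
  shows "abs_conv (\<lambda>n. a n * of_nat (big_omega n) ^ k) c"
proof (rule abs_conv_mono[OF abs_conv_ln_power[OF assms, of k]])
  fix n :: nat assume n: "n \<ge> 1"
  have "real (big_omega n) ^ k \<le> (2 * ln (real n)) ^ k"
    using n by (intro power_mono big_omega_le_ln) auto
  thus "norm (a n * of_nat (big_omega n) ^ k) \<le> 2 ^ k * norm (a n * of_real (ln (real n)) ^ k)"
    using n by (simp add: norm_mult norm_power power_mult_distrib mult_left_mono mult.left_commute)
qed

text \<open>Multiplication by \<open>big_omega\<close> is a derivation for Dirichlet convolution, because \<open>big_omega\<close> is completely additive.\<close>

lemma dser_leibniz:
  assumes "abs_conv a c" "abs_conv b c" "Re s > c"
    and e: "\<And>n. n \<ge> 1 \<Longrightarrow> e n = (\<Sum>d | d dvd n. a d * b (n div d))"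
  shows "(\<Sum>j\<le>k. of_nat (k choose j) * (dser (\<lambda>n. a n * of_nat (big_omega n) ^ j) s * 
           dser (\<lambda>n. b n * of_nat (big_omega n) ^ (k - j)) s)) = dser (\<lambda>n. e n * of_nat (big_omega n) ^ k) s"
proof -
  define E where "E j n = (\<Sum>d | d dvd n. (a d * of_nat (big_omega d) ^ j) * (b (n div d) * of_nat (big_omega (n div d)) ^ (k - j)))" for j n
  have "(\<lambda>n. E j n * of_nat n powr (-s)) sums (dser (\<lambda>n. a n * of_nat (big_omega n) ^ j) s * 
           dser (\<lambda>n. b n * of_nat (big_omega n) ^ (k - j)) s)" for j
    by (rule dser_mult_sums[OF abs_conv_big_omega_power[OF assms(1)] abs_conv_big_omega_power[OF assms(2)] assms(3)])
       (simp add: E_def)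
  hence "(\<lambda>n. \<Sum>j\<le>k. of_nat (k choose j) * (E j n * of_nat n powr (-s))) sums
     (\<Sum>j\<le>k. of_nat (k choose j) * (dser (\<lambda>n. a n * of_nat (big_omega n) ^ j) s * 
           dser (\<lambda>n. b n * of_nat (big_omega n) ^ (k - j)) s))"
    by (intro sums_sum sums_mult)
  moreover have "(\<Sum>j\<le>k. of_nat (k choose j) * (E j n * of_nat n powr (-s))) = 
      e n * of_nat (big_omega n) ^ k * of_nat n powr (-s)" for n
  proof (cases "n = 0")
    case False
    have "(\<Sum>j\<le>k. of_nat (k choose j) * E j n) = 
       (\<Sum>d | d dvd n. \<Sum>j\<le>k. a d * b (n div d) * (of_nat (k choose j) * of_nat (big_omega d) ^ j * of_nat (big_omega (n div d)) ^ (k - j)))"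
      unfolding E_def sum_distrib_left by (subst sum.swap) (simp add: mult_ac)
    also have "\<dots> = (\<Sum>d | d dvd n. a d * b (n div d) * of_nat (big_omega n) ^ k)"
    proof (rule sum.cong)
      fix d assume "d \<in> {d. d dvd n}"
      then obtain m where m: "n = d * m" by auto
      with False have "d > 0" "m > 0" by auto
      hence "big_omega n = big_omega d + big_omega (n div d)" by (simp add: m big_omega_mult)
      thus "(\<Sum>j\<le>k. a d * b (n div d) * (of_nat (k choose j) * of_nat (big_omega d) ^ j * of_nat (big_omega (n div d)) ^ (k - j))) =
         a d * b (n div d) * of_nat (big_omega n) ^ k"
        by (simp add: binomial_ring sum_distrib_left)
    qed auto
    also have "\<dots> = e n * of_nat (big_omega n) ^ k" using False by (subst e) (auto simp: sum_distrib_right)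
    finally show ?thesis by (simp add: sum_distrib_right [symmetric] mult.assoc [symmetric])
  qed auto
  ultimately show ?thesis by (simp add: dser_def sums_iff)
qed

section \<open>The Dirichlet series weighted by powers of \<open>big_omega\<close>\<close>

definition mu :: "nat \<Rightarrow> complex" where "mu n = of_int (moebius_mu n)"
definition zeta :: "complex \<Rightarrow> complex" where "zeta = dser (\<lambda>_. 1)"
definition ppow :: "nat \<Rightarrow> complex" where "ppow n = (if primepow n then 1 else 0)"
definition D_mu :: "nat \<Rightarrow> complex \<Rightarrow> complex" where "D_mu k = dser (\<lambda>n. mu n * of_nat (big_omega n) ^ k)"
definition D_ppow :: "nat \<Rightarrow> complex \<Rightarrow> complex" where "D_ppow k = dser (\<lambda>n. ppow n * of_nat (big_omega n) ^ k)"
text \<open>\<open>log_zeta\<close> is a logarithm of \<open>zeta\<close> up to an additive constant. At prime powers \<open>big_omega\<close> is the exponent,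
  so the coefficients are the usual \<open>1 / r\<close> at \<open>p ^ r\<close>; elsewhere they vanish, and \<open>1 / 0 = 0\<close> is harmless.\<close>

definition log_zeta :: "complex \<Rightarrow> complex" where "log_zeta = dser (\<lambda>n. ppow n / of_nat (big_omega n))"
definition D_corr :: "nat \<Rightarrow> complex \<Rightarrow> complex" where 
  "D_corr k = dser (\<lambda>n. ppow n * (of_nat (big_omega n) ^ k - 1 / of_nat (big_omega n)))"

lemma norm_mu_le: "norm (mu n) \<le> 1" by (simp add: mu_def moebius_mu_def norm_power)

lemma abs_conv_mu: "abs_conv mu 1" by (rule abs_conv_mono[OF abs_conv_one, of _ 1]) (simp add: norm_mu_le)

lemma abs_conv_ppow: "abs_conv ppow 1" by (rule abs_conv_mono[OF abs_conv_one, of _ 1]) (simp add: ppow_def)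

lemma abs_conv_log_zeta: "abs_conv (\<lambda>n. ppow n / of_nat (big_omega n)) 1"
proof (rule abs_conv_mono[OF abs_conv_one, of _ 1])
  fix n :: nat
  have "1 / real (big_omega n) \<le> 1" by (cases "big_omega n = 0") auto
  thus "norm (ppow n / of_nat (big_omega n)) \<le> 1 * norm (1 :: complex)" by (auto simp: ppow_def norm_divide)
qed

text \<open>At primes the coefficient is \<open>1 - 1 = 0\<close>, so only \<open>p ^ r\<close> with
  \<open>r \<ge> 2\<close> remain. Each of these has the form \<open>a ^ 2 * b ^ 3\<close> with
  \<open>b = 1\<close> for even \<open>r\<close> and \<open>b = p\<close> for odd \<open>r\<close>.
  The double series over all \<open>a\<close>, \<open>b\<close> converges for
  \<open>\<sigma> > 1/2\<close>, and choosing one pair for each number is injective because the pair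
  determines the number.\<close>

lemma abs_conv_D_corr: "abs_conv (\<lambda>n. ppow n * (of_nat (big_omega n) ^ k - 1 / of_nat (big_omega n))) (1/2)"
proof -
  define X where "X = {n. primepow n \<and> big_omega n \<ge> 2}"
  have ex: "\<exists>ab. n = fst ab ^ 2 * snd ab ^ 3" if "n \<in> X" for n :: nat
  proof -
    from that obtain p r where p: "prime p" "n = p ^ r" "r > 0" by (auto simp: X_def primepow_def)
    with that have r: "r \<ge> 2" by (auto simp: X_def big_omega_prime_power)
    show ?thesis
    proof (cases "even r")
      case True
      then obtain q where "r = 2 * q" by auto
      thus ?thesis using p by (intro exI[of _ "(p ^ q, 1)"]) (simp add: power_mult mult.commute)
    next
      case False
      then obtain q where q: "r = 2 * q + 1" by (auto elim: oddE)
      with r obtain q' where "q = Suc q'" by (cases q) auto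
      with q have "r = q' * 2 + 3" by simp
      thus ?thesis using p by (intro exI[of _ "(p ^ q', p)"]) (simp only: power_mult power_add fst_conv snd_conv)
    qed
  qed
  define h where "h n = (SOME ab. n = fst ab ^ 2 * snd ab ^ 3)" for n :: nat
  have h: "n = fst (h n) ^ 2 * snd (h n) ^ 3" if "n \<in> X" for n
    unfolding h_def by (rule someI_ex[OF ex[OF that]])
  have inj: "inj_on h X" by (rule inj_onI) (metis h)
  have "abs_conv (indicator X) (1/2)"
    unfolding abs_conv_def
  proof (intro allI impI)
    fix \<sigma> :: real assume \<sigma>: "\<sigma> > 1/2"
    define F where "F = (\<lambda>(a::nat,b::nat). real a powr (-2*\<sigma>) * real b powr (-3*\<sigma>))"
    have s: "(\<lambda>a::nat. real a powr (-2*\<sigma>)) summable_on UNIV" "(\<lambda>b::nat. real b powr (-3*\<sigma>)) summable_on UNIV"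
      using \<sigma> by (auto simp: summable_on_UNIV_nonneg_real_iff summable_real_powr_iff)
    have "F summable_on UNIV \<times> UNIV"
    proof (rule summable_on_SigmaI)
      show "((\<lambda>b. F (a, b)) has_sum real a powr (-2*\<sigma>) * infsum (\<lambda>b. real b powr (-3*\<sigma>)) UNIV) UNIV" for a
        unfolding F_def using has_sum_cmult_right[OF has_sum_infsum[OF s(2)]] by simp
      show "(\<lambda>a. real a powr (-2*\<sigma>) * infsum (\<lambda>b. real b powr (-3*\<sigma>)) UNIV) summable_on UNIV"
        by (intro summable_on_cmult_left s)
    qed (auto simp: F_def)
    hence "F summable_on (h ` X)" by (rule summable_on_subset_banach) auto
    hence "(\<lambda>n. F (h n)) summable_on X" by (subst (asm) summable_on_reindex[OF inj]) (simp add: o_def)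
    also have "?this \<longleftrightarrow> (\<lambda>n. norm (indicator X n :: complex) * real n powr (-\<sigma>)) summable_on UNIV"
    proof (rule summable_on_cong_neutral)
      fix n assume "n \<in> X \<inter> UNIV"
      hence n: "n \<in> X" by auto
      obtain a b where ab: "h n = (a, b)" by force
      have "n = a ^ 2 * b ^ 3" using h[OF n] ab by simp
      moreover have "n > 0" using n by (auto simp: X_def primepow_gt_0_nat)
      ultimately have "a > 0" "b > 0" and n_eq: "real n = real a powr 2 * real b powr 3" by auto
      have "real n powr (-\<sigma>) = F (h n)"
        unfolding n_eq ab F_def by (simp add: powr_mult powr_powr del: powr_numeral)
      thus "F (h n) = norm (indicator X n :: complex) * real n powr (-\<sigma>)" using n by simp
    qed auto
    finally show "summable (\<lambda>n. norm (indicator X n :: complex) * real n powr (-\<sigma>))"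
      by (rule summable_on_imp_summable)
  qed
  hence "abs_conv (\<lambda>n. indicator X n * of_nat (big_omega n) ^ k + indicator X n) (1/2)"
    by (intro abs_conv_add abs_conv_big_omega_power)
  thus ?thesis
  proof (rule abs_conv_mono[where C = 1])
    fix n :: nat assume "n \<ge> 1"
    show "norm (ppow n * (of_nat (big_omega n) ^ k - 1 / of_nat (big_omega n))) \<le> 1 * norm (indicator X n * of_nat (big_omega n) ^ k + indicator X n :: complex)"
    proof (cases "primepow n")
      case True
      then obtain p r where p: "prime p" "n = p ^ r" "r > 0" by (auto simp: primepow_def)
      hence big_omega: "big_omega n = r" by (simp add: big_omega_prime_power)
      show ?thesis
      proof (cases "r = 1")
        case False
        with p big_omega True have "n \<in> X" by (auto simp: X_def)
        moreover have "norm (of_nat r ^ k - 1 / of_nat r :: complex) \<le> norm (of_nat r ^ k :: complex) + norm (1 / of_nat r :: complex)"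
          by (rule norm_triangle_ineq4)
        moreover have "norm (1 / of_nat r :: complex) \<le> 1" using p by (simp add: norm_divide)
        moreover have "norm (of_nat r ^ k + 1 :: complex) = real r ^ k + 1"
          using norm_of_nat[of "r ^ k + 1", where ?'a = complex] by (simp add: add.commute)
        ultimately show ?thesis using True big_omega by (simp add: ppow_def norm_power)
      qed (use big_omega in \<open>simp add: ppow_def\<close>)
    qed (simp add: ppow_def)
  qed
qed

lemma D_ppow_eq:
  assumes "Re s > 1" shows "D_ppow k s = log_zeta s + D_corr k s"
proof -
  have "dser (\<lambda>n. ppow n / of_nat (big_omega n) + ppow n * (of_nat (big_omega n) ^ k - 1 / of_nat (big_omega n))) s = log_zeta s + D_corr k s"
    unfolding log_zeta_def D_corr_def
    by (rule dser_add[of _ 1]) (use assms abs_conv_log_zeta abs_conv_D_corr[of k] in \<open>auto simp: abs_conv_def\<close>)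
  thus ?thesis by (simp add: D_ppow_def field_simps)
qed

lemma D_mu_0_zeta:
  assumes "Re s > 1" shows "D_mu 0 s * zeta s = 1"
proof -
  have "D_mu 0 s * zeta s = dser (\<lambda>n. if n = 1 then 1 else 0) s"
    unfolding D_mu_def zeta_def
  proof (rule dser_mult[OF _ abs_conv_one assms])
    fix n :: nat assume n: "n \<ge> 1"
    have "(\<Sum>d | d dvd n. mu d) = of_int (\<Sum>d | d dvd n. moebius_mu d)" by (simp add: mu_def)
    also have "\<dots> = (if n = 1 then 1 else 0)" by (subst sum_moebius_mu_divisors[OF n]) auto
    finally show "(if n = 1 then 1 else 0) = (\<Sum>d | d dvd n. mu d * of_nat (big_omega d) ^ 0 * 1)" by simp
  qed (use abs_conv_mu in simp)
  thus ?thesis using dser_eq_1[of s] by simp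
qed

text \<open>For fixed \<open>s\<close> the power series \<open>FA\<close>, \<open>FZ\<close>,
  \<open>FK\<close> are exponential generating functions, formally the Dirichlet series twisted by
  \<open>exp (t * big_omega n)\<close>. By complete additivity convolution identities survive the
  twist. So Moebius inversion gives \<open>FA * FZ = 1\<close>, the prime power identity gives
  \<open>fps_deriv FZ = FK * FZ\<close>, and together \<open>fps_deriv FA = - (FK * FA)\<close>,
  whose coefficients are the recursion.\<close>

lemma D_mu_Suc:
  assumes s: "Re s > 1"
  shows "D_mu (Suc k) s = - (\<Sum>i\<le>k. of_nat (k choose i) * D_ppow i s * D_mu (k - i) s)"
proof -
  define Z where "Z k = dser (\<lambda>n. 1 * of_nat (big_omega n) ^ k) s" for k
  define FA where "FA = Abs_fps (\<lambda>j. D_mu j s / fact j)"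
  define FZ where "FZ = Abs_fps (\<lambda>j. Z j / fact j)"
  define FK where "FK = Abs_fps (\<lambda>j. D_ppow j s / fact j)"
  have conv: "(\<Sum>j=0..k. f j / fact j * (g (k - j) / fact (k - j))) = (\<Sum>j\<le>k. of_nat (k choose j) * (f j * g (k - j))) / fact k" 
    for f g :: "nat \<Rightarrow> complex" and k
    unfolding sum_divide_distrib atLeast0AtMost
    by (intro sum.cong) (auto simp: binomial_fact field_simps)
  have 1: "FA * FZ = 1"
  proof (rule fps_ext)
    fix k
    have "(FA * FZ) $ k = (\<Sum>j\<le>k. of_nat (k choose j) * (D_mu j s * Z (k - j))) / fact k"
      unfolding fps_mult_nth FA_def FZ_def fps_nth_Abs_fps by (rule conv)
    also have "(\<Sum>j\<le>k. of_nat (k choose j) * (D_mu j s * Z (k - j))) = dser (\<lambda>n. (if n = 1 then 1 else 0) * of_nat (big_omega n) ^ k) s"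
      unfolding D_mu_def Z_def
    proof (rule dser_leibniz[OF abs_conv_mu abs_conv_one s])
      fix n :: nat assume n: "n \<ge> 1"
      have "(\<Sum>d | d dvd n. mu d) = of_int (\<Sum>d | d dvd n. moebius_mu d)" by (simp add: mu_def)
      also have "\<dots> = (if n = 1 then 1 else 0)" by (subst sum_moebius_mu_divisors[OF n]) auto
      finally show "(if n = 1 then 1 else 0) = (\<Sum>d | d dvd n. mu d * 1)" by simp
    qed
    also have "\<dots> = (if k = 0 then 1 else 0)"
    proof (cases "k = 0")
      case False
      hence "(\<lambda>n. (if n = 1 then 1 else 0) * of_nat (big_omega n) ^ k) = (\<lambda>n. 0 :: complex)" by (auto simp: fun_eq_iff)
      thus ?thesis using False by (simp add: dser_eq_0)
    qed (use dser_eq_1 in simp)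
    finally show "(FA * FZ) $ k = 1 $ k" by simp
  qed
  have 2: "fps_deriv FZ = FK * FZ"
  proof (rule fps_ext)
    fix k
    have "(FK * FZ) $ k = (\<Sum>j\<le>k. of_nat (k choose j) * (D_ppow j s * Z (k - j))) / fact k"
      unfolding fps_mult_nth FK_def FZ_def fps_nth_Abs_fps by (rule conv)
    also have "(\<Sum>j\<le>k. of_nat (k choose j) * (D_ppow j s * Z (k - j))) = dser (\<lambda>n. of_nat (big_omega n) * of_nat (big_omega n) ^ k) s"
      unfolding D_ppow_def Z_def
    proof (rule dser_leibniz[OF abs_conv_ppow abs_conv_one s])
      fix n :: nat assume n: "n \<ge> 1"
      have "of_nat (big_omega n) = of_nat (\<Sum>d | d dvd n. if primepow d then 1 else 0 :: nat)"
        by (subst sum_primepow_divisors[OF n]) auto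
      also have "\<dots> = (\<Sum>d | d dvd n. ppow d)" unfolding of_nat_sum by (intro sum.cong) (auto simp: ppow_def)
      finally show "of_nat (big_omega n) = (\<Sum>d | d dvd n. ppow d * 1)" by simp
    qed
    also have "\<dots> = Z (Suc k)" by (simp add: Z_def)
    finally show "fps_deriv FZ $ k = (FK * FZ) $ k" by (simp add: FZ_def del: of_nat_Suc)
  qed
  have "fps_deriv FA * FZ + FA * (FK * FZ) = 0"
    using arg_cong[OF 1, of fps_deriv] 2 by (simp add: algebra_simps)
  hence "(fps_deriv FA * FZ + FA * (FK * FZ)) * FA = 0" by simp
  hence "fps_deriv FA * (FA * FZ) + FA * FK * (FA * FZ) = 0" by (simp add: algebra_simps)
  hence "fps_deriv FA = - (FK * FA)" by (simp add: 1 eq_neg_iff_add_eq_0 mult.commute)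
  hence "fps_deriv FA $ k = - ((FK * FA) $ k)" by simp
  also have "(FK * FA) $ k = (\<Sum>j\<le>k. of_nat (k choose j) * (D_ppow j s * D_mu (k - j) s)) / fact k"
      unfolding fps_mult_nth FK_def FA_def fps_nth_Abs_fps by (rule conv)
  finally have "D_mu (Suc k) s / fact k = - (\<Sum>j\<le>k. of_nat (k choose j) * (D_ppow j s * D_mu (k - j) s)) / fact k"
    by (simp add: FA_def del: of_nat_Suc)
  thus ?thesis by (simp only: divide_cancel_right) (simp add: mult.assoc)
qed

lemma has_field_derivative_zeta:
  assumes s: "Re s > 1"
  shows "(zeta has_field_derivative - zeta s * dser mangoldt s) (at s)"
proof -
  have ac: "abs_conv (mangoldt :: nat \<Rightarrow> complex) 1"
    by (rule abs_conv_ln_bound[of _ 1 1]) (auto simp: mangoldt_le)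
  have "zeta s * dser mangoldt s = dser (\<lambda>n. of_real (ln (real n))) s"
    unfolding zeta_def mult.commute[of "dser (\<lambda>_. 1) s"]
  proof (rule dser_mult[OF ac abs_conv_one s])
    fix n :: nat assume n: "n \<ge> 1"
    show "complex_of_real (ln (real n)) = (\<Sum>d | d dvd n. mangoldt d * 1)"
      using mangoldt_sum[of n, where ?'a = complex] n by simp
  qed
  moreover have "dser (\<lambda>n. - of_real (ln (real n)) * 1) s = - dser (\<lambda>n. of_real (ln (real n))) s"
    unfolding dser_def mult_minus_left mult_1_right
    by (rule suminf_minus, rule summable_norm_cancel, rule dser_summable[of _ 1], 
        rule abs_conv_ln_bound[of _ 1 1], use s in auto)
  ultimately show ?thesis using has_field_derivative_dser[OF abs_conv_one s] by (simp add: zeta_def)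
qed

text \<open>At \<open>p ^ r\<close> differentiation brings down \<open>r * ln p\<close>, and the
  division by \<open>r\<close> leaves \<open>ln p\<close>, the value of
  \<open>mangoldt\<close>.\<close>

lemma has_field_derivative_log_zeta:
  assumes s: "Re s > 1"
  shows "(log_zeta has_field_derivative - dser mangoldt s) (at s)"
proof -
  have "dser (\<lambda>n. - of_real (ln (real n)) * (ppow n / of_nat (big_omega n))) s = dser (\<lambda>n. - mangoldt n) s"
  proof (rule dser_cong)
    fix n :: nat assume n: "n \<ge> 1"
    show "- complex_of_real (ln (real n)) * (ppow n / of_nat (big_omega n)) = - mangoldt n"
    proof (cases "primepow n")
      case True
      then obtain p r where p: "prime p" "n = p ^ r" "r > 0" by (auto simp: primepow_def)
      hence "prime p" "p > 0" by (auto simp: prime_gt_0_nat)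
      thus ?thesis using p by (simp add: ppow_def big_omega_prime_power ln_realpow mangoldt_primepow)
    qed (simp add: ppow_def mangoldt_def)
  qed
  also have "\<dots> = - dser mangoldt s"
    unfolding dser_def mult_minus_left
    by (rule suminf_minus, rule summable_norm_cancel, rule dser_summable[of _ 1], 
        rule abs_conv_ln_bound[of _ 1 1], use s in \<open>auto simp: mangoldt_le\<close>)
  finally show ?thesis using has_field_derivative_dser[OF abs_conv_log_zeta s] by (simp add: log_zeta_def)
qed


section \<open>Continuation of the zeta function and the 3-4-1 inequality\<close>

text \<open>The summands of \<open>(s - 1) * zeta s - 1\<close>: the series over \<open>n\<close> of the difference between a term of \<open>zeta\<close> and the
  integral of \<open>u powr -s\<close> over a unit interval, times \<open>s - 1\<close>, which makes each summand entire.\<close>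

definition zterm :: "nat \<Rightarrow> complex \<Rightarrow> complex" where
  "zterm n s = (s - 1) * of_nat (Suc n) powr (-s) - (of_nat (Suc n) powr (1 - s) - of_nat (Suc (Suc n)) powr (1 - s))"

text \<open>The leading 1 is the value of the telescoping sum of the integral parts for
  \<open>Re s > 1\<close>.\<close>

definition zetaY :: "complex \<Rightarrow> complex" where "zetaY s = 1 + (\<Sum>n. zterm n s)"

lemma norm_real_add_powr:
  assumes "N > 0" "u \<ge> 0"
  shows "norm ((of_real N + of_real u :: complex) powr s) = (N + u) powr Re s"
  using norm_powr_real_powr[of "of_real (N + u)" s] assms by simp

lemma powr_shift_bound:
  assumes N: "N \<ge> (1::real)" and s: "Re s > 0" and u: "u \<in> {0..1}"
  shows "norm (of_real N powr (-s) - (of_real N + of_real u) powr (-s) :: complex) \<le> norm s * N powr (-Re s - 1)"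
proof -
  have "norm ((of_real N + of_real 0) powr (-s) - (of_real N + of_real u) powr (-s) :: complex)
      \<le> (norm s * N powr (-Re s - 1)) * norm (of_real 0 - of_real u :: complex)"
  proof (rule field_differentiable_bound[of "closed_segment 0 1" _ "\<lambda>z. - s * (of_real N + z) powr (-s - 1)"])
    fix z :: complex assume "z \<in> closed_segment 0 1"
    then obtain v where v: "z = of_real v" "v \<in> {0..1}" by (auto simp: in_segment scaleR_conv_of_real)
    have "of_real N + z \<notin> \<real>\<^sub>\<le>\<^sub>0" using N v by (auto simp: complex_nonpos_Reals_iff)
    thus "((\<lambda>z. (of_real N + z) powr (-s)) has_field_derivative - s * (of_real N + z) powr (-s - 1)) (at z within closed_segment 0 1)"
      by (auto intro!: derivative_eq_intros)
    have "(N + v) powr (-Re s - 1) \<le> N powr (-Re s - 1)"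
      using N v s by (intro powr_mono2') auto
    thus "norm (- s * (of_real N + z) powr (-s - 1)) \<le> norm s * N powr (-Re s - 1)"
      using N v by (simp add: norm_mult norm_real_add_powr mult_left_mono)
  qed (use u in \<open>auto simp: in_segment scaleR_conv_of_real intro!: exI[of _ u]\<close>)
  also have "\<dots> \<le> (norm s * N powr (-Re s - 1)) * 1" using u by (intro mult_left_mono) auto
  finally show ?thesis by simp
qed

lemma powr_shift_bound':
  assumes N: "N \<ge> (1::real)" and s: "Re s > 0" and u: "u \<in> {0..1}"
  shows "norm (of_real N powr (-s) - (of_real N + of_real u) powr (-s) :: complex) \<le> 2 * N powr (-Re s)"
proof -
  have "norm (of_real N powr (-s) - (of_real N + of_real u) powr (-s) :: complex) \<le> 
     norm ((of_real N + of_real 0) powr (-s) :: complex) + norm ((of_real N + of_real u) powr (-s) :: complex)"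
    using norm_triangle_ineq4 by simp
  also have "\<dots> = N powr (-Re s) + (N + u) powr (-Re s)"
    using N u by (subst (1 2) norm_real_add_powr) auto
  also have "(N + u) powr (-Re s) \<le> N powr (-Re s)" using N u s by (intro powr_mono2') auto
  finally show ?thesis by simp
qed

text \<open>\<open>zterm n s\<close> is the increment over the unit segment of a function whose
  derivative is \<open>s - 1\<close> times the difference bounded by \<open>B\<close>. The mean
  value inequality thus replaces the integral.\<close>

lemma zterm_bound_aux:
  assumes s: "Re s > 0" 
    and B: "\<And>u. u \<in> {0..1} \<Longrightarrow> norm (of_real (real (Suc n)) powr (-s) - (of_real (real (Suc n)) + of_real u) powr (-s) :: complex) \<le> B"
  shows "norm (zterm n s) \<le> norm (s - 1) * B"
proof -
  define N where "N = real (Suc n)"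
  define f where "f z = (s - 1) * z * of_real N powr (-s) + (of_real N + z) powr (1 - s)" for z :: complex
  have "norm (f 1 - f 0) \<le> (norm (s - 1) * B) * norm (1 - 0 :: complex)"
  proof (rule field_differentiable_bound[of "closed_segment 0 1" _ "\<lambda>z. (s - 1) * (of_real N powr (-s) - (of_real N + z) powr (-s))"])
    fix z :: complex assume "z \<in> closed_segment 0 1"
    then obtain v where v: "z = of_real v" "v \<in> {0..1}" by (auto simp: in_segment scaleR_conv_of_real)
    have "of_real N + z \<notin> \<real>\<^sub>\<le>\<^sub>0" using v by (auto simp: complex_nonpos_Reals_iff N_def)
    thus "(f has_field_derivative (s - 1) * (of_real N powr (-s) - (of_real N + z) powr (-s))) (at z within closed_segment 0 1)"
      unfolding f_def by (auto intro!: derivative_eq_intros simp: algebra_simps)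
    show "norm ((s - 1) * (of_real N powr (-s) - (of_real N + z) powr (-s))) \<le> norm (s - 1) * B"
      unfolding norm_mult using B[OF v(2)] v(1) by (intro mult_left_mono) (auto simp: N_def)
  qed auto
  also have "f 1 - f 0 = zterm n s"
    by (simp add: f_def zterm_def N_def algebra_simps)
  finally show ?thesis by simp
qed

text \<open>Interpolation between the trivial bound and the one from the mean value theorem; with \<open>\<theta>\<close> small this yields
  the growth of \<open>zeta\<close> to the left of the line \<open>Re s = 1\<close> without truncating the series.\<close>

lemma zterm_bound:
  assumes s: "Re s > 0" and \<theta>: "\<theta> \<in> {0..1}"
  shows "norm (zterm n s) \<le> 2 * norm (s - 1) * norm s powr \<theta> * real (Suc n) powr (-Re s - \<theta>)"
proof -
  define N where "N = real (Suc n)"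
  have N: "N \<ge> 1" by (simp add: N_def)
  have s0: "norm s > 0" using s by auto
  have "norm (of_real N powr (-s) - (of_real N + of_real u) powr (-s) :: complex) \<le> 2 * norm s powr \<theta> * N powr (-Re s - \<theta>)"
    if u: "u \<in> {0..1}" for u
  proof (cases "norm (of_real N powr (-s) - (of_real N + of_real u) powr (-s) :: complex) = 0")
    case False
    let ?X = "norm (of_real N powr (-s) - (of_real N + of_real u) powr (-s) :: complex)"
    from False have X: "?X > 0" by simp
    have "?X = ?X powr (1 - \<theta>) * ?X powr \<theta>" using X by (simp flip: powr_add)
    also have "\<dots> \<le> (2 * N powr (-Re s)) powr (1 - \<theta>) * (norm s * N powr (-Re s - 1)) powr \<theta>"
      using powr_shift_bound[OF N s u] powr_shift_bound'[OF N s u] \<theta> by (intro mult_mono powr_mono2) auto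
    also have "\<dots> = 2 powr (1 - \<theta>) * norm s powr \<theta> * N powr ((-Re s) * (1 - \<theta>) + (-Re s - 1) * \<theta>)"
    proof -
      have "(2 * N powr (-Re s)) powr (1 - \<theta>) = 2 powr (1 - \<theta>) * N powr ((-Re s) * (1 - \<theta>))"
        by (simp add: powr_mult powr_powr)
      moreover have "(norm s * N powr (-Re s - 1)) powr \<theta> = norm s powr \<theta> * N powr ((-Re s - 1) * \<theta>)"
        by (simp add: powr_mult powr_powr)
      ultimately show ?thesis unfolding powr_add by (simp only: mult_ac)
    qed
    also have "(-Re s) * (1 - \<theta>) + (-Re s - 1) * \<theta> = -Re s - \<theta>" by (simp add: algebra_simps)
    also have "2 powr (1 - \<theta>) * norm s powr \<theta> * N powr (-Re s - \<theta>) \<le> 2 powr 1 * norm s powr \<theta> * N powr (-Re s - \<theta>)"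
      using \<theta> by (intro mult_right_mono powr_mono) auto
    finally show ?thesis by simp
  qed auto
  from zterm_bound_aux[OF s, of n, OF this[unfolded N_def]] show ?thesis
    by (simp add: N_def mult_ac)
qed

lemma summable_Suc_powr: "c < -1 \<Longrightarrow> summable (\<lambda>n. real (Suc n) powr c)"
  by (subst summable_Suc_iff) (simp add: summable_real_powr_iff)

lemma zterm_summable: "Re s > 0 \<Longrightarrow> summable (\<lambda>n. norm (zterm n s))"
  by (rule summable_comparison_test[OF _ summable_mult[OF summable_Suc_powr[of "-Re s - 1"], of "2 * norm (s - 1) * norm s powr 1"]])
     (auto intro!: exI[of _ 0] simp: mult.assoc order.trans[OF zterm_bound[of s 1]])

lemma holomorphic_zetaY: "zetaY holomorphic_on {s. Re s > 0}"
proof -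
  let ?S = "{s. Re s > 0}"
  have op: "open ?S" by (rule open_halfspace_Re_gt)
  have "\<exists>g g'. \<forall>x\<in>?S. ((\<lambda>n. zterm n x) sums g x) \<and>
      ((\<lambda>n. deriv (zterm n) x) sums g' x) \<and> (g has_field_derivative g' x) (at x)"
  proof (rule series_and_derivative_comparison_complex[OF op])
    fix n x assume "x \<in> ?S"
    have "zterm n holomorphic_on UNIV"
      unfolding zterm_def by (intro holomorphic_intros)
    hence "zterm n field_differentiable at x"
      by (rule holomorphic_on_imp_differentiable_at) auto
    thus "(zterm n has_field_derivative deriv (zterm n) x) (at x)"
      by (simp add: DERIV_deriv_iff_field_differentiable)
  next
    fix x assume x: "x \<in> ?S"
    define d where "d = Re x / 2"
    have d: "d > 0" "Re x - d = d" using x by (auto simp: d_def)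
    define K where "K = 2 * (norm x + d + 1) * (norm x + d)"
    show "\<exists>d h. 0 < d \<and> summable h \<and> range h \<subseteq> \<real>\<^sub>\<ge>\<^sub>0 \<and>
        (\<forall>\<^sub>F n in sequentially. \<forall>y\<in>ball x d \<inter> ?S. cmod (zterm n y) \<le> cmod (h n))"
    proof (intro exI conjI)
      show "d > 0" by fact
      show "summable (\<lambda>n. of_real (K * real (Suc n) powr (-d-1)) :: complex)"
        using d by (intro summable_of_real summable_mult summable_Suc_powr) auto
      show "range (\<lambda>n. of_real (K * real (Suc n) powr (-d-1)) :: complex) \<subseteq> \<real>\<^sub>\<ge>\<^sub>0"
        using d by (auto simp: nonneg_Reals_of_real_iff K_def simp del: of_real_mult)
      show "\<forall>\<^sub>F n in sequentially. \<forall>y\<in>ball x d \<inter> ?S. cmod (zterm n y) \<le> 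
         cmod (of_real (K * real (Suc n) powr (-d-1)))"
      proof (intro always_eventually allI ballI)
        fix n :: nat and y assume y: "y \<in> ball x d \<inter> ?S"
        have "\<bar>Re (x - y)\<bar> \<le> norm (x - y)" by (rule abs_Re_le_cmod)
        hence Re: "Re y \<ge> d" using y d by (auto simp: dist_norm)
        have ny: "norm y \<le> norm x + d" using y norm_triangle_ineq4[of x "x - y"] by (auto simp: dist_norm)
        have ny': "norm (y - 1) \<le> norm x + d + 1" using ny norm_triangle_ineq4[of y 1] by simp
        have "norm (zterm n y) \<le> 2 * norm (y - 1) * norm y powr 1 * real (Suc n) powr (-Re y - 1)"
          using y by (intro zterm_bound) auto
        also have "\<dots> \<le> K * real (Suc n) powr (-d-1)"
          using ny ny' Re d unfolding K_def by (intro mult_mono powr_mono) auto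
        finally show "cmod (zterm n y) \<le> cmod (of_real (K * real (Suc n) powr (-d-1)))"
          unfolding norm_of_real by linarith
      qed
    qed
  qed
  then obtain g g' where g: "\<And>x. x \<in> ?S \<Longrightarrow> (\<lambda>n. zterm n x) sums g x"
     "\<And>x. x \<in> ?S \<Longrightarrow> (g has_field_derivative g' x) (at x)" by blast
  have "g holomorphic_on ?S" using g(2) by (subst holomorphic_on_open[OF op]) auto
  hence "(\<lambda>s. 1 + g s) holomorphic_on ?S" by (intro holomorphic_intros)
  thus ?thesis
    by (rule holomorphic_transform) (use g(1) in \<open>auto simp: zetaY_def sums_iff\<close>)
qed

text \<open>All summands vanish at \<open>s = 1\<close>. The value 1 is the residue of
  \<open>zeta\<close>, and it later normalises the leading coefficient through
  \<open>H k 0 = 1\<close>.\<close>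

lemma zetaY_1: "zetaY 1 = 1"
  by (simp add: zetaY_def zterm_def del: of_nat_Suc)

lemma zetaY_eq:
  assumes s: "Re s > 1" shows "zetaY s = (s - 1) * zeta s"
proof -
  have "(\<lambda>n. (1::complex) * of_nat n powr (-s)) sums zeta s"
    unfolding zeta_def by (rule dser_sums[OF abs_conv_one s])
  hence "(\<lambda>n. of_nat (Suc n) powr (-s) :: complex) sums zeta s"
    by (subst sums_Suc_iff) auto
  hence 1: "(\<lambda>n. (s - 1) * of_nat (Suc n) powr (-s) :: complex) sums ((s - 1) * zeta s)"
    by (rule sums_mult)
  have "(\<lambda>n. real n powr (1 - Re s)) \<longlonglongrightarrow> 0" using s by real_asymp
  hence "(\<lambda>n. norm (of_nat n powr (1 - s) :: complex)) \<longlonglongrightarrow> 0" by simp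
  hence "(\<lambda>n. of_nat n powr (1 - s) :: complex) \<longlonglongrightarrow> 0" by (rule tendsto_norm_zero_cancel)
  hence "(\<lambda>n. of_nat (Suc n) powr (1 - s) :: complex) \<longlonglongrightarrow> 0" by (rule LIMSEQ_Suc)
  from telescope_sums'[OF this] have 2: "(\<lambda>n. of_nat (Suc n) powr (1 - s) - of_nat (Suc (Suc n)) powr (1 - s) :: complex) sums (1 - 0)" 
    by simp
  from sums_diff[OF 1 2] show ?thesis by (simp add: zetaY_def zterm_def sums_iff)
qed

text \<open>Interpolation with \<open>\<theta> = 2 * \<eta>\<close>: for
  \<open>Re s \<ge> 1 - \<eta>\<close> the exponent of the series is at most
  \<open>- 1 - \<eta>\<close>, hence still summable, and the price is only a small power of
  \<open>norm s\<close>.\<close>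

lemma zetaY_bound:
  assumes \<eta>: "\<eta> \<in> {0<..1/2}"
  shows "\<exists>C\<ge>0. \<forall>s. Re s \<ge> 1 - \<eta> \<longrightarrow> norm (zetaY s) \<le> 1 + C * norm (s - 1) * norm s powr (2 * \<eta>)"
proof (intro exI[of _ "2 * (\<Sum>n. real (Suc n) powr (-1-\<eta>))"] conjI allI impI)
  show "0 \<le> 2 * (\<Sum>n. real (Suc n) powr (-1-\<eta>))"
    using \<eta> by (intro mult_nonneg_nonneg suminf_nonneg summable_Suc_powr) auto
  fix s assume s: "Re s \<ge> 1 - \<eta>"
  hence s0: "Re s > 0" using \<eta> by auto
  have "norm (\<Sum>n. zterm n s) \<le> (\<Sum>n. norm (zterm n s))" by (rule summable_norm[OF zterm_summable[OF s0]])
  also have "\<dots> \<le> (\<Sum>n. 2 * norm (s - 1) * norm s powr (2 * \<eta>) * real (Suc n) powr (-1-\<eta>))"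
  proof (rule suminf_le[OF _ zterm_summable[OF s0]])
    fix n
    have "norm (zterm n s) \<le> 2 * norm (s - 1) * norm s powr (2 * \<eta>) * real (Suc n) powr (-Re s - 2 * \<eta>)"
      using \<eta> s0 by (intro zterm_bound) auto
    also have "\<dots> \<le> 2 * norm (s - 1) * norm s powr (2 * \<eta>) * real (Suc n) powr (-1-\<eta>)"
      using s by (intro mult_left_mono powr_mono) auto
    finally show "norm (zterm n s) \<le> 2 * norm (s - 1) * norm s powr (2 * \<eta>) * real (Suc n) powr (-1-\<eta>)" .
  qed (use \<eta> in \<open>intro summable_mult summable_Suc_powr, auto\<close>)
  also have "\<dots> = 2 * norm (s - 1) * norm s powr (2 * \<eta>) * (\<Sum>n. real (Suc n) powr (-1-\<eta>))"
    using \<eta> by (intro suminf_mult summable_Suc_powr) auto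
  finally show "norm (zetaY s) \<le> 1 + 2 * (\<Sum>n. real (Suc n) powr (-1-\<eta>)) * norm (s - 1) * norm s powr (2 * \<eta>)"
    unfolding zetaY_def using norm_triangle_ineq[of 1 "\<Sum>n. zterm n s"] by (simp add: mult_ac)
qed

section \<open>Nonvanishing and the 3-4-1 inequality to the right of 1\<close>

lemma zeta_nonzero: "Re s > 1 \<Longrightarrow> zeta s \<noteq> 0"
  using D_mu_0_zeta[of s] by auto

text \<open>The two sides have the same logarithmic derivative on a convex set. The constant can
  stay unknown: for the 3-4-1 inequality only \<open>c \<noteq> 0\<close> matters.\<close>

lemma zeta_eq_exp: "\<exists>c. c \<noteq> 0 \<and> (\<forall>s. Re s > 1 \<longrightarrow> zeta s = c * exp (log_zeta s))"
proof -
  let ?S = "{s. Re s > 1}"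
  have "\<exists>c. \<forall>s\<in>?S. zeta s * exp (- log_zeta s) = c"
  proof (rule has_field_derivative_zero_constant)
    fix s assume "s \<in> ?S"
    hence "((\<lambda>s. zeta s * exp (- log_zeta s)) has_field_derivative 0) (at s)"
      by (auto intro!: derivative_eq_intros has_field_derivative_zeta has_field_derivative_log_zeta simp: algebra_simps)
    thus "((\<lambda>s. zeta s * exp (- log_zeta s)) has_field_derivative 0) (at s within ?S)"
      by (rule has_field_derivative_at_within)
  qed (rule convex_halfspace_Re_gt)
  then obtain c where c: "\<And>s. Re s > 1 \<Longrightarrow> zeta s * exp (- log_zeta s) = c" by auto
  have "zeta s = c * exp (log_zeta s)" if "Re s > 1" for s
    using c[OF that] by (auto simp: exp_minus field_simps)
  moreover have "c \<noteq> 0" using c[of 2] zeta_nonzero[of 2] by auto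
  ultimately show ?thesis by blast
qed

lemma cos_341: "3 + 4 * cos x + cos (2 * x) \<ge> (0::real)"
proof -
  have "3 + 4 * cos x + cos (2 * x) = 2 * (1 + cos x)\<^sup>2" 
    unfolding cos_double_cos by (simp add: power2_eq_square algebra_simps)
  thus ?thesis by simp
qed

text \<open>The coefficients of \<open>log_zeta\<close> are nonnegative reals, so
  \<open>cos_341\<close>, applied with the angle \<open>t * ln n\<close>, makes every term of the
  combined series nonnegative.\<close>

lemma log_zeta_341:
  assumes "\<sigma> > 1"
  shows "0 \<le> 3 * Re (log_zeta (of_real \<sigma>)) + 4 * Re (log_zeta (Complex \<sigma> t)) + Re (log_zeta (Complex \<sigma> (2 * t)))"
proof -
  define a where "a n = (if primepow n then 1 / real (big_omega n) else 0)" for n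
  have a: "ppow n / of_nat (big_omega n) = of_real (a n)" for n by (simp add: a_def ppow_def)
  have re: "(\<lambda>n. a n * real n powr (-\<sigma>) * cos (x * ln (real n))) sums Re (log_zeta (Complex \<sigma> x))" for x
  proof -
    have "(\<lambda>n. Re (ppow n / of_nat (big_omega n) * of_nat n powr (-Complex \<sigma> x))) sums Re (log_zeta (Complex \<sigma> x))"
      unfolding log_zeta_def by (intro sums_Re dser_sums[OF abs_conv_log_zeta]) (use assms in auto)
    moreover have "Re (ppow n / of_nat (big_omega n) * of_nat n powr (-Complex \<sigma> x)) = a n * real n powr (-\<sigma>) * cos (x * ln (real n))" for n
      by (cases "n = 0") (auto simp: a powr_def Ln_of_nat Re_exp)
    ultimately show ?thesis by simp
  qed
  have S: "(\<lambda>n. 3 * (a n * real n powr (-\<sigma>) * cos (0 * ln (real n))) + 4 * (a n * real n powr (-\<sigma>) * cos (t * ln (real n))) + 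
          a n * real n powr (-\<sigma>) * cos (2 * t * ln (real n))) sums
        (3 * Re (log_zeta (Complex \<sigma> 0)) + 4 * Re (log_zeta (Complex \<sigma> t)) + Re (log_zeta (Complex \<sigma> (2 * t))))"
    by (intro sums_add sums_mult re)
  have P: "0 \<le> 3 * (a n * real n powr (-\<sigma>) * cos (0 * ln (real n))) + 4 * (a n * real n powr (-\<sigma>) * cos (t * ln (real n))) + 
          a n * real n powr (-\<sigma>) * cos (2 * t * ln (real n))" for n
  proof -
    have "0 \<le> (a n * real n powr (-\<sigma>)) * (3 + 4 * cos (t * ln (real n)) + cos (2 * (t * ln (real n))))"
      by (intro mult_nonneg_nonneg cos_341) (auto simp: a_def)
    thus ?thesis by (simp add: algebra_simps)
  qed
  from sums_le[OF P sums_zero S] show ?thesis by (simp add: complex_of_real_def)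
qed

lemma zeta_341: "\<exists>c>0. \<forall>\<sigma>>1. \<forall>t. norm (zeta (of_real \<sigma>)) ^ 3 * norm (zeta (Complex \<sigma> t)) ^ 4 * norm (zeta (Complex \<sigma> (2 * t))) \<ge> c"
proof -
  obtain c where c: "c \<noteq> 0" "\<And>s. Re s > 1 \<Longrightarrow> zeta s = c * exp (log_zeta s)" using zeta_eq_exp by blast
  show ?thesis
  \<comment> \<open>One factor \<open>norm c\<close> for each of the \<open>3 + 4 + 1\<close> values
    of \<open>zeta\<close>.\<close>
  proof (intro exI[of _ "norm c ^ 8"] conjI allI impI)
    fix \<sigma> t :: real assume \<sigma>: "\<sigma> > 1"
    have eq: "(k * exp x) ^ 3 * (k * exp y) ^ 4 * (k * exp z) = k ^ 8 * exp (3 * x + 4 * y + z)" for k x y z :: real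
    proof -
      have "exp (3 * x + 4 * y + z) = exp x ^ 3 * exp y ^ 4 * exp z"
        using exp_of_nat_mult[of 3 x] exp_of_nat_mult[of 4 y] by (simp add: exp_add)
      moreover have "(k * a) ^ 3 * (k * b) ^ 4 * (k * d) = k ^ 8 * (a ^ 3 * b ^ 4 * d)" for a b d :: real
        by (simp add: power_mult_distrib) (simp add: eval_nat_numeral)
      ultimately show ?thesis by (simp only:)
    qed
    have n: "norm (zeta s) = norm c * exp (Re (log_zeta s))" if "Re s > 1" for s
      by (simp add: c(2)[OF that] norm_mult)
    have "norm (zeta (of_real \<sigma>)) ^ 3 * norm (zeta (Complex \<sigma> t)) ^ 4 * norm (zeta (Complex \<sigma> (2 * t))) =
       norm c ^ 8 * exp (3 * Re (log_zeta (of_real \<sigma>)) + 4 * Re (log_zeta (Complex \<sigma> t)) + Re (log_zeta (Complex \<sigma> (2 * t))))"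
      using \<sigma> by (subst (1 2 3) n) (simp_all only: eq, auto)
    also have "\<dots> \<ge> norm c ^ 8 * 1"
      using log_zeta_341[OF \<sigma>, of t] by (intro mult_left_mono) auto
    finally show "norm c ^ 8 \<le> norm (zeta (of_real \<sigma>)) ^ 3 * norm (zeta (Complex \<sigma> t)) ^ 4 * norm (zeta (Complex \<sigma> (2 * t)))"
      by simp
  qed (use c in auto)
qed


section \<open>Functions with subpolynomial growth on vertical lines\<close>

text \<open>The bound is uniform up to the line \<open>Re s = 1\<close> without involving values on
  it; \<open>t0\<close> cuts out the pole at 1. Recording each order \<open>n\<close> separately
  allows an induction on the order in \<open>slow_inverse\<close>.\<close>

definition slow_at :: "real \<Rightarrow> nat \<Rightarrow> (complex \<Rightarrow> complex) \<Rightarrow> bool" where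
  "slow_at t0 n f \<longleftrightarrow> (\<forall>e>0. \<exists>C\<ge>0. \<forall>s. 1 < Re s \<and> Re s \<le> 2 \<and> t0 \<le> \<bar>Im s\<bar> \<longrightarrow> 
     norm ((deriv ^^ n) f s) \<le> C * (1 + \<bar>Im s\<bar>) powr e)"

definition slow :: "real \<Rightarrow> (complex \<Rightarrow> complex) \<Rightarrow> bool" where
  "slow t0 f \<longleftrightarrow> f holomorphic_on {s. Re s > 1} \<and> (\<forall>n. slow_at t0 n f)"

lemma slow_atD:
  assumes "slow_at t0 n f" "e > 0"
  obtains C where "C \<ge> 0" "\<And>s. 1 < Re s \<Longrightarrow> Re s \<le> 2 \<Longrightarrow> t0 \<le> \<bar>Im s\<bar> \<Longrightarrow> norm ((deriv ^^ n) f s) \<le> C * (1 + \<bar>Im s\<bar>) powr e"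
  using assms unfolding slow_at_def by blast

lemma open_Re_gt_1: "open {s. Re s > 1}" by (rule open_halfspace_Re_gt)

lemma slow_at_cong:
  assumes "f holomorphic_on {s. Re s > 1}" "\<And>s. Re s > 1 \<Longrightarrow> f s = g s" "slow_at t0 n f"
  shows "slow_at t0 n g"
proof -
  have "g holomorphic_on {s. Re s > 1}" using assms(2) by (intro holomorphic_transform[OF assms(1)]) auto
  hence "(deriv ^^ n) g s = (deriv ^^ n) f s" if "Re s > 1" for s
    by (rule higher_deriv_transform_within_open[OF _ assms(1) open_Re_gt_1]) (use that assms(2) in auto)
  thus ?thesis using assms(3) by (simp add: slow_at_def)
qed

lemma slow_cong:
  assumes "slow t0 f" "\<And>s. Re s > 1 \<Longrightarrow> f s = g s"
  shows "slow t0 g"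
  using assms slow_at_cong[of f g] unfolding slow_def
  by (auto intro: holomorphic_transform[of f])

lemma slow_at_add:
  assumes "f holomorphic_on {s. Re s > 1}" "g holomorphic_on {s. Re s > 1}" "slow_at t0 n f" "slow_at t0 n g"
  shows "slow_at t0 n (\<lambda>s. f s + g s)"
  unfolding slow_at_def
proof (intro allI impI)
  fix e :: real assume e: "e > 0"
  obtain C D where C: "C \<ge> 0" "\<And>s. 1 < Re s \<Longrightarrow> Re s \<le> 2 \<Longrightarrow> t0 \<le> \<bar>Im s\<bar> \<Longrightarrow> norm ((deriv ^^ n) f s) \<le> C * (1 + \<bar>Im s\<bar>) powr e"
    and D: "D \<ge> 0" "\<And>s. 1 < Re s \<Longrightarrow> Re s \<le> 2 \<Longrightarrow> t0 \<le> \<bar>Im s\<bar> \<Longrightarrow> norm ((deriv ^^ n) g s) \<le> D * (1 + \<bar>Im s\<bar>) powr e"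
    using slow_atD[OF assms(3) e] slow_atD[OF assms(4) e] by metis
  show "\<exists>C\<ge>0. \<forall>s. 1 < Re s \<and> Re s \<le> 2 \<and> t0 \<le> \<bar>Im s\<bar> \<longrightarrow> 
     norm ((deriv ^^ n) (\<lambda>s. f s + g s) s) \<le> C * (1 + \<bar>Im s\<bar>) powr e"
  proof (intro exI[of _ "C + D"] conjI allI impI)
    fix s assume s: "1 < Re s \<and> Re s \<le> 2 \<and> t0 \<le> \<bar>Im s\<bar>"
    have "(deriv ^^ n) (\<lambda>s. f s + g s) s = (deriv ^^ n) f s + (deriv ^^ n) g s"
      by (rule higher_deriv_add[OF assms(1,2) open_Re_gt_1]) (use s in auto)
    also have "norm \<dots> \<le> norm ((deriv ^^ n) f s) + norm ((deriv ^^ n) g s)" by (rule norm_triangle_ineq)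
    also have "\<dots> \<le> C * (1 + \<bar>Im s\<bar>) powr e + D * (1 + \<bar>Im s\<bar>) powr e"
      using s by (intro add_mono C D) auto
    finally show "norm ((deriv ^^ n) (\<lambda>s. f s + g s) s) \<le> (C + D) * (1 + \<bar>Im s\<bar>) powr e"
      by (simp add: algebra_simps)
  qed (use C D in auto)
qed

lemma slow_add: "slow t0 f \<Longrightarrow> slow t0 g \<Longrightarrow> slow t0 (\<lambda>s. f s + g s)"
  by (auto simp: slow_def intro!: slow_at_add holomorphic_intros)

lemma slow_at_mult:
  assumes "f holomorphic_on {s. Re s > 1}" "g holomorphic_on {s. Re s > 1}" 
    "\<And>i. i \<le> n \<Longrightarrow> slow_at t0 i f" "\<And>i. i \<le> n \<Longrightarrow> slow_at t0 i g"
  shows "slow_at t0 n (\<lambda>s. f s * g s)"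
  unfolding slow_at_def
proof (intro allI impI)
  fix e :: real assume e: "e > 0"
  hence e2: "e / 2 > 0" by simp
  have "\<forall>i\<in>{..n}. \<exists>C\<ge>0. \<forall>s. 1 < Re s \<and> Re s \<le> 2 \<and> t0 \<le> \<bar>Im s\<bar> \<longrightarrow> 
     norm ((deriv ^^ i) f s) \<le> C * (1 + \<bar>Im s\<bar>) powr (e/2)" using assms(3) e2 by (auto simp: slow_at_def)
  then obtain C where C: "\<And>i. i \<le> n \<Longrightarrow> C i \<ge> 0" "\<And>i s. i \<le> n \<Longrightarrow> 1 < Re s \<and> Re s \<le> 2 \<and> t0 \<le> \<bar>Im s\<bar> \<Longrightarrow> 
     norm ((deriv ^^ i) f s) \<le> C i * (1 + \<bar>Im s\<bar>) powr (e/2)" by (auto dest!: bchoice)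
  have "\<forall>i\<in>{..n}. \<exists>C\<ge>0. \<forall>s. 1 < Re s \<and> Re s \<le> 2 \<and> t0 \<le> \<bar>Im s\<bar> \<longrightarrow> 
     norm ((deriv ^^ i) g s) \<le> C * (1 + \<bar>Im s\<bar>) powr (e/2)" using assms(4) e2 by (auto simp: slow_at_def)
  then obtain D where D: "\<And>i. i \<le> n \<Longrightarrow> D i \<ge> 0" "\<And>i s. i \<le> n \<Longrightarrow> 1 < Re s \<and> Re s \<le> 2 \<and> t0 \<le> \<bar>Im s\<bar> \<Longrightarrow> 
     norm ((deriv ^^ i) g s) \<le> D i * (1 + \<bar>Im s\<bar>) powr (e/2)" by (auto dest!: bchoice)
  define K where "K = (\<Sum>i=0..n. real (n choose i) * C i * D (n - i))"
  show "\<exists>C\<ge>0. \<forall>s. 1 < Re s \<and> Re s \<le> 2 \<and> t0 \<le> \<bar>Im s\<bar> \<longrightarrow> 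
     norm ((deriv ^^ n) (\<lambda>s. f s * g s) s) \<le> C * (1 + \<bar>Im s\<bar>) powr e"
  proof (intro exI[of _ K] conjI allI impI)
    show "K \<ge> 0" unfolding K_def using C(1) D(1) by (intro sum_nonneg) auto
    fix s assume s: "1 < Re s \<and> Re s \<le> 2 \<and> t0 \<le> \<bar>Im s\<bar>"
    have "(deriv ^^ n) (\<lambda>s. f s * g s) s = (\<Sum>i=0..n. of_nat (n choose i) * (deriv ^^ i) f s * (deriv ^^ (n - i)) g s)"
      by (rule higher_deriv_mult[OF assms(1,2) open_Re_gt_1]) (use s in auto)
    also have "norm \<dots> \<le> (\<Sum>i=0..n. real (n choose i) * C i * D (n - i) * (1 + \<bar>Im s\<bar>) powr e)"
    proof (rule sum_norm_le)
      fix i assume i: "i \<in> {0..n}"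
      have "norm (of_nat (n choose i) * (deriv ^^ i) f s * (deriv ^^ (n - i)) g s) \<le> 
          real (n choose i) * (C i * (1 + \<bar>Im s\<bar>) powr (e/2)) * (D (n - i) * (1 + \<bar>Im s\<bar>) powr (e/2))"
        unfolding norm_mult norm_of_nat using i s C(1)[of i]
        by (intro mult_mono C(2) D(2)) auto
      also have "\<dots> = real (n choose i) * C i * D (n - i) * ((1 + \<bar>Im s\<bar>) powr (e/2) * (1 + \<bar>Im s\<bar>) powr (e/2))" by simp
      also have "(1 + \<bar>Im s\<bar>) powr (e/2) * (1 + \<bar>Im s\<bar>) powr (e/2) = (1 + \<bar>Im s\<bar>) powr e"
        by (simp flip: powr_add)
      finally show "norm (of_nat (n choose i) * (deriv ^^ i) f s * (deriv ^^ (n - i)) g s) \<le> 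
        real (n choose i) * C i * D (n - i) * (1 + \<bar>Im s\<bar>) powr e" .
    qed
    also have "\<dots> = K * (1 + \<bar>Im s\<bar>) powr e" by (simp add: K_def sum_distrib_right)
    finally show "norm ((deriv ^^ n) (\<lambda>s. f s * g s) s) \<le> K * (1 + \<bar>Im s\<bar>) powr e" .
  qed
qed

lemma slow_mult: "slow t0 f \<Longrightarrow> slow t0 g \<Longrightarrow> slow t0 (\<lambda>s. f s * g s)"
  by (auto simp: slow_def intro!: slow_at_mult holomorphic_intros)

lemma slow_deriv: "slow t0 f \<Longrightarrow> slow t0 (deriv f)"
  unfolding slow_def slow_at_def
  by (auto intro!: holomorphic_deriv open_Re_gt_1 simp del: funpow.simps simp flip: funpow_Suc_right[THEN fun_cong, unfolded o_def])

text \<open>A bound slightly to the left of the line gives all derivatives on its right by Cauchy's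
  estimates on discs of fixed radius. The width \<open>\<eta>\<close> may depend on
  \<open>e\<close>, as it must for \<open>zeta\<close>, whose growth exponent is proportional to the
  distance from the line.\<close>

lemma slow_of_bound:
  assumes t0: "t0 > 0" and \<eta>0: "\<eta>0 > 0"
    and hol: "f holomorphic_on {s. Re s > 1 - \<eta>0} - {1}"
    and bd: "\<And>e. e > 0 \<Longrightarrow> \<exists>\<eta> C. 0 < \<eta> \<and> \<eta> < \<eta>0 \<and> C \<ge> 0 \<and> (\<forall>s. 1 - \<eta> \<le> Re s \<and> Re s \<le> 3 \<and> t0 / 2 \<le> \<bar>Im s\<bar> \<longrightarrow> 
           norm (f s) \<le> C * (1 + \<bar>Im s\<bar>) powr e)"
  shows "slow t0 f"
  unfolding slow_def
proof (intro conjI allI)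
  show "f holomorphic_on {s. Re s > 1}" using \<eta>0 by (intro holomorphic_on_subset[OF hol]) auto
  fix n
  show "slow_at t0 n f"
    unfolding slow_at_def
  proof (intro allI impI)
    fix e :: real assume e: "e > 0"
    obtain \<eta> C where \<eta>: "0 < \<eta>" "\<eta> < \<eta>0" and C: "C \<ge> 0" "\<And>s. 1 - \<eta> \<le> Re s \<Longrightarrow> Re s \<le> 3 \<Longrightarrow> t0 / 2 \<le> \<bar>Im s\<bar> \<Longrightarrow> norm (f s) \<le> C * (1 + \<bar>Im s\<bar>) powr e"
      using bd[OF e] by auto
    \<comment> \<open>The three entries keep the disc to the right of \<open>1 - \<eta>\<close>, at
      height at least \<open>t0 / 2\<close> and thus away from the pole, and to the left of
      3.\<close>
    define r where "r = Min {\<eta>, t0 / 2, 1}"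
    have r: "r > 0" "r \<le> \<eta>" "r \<le> t0 / 2" "r \<le> 1" using t0 \<eta> by (auto simp: r_def)
    define K where "K = fact n * (C * 2 powr e) / r ^ n"
    show "\<exists>C\<ge>0. \<forall>s. 1 < Re s \<and> Re s \<le> 2 \<and> t0 \<le> \<bar>Im s\<bar> \<longrightarrow> norm ((deriv ^^ n) f s) \<le> C * (1 + \<bar>Im s\<bar>) powr e"
    proof (intro exI[of _ K] conjI allI impI)
      show "K \<ge> 0" using r C by (auto simp: K_def)
      fix s assume s: "1 < Re s \<and> Re s \<le> 2 \<and> t0 \<le> \<bar>Im s\<bar>"
      have w: "1 - \<eta> \<le> Re w" "Re w \<le> 3" "t0 / 2 \<le> \<bar>Im w\<bar>" "\<bar>Im w\<bar> \<le> \<bar>Im s\<bar> + 1" if "w \<in> cball s r" for w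
      proof -
        have "\<bar>Re (s - w)\<bar> \<le> r" "\<bar>Im (s - w)\<bar> \<le> r"
          using that abs_Re_le_cmod[of "s - w"] abs_Im_le_cmod[of "s - w"] by (auto simp: dist_norm)
        thus "1 - \<eta> \<le> Re w" "Re w \<le> 3" "t0 / 2 \<le> \<bar>Im w\<bar>" "\<bar>Im w\<bar> \<le> \<bar>Im s\<bar> + 1" using s r by auto
      qed
      have sub: "cball s r \<subseteq> {s. Re s > 1 - \<eta>0} - {1}"
      proof
        fix x assume "x \<in> cball s r"
        from w[OF this] show "x \<in> {s. Re s > 1 - \<eta>0} - {1}" using t0 \<eta> by auto
      qed
      have "norm ((deriv ^^ n) f s) \<le> fact n * (C * 2 powr e * (1 + \<bar>Im s\<bar>) powr e) / r ^ n"
      proof (rule Cauchy_inequality)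
        show "f holomorphic_on ball s r" by (rule holomorphic_on_subset[OF hol]) (use sub ball_subset_cball in blast)
        show "continuous_on (cball s r) f" 
          by (rule holomorphic_on_imp_continuous_on[OF holomorphic_on_subset[OF hol sub]])
        fix x assume "norm (s - x) = r"
        hence x: "x \<in> cball s r" by (simp add: dist_norm)
        have "norm (f x) \<le> C * (1 + \<bar>Im x\<bar>) powr e" using w[OF x] by (intro C) auto
        also have "\<dots> \<le> C * (2 * (1 + \<bar>Im s\<bar>)) powr e"
          using w[OF x] C e by (intro mult_left_mono powr_mono2) auto
        also have "(2 * (1 + \<bar>Im s\<bar>)) powr e = 2 powr e * (1 + \<bar>Im s\<bar>) powr e" by (rule powr_mult)
        finally show "norm (f x) \<le> C * 2 powr e * (1 + \<bar>Im s\<bar>) powr e" by (simp add: mult.assoc)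
      qed (use r in auto)
      thus "norm ((deriv ^^ n) f s) \<le> K * (1 + \<bar>Im s\<bar>) powr e" by (simp add: K_def)
    qed
  qed
qed

lemma slow_of_bounded:
  assumes "t0 > 0" "\<eta>0 > 0" "f holomorphic_on {s. Re s > 1 - \<eta>0}" "\<And>s. Re s \<ge> 1 - \<eta>0 / 2 \<Longrightarrow> norm (f s) \<le> C" "C \<ge> 0"
  shows "slow t0 f"
proof (rule slow_of_bound[OF assms(1,2)])
  show "f holomorphic_on {s. Re s > 1 - \<eta>0} - {1}" by (rule holomorphic_on_subset[OF assms(3)]) auto
  fix e :: real assume "e > 0"
  show "\<exists>\<eta> C. 0 < \<eta> \<and> \<eta> < \<eta>0 \<and> C \<ge> 0 \<and> (\<forall>s. 1 - \<eta> \<le> Re s \<and> Re s \<le> 3 \<and> t0 / 2 \<le> \<bar>Im s\<bar> \<longrightarrow> norm (f s) \<le> C * (1 + \<bar>Im s\<bar>) powr e)"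
  proof (rule exI[of _ "\<eta>0/2"], rule exI[of _ C], intro conjI allI impI)
    fix s assume s: "1 - \<eta>0 / 2 \<le> Re s \<and> Re s \<le> 3 \<and> t0 / 2 \<le> \<bar>Im s\<bar>"
    hence "norm (f s) \<le> C * 1" using assms(4)[of s] by simp
    also have "\<dots> \<le> C * (1 + \<bar>Im s\<bar>) powr e" using \<open>e > 0\<close> assms(5) by (intro mult_left_mono ge_one_powr_ge_zero) auto
    finally show "norm (f s) \<le> C * (1 + \<bar>Im s\<bar>) powr e" .
  qed (use assms in auto)
qed

lemma slow_const: "t0 > 0 \<Longrightarrow> slow t0 (\<lambda>_. c)"
  by (rule slow_of_bounded[of _ 1 _ "norm c"]) auto

lemma slow_uminus: "t0 > 0 \<Longrightarrow> slow t0 f \<Longrightarrow> slow t0 (\<lambda>s. - f s)"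
  using slow_mult[OF slow_const[of t0 "-1"], of f] by simp

lemma slow_sum: "t0 > 0 \<Longrightarrow> (\<And>i. i \<in> A \<Longrightarrow> slow t0 (f i)) \<Longrightarrow> slow t0 (\<lambda>s. \<Sum>i\<in>A. f i s)"
  by (induction A rule: infinite_finite_induct) (auto intro: slow_const slow_add)

lemma slow_inverse_id: 
  assumes "t0 > 0" shows "slow t0 (\<lambda>s. 1 / s)"
proof (rule slow_of_bounded[OF assms, of 1 _ 2])
  fix s :: complex assume "Re s \<ge> 1 - 1 / 2"
  hence "norm s \<ge> 1/2" using abs_Re_le_cmod[of s] by linarith
  thus "norm (1 / s) \<le> 2" by (auto simp: norm_divide divide_simps)
qed (auto intro!: holomorphic_intros)

lemma slow_D_corr: 
  assumes "t0 > 0" shows "slow t0 (D_corr k)"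
proof (rule slow_of_bounded[OF assms, of "1/2" _ "\<Sum>n. norm (ppow n * (of_nat (big_omega n) ^ k - 1 / of_nat (big_omega n))) * real n powr (-3/4)"])
  show "D_corr k holomorphic_on {s. Re s > 1 - 1/2}"
    using holomorphic_dser[OF abs_conv_D_corr[of k]] by (simp add: D_corr_def)
  show "0 \<le> (\<Sum>n. norm (ppow n * (of_nat (big_omega n) ^ k - 1 / of_nat (big_omega n))) * real n powr (-3/4))"
    using abs_conv_D_corr[of k, unfolded abs_conv_def, rule_format, of "3/4"] by (intro suminf_nonneg) auto
  fix s assume "Re s \<ge> 1 - 1 / 2 / 2"
  thus "norm (D_corr k s) \<le> (\<Sum>n. norm (ppow n * (of_nat (big_omega n) ^ k - 1 / of_nat (big_omega n))) * real n powr (-3/4))"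
    using norm_dser_le[OF abs_conv_D_corr, of "3/4" s k] by (simp add: D_corr_def)
qed auto

text \<open>In \<open>zetaY s / (s - 1)\<close> the factor \<open>norm (s - 1)\<close> of the bound
  for \<open>zetaY\<close> cancels, which leaves the power
  \<open>2 * \<eta> \<le> e\<close>.\<close>

lemma slow_zeta:
  assumes t0: "t0 > 0" shows "slow t0 zeta"
proof -
  have "slow t0 (\<lambda>s. zetaY s / (s - 1))"
  proof (rule slow_of_bound[OF t0, of 1])
    show "(\<lambda>s. zetaY s / (s - 1)) holomorphic_on {s. Re s > 1 - 1} - {1}"
      by (intro holomorphic_intros holomorphic_on_subset[OF holomorphic_zetaY]) auto
    fix e :: real assume e: "e > 0"
    define \<eta> where "\<eta> = min (e / 2) (1 / 2)"
    have \<eta>: "\<eta> \<in> {0<..1/2}" "2 * \<eta> \<le> e" using e by (auto simp: \<eta>_def)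
    obtain C where C: "C \<ge> 0" "\<And>s. Re s \<ge> 1 - \<eta> \<Longrightarrow> norm (zetaY s) \<le> 1 + C * norm (s - 1) * norm s powr (2 * \<eta>)"
      using zetaY_bound[OF \<eta>(1)] by auto
    define K where "K = 2 / t0 + C * 3 powr e"
    show "\<exists>\<eta> C. 0 < \<eta> \<and> \<eta> < 1 \<and> C \<ge> 0 \<and> (\<forall>s. 1 - \<eta> \<le> Re s \<and> Re s \<le> 3 \<and> t0 / 2 \<le> \<bar>Im s\<bar> \<longrightarrow> 
       norm (zetaY s / (s - 1)) \<le> C * (1 + \<bar>Im s\<bar>) powr e)"
    proof (rule exI[of _ \<eta>], rule exI[of _ K], intro conjI allI impI)
      show "K \<ge> 0" using t0 C(1) by (auto simp: K_def)
      fix s assume s: "1 - \<eta> \<le> Re s \<and> Re s \<le> 3 \<and> t0 / 2 \<le> \<bar>Im s\<bar>"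
      have n1: "norm (s - 1) \<ge> t0 / 2" using s abs_Im_le_cmod[of "s - 1"] by simp
      hence n1': "norm (s - 1) > 0" using t0 by linarith
      have "norm s \<le> \<bar>Re s\<bar> + \<bar>Im s\<bar>" by (rule cmod_le)
      hence ns: "norm s \<le> 3 * (1 + \<bar>Im s\<bar>)" using s \<eta> by auto
      have p1: "(1 + \<bar>Im s\<bar>) powr e \<ge> 1" using e by (intro ge_one_powr_ge_zero) auto
      have "norm (zetaY s / (s - 1)) \<le> (1 + C * norm (s - 1) * norm s powr (2 * \<eta>)) / norm (s - 1)"
        unfolding norm_divide using s by (intro divide_right_mono C) auto
      also have "\<dots> = 1 / norm (s - 1) + C * norm s powr (2 * \<eta>)" using n1' by (auto simp: field_simps)
      also have "\<dots> \<le> 1 / (t0 / 2) + C * (3 * (1 + \<bar>Im s\<bar>)) powr (2 * \<eta>)"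
        using n1 n1' ns t0 \<eta> C(1) by (intro add_mono mult_left_mono powr_mono2 divide_left_mono mult_pos_pos) auto
      also have "\<dots> \<le> 1 / (t0 / 2) + C * (3 * (1 + \<bar>Im s\<bar>)) powr e"
        using \<eta> C(1) by (intro add_mono mult_left_mono powr_mono) auto
      also have "1 / (t0 / 2) + C * (3 * (1 + \<bar>Im s\<bar>)) powr e = 2 / t0 * 1 + C * 3 powr e * (1 + \<bar>Im s\<bar>) powr e"
        by (subst powr_mult) auto
      also have "\<dots> \<le> 2 / t0 * (1 + \<bar>Im s\<bar>) powr e + C * 3 powr e * (1 + \<bar>Im s\<bar>) powr e"
        using p1 t0 C(1) by (intro add_mono mult_left_mono) auto
      finally show "norm (zetaY s / (s - 1)) \<le> K * (1 + \<bar>Im s\<bar>) powr e"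
        using C(1) by (simp add: K_def algebra_simps)
    qed (use \<eta> in auto)
  qed auto
  thus ?thesis by (rule slow_cong) (auto simp: zetaY_eq)
qed

text \<open>Nothing is known about \<open>1 / f\<close> to the left of the line, so Cauchy's
  estimates do not apply. Instead the derivative of \<open>g = 1 / f\<close> is
  \<open>- deriv f * (g * g)\<close>, which reduces order \<open>m + 1\<close> of \<open>g\<close>
  to orders at most \<open>m\<close>; only order 0 has to be supplied.\<close>

lemma slow_inverse:
  assumes t0: "t0 > 0" and f: "slow t0 f" and nz: "\<And>s. Re s > 1 \<Longrightarrow> f s \<noteq> 0" 
    and bd: "slow_at t0 0 (\<lambda>s. 1 / f s)"
  shows "slow t0 (\<lambda>s. 1 / f s)"
proof -
  let ?S = "{s. Re s > 1}"
  let ?g = "\<lambda>s. 1 / f s"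
  have hf: "f holomorphic_on ?S" using f by (simp add: slow_def)
  have hg: "?g holomorphic_on ?S" using hf nz by (intro holomorphic_intros) auto
  have hd: "deriv f holomorphic_on ?S" by (rule holomorphic_deriv[OF hf open_Re_gt_1])
  have "slow_at t0 n ?g" for n
  proof (induction n rule: less_induct)
    case (less n)
    show ?case
    proof (cases n)
      case (Suc m)
      have hm: "(\<lambda>s. - deriv f s * (?g s * ?g s)) holomorphic_on ?S" by (rule holomorphic_on_mult[OF holomorphic_on_minus[OF hd] holomorphic_on_mult[OF hg hg]])
      have "slow t0 (\<lambda>s. - deriv f s)" by (rule slow_uminus[OF t0 slow_deriv[OF f]])
      hence h1: "(\<lambda>s. - deriv f s) holomorphic_on ?S" "\<And>i. slow_at t0 i (\<lambda>s. - deriv f s)" 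
        by (auto simp: slow_def)
      have h2: "(\<lambda>s. ?g s * ?g s) holomorphic_on ?S" by (rule holomorphic_on_mult[OF hg hg])
      have h3: "slow_at t0 i (\<lambda>s. ?g s * ?g s)" if "i \<le> m" for i
        by (rule slow_at_mult[OF hg hg]) (use less.IH Suc that in auto)
      have "slow_at t0 m (\<lambda>s. - deriv f s * (?g s * ?g s))"
        by (rule slow_at_mult[OF h1(1) h2 h1(2) h3])
      moreover have eq: "- deriv f s * (?g s * ?g s) = deriv ?g s" if "Re s > 1" for s
      proof -
        have "(f has_field_derivative deriv f s) (at s)"
          using holomorphic_derivI[OF hf open_Re_gt_1] that by auto
        hence "(?g has_field_derivative - deriv f s * (?g s * ?g s)) (at s)"
          using nz[OF that] by (intro DERIV_cong[OF DERIV_divide[OF DERIV_const]]) auto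
        thus ?thesis by (rule DERIV_imp_deriv [symmetric])
      qed
      ultimately have "slow_at t0 m (deriv ?g)" by (intro slow_at_cong[OF hm eq])
      thus ?thesis unfolding slow_at_def Suc funpow_Suc_right o_def .
    qed (use bd in auto)
  qed
  thus ?thesis using hg by (simp add: slow_def)
qed


section \<open>Growth of the Dirichlet series in question\<close>

lemma holomorphic_horizontal_bound:
  assumes hol: "f holomorphic_on {s. Re s > 1}" 
    and K: "\<And>z. Im z = t \<Longrightarrow> 1 < Re z \<Longrightarrow> Re z \<le> 2 \<Longrightarrow> norm (deriv f z) \<le> K"
    and "Im x = t" "1 < Re x" "Re x \<le> 2" "Im y = t" "1 < Re y" "Re y \<le> 2"
  shows "norm (f x - f y) \<le> K * norm (x - y)"
proof (rule field_differentiable_bound[of "{z. Im z = t} \<inter> {z. Re z > 1} \<inter> {z. Re z \<le> 2}" _ "deriv f"])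
  show "convex ({z. Im z = t} \<inter> {z. Re z > 1} \<inter> {z. Re z \<le> 2})"
    by (intro convex_Int convex_halfspace_Re_gt convex_halfspace_Re_le)
       (auto intro!: convexI simp: algebra_simps simp flip: distrib_right)
  fix z assume z: "z \<in> {z. Im z = t} \<inter> {z. Re z > 1} \<inter> {z. Re z \<le> 2}"
  thus "norm (deriv f z) \<le> K" using K[of z] by auto
  show "(f has_field_derivative deriv f z) (at z within {z. Im z = t} \<inter> {z. Re z > 1} \<inter> {z. Re z \<le> 2})"
    by (rule has_field_derivative_at_within, rule holomorphic_derivI[OF hol open_Re_gt_1]) (use z in auto)
qed (use assms in auto)

lemma zeta_real_bound: "\<exists>C>0. \<forall>\<sigma>. 1 < \<sigma> \<and> \<sigma> \<le> 2 \<longrightarrow> norm (zeta (of_real \<sigma>)) \<le> C / (\<sigma> - 1)"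
proof -
  have "continuous_on {1..2} (\<lambda>\<sigma>::real. zetaY (of_real \<sigma>))"
    by (rule continuous_on_compose2[OF holomorphic_on_imp_continuous_on[OF holomorphic_zetaY]])
       (auto intro!: continuous_intros)
  hence "bounded ((\<lambda>\<sigma>::real. zetaY (of_real \<sigma>)) ` {1..2})"
    by (intro compact_imp_bounded compact_continuous_image) auto
  then obtain C where C: "C > 0" "\<And>\<sigma>. \<sigma> \<in> {1..2} \<Longrightarrow> norm (zetaY (of_real \<sigma>)) \<le> C"
    unfolding bounded_pos by auto
  show ?thesis
  proof (intro exI[of _ C] conjI allI impI)
    fix \<sigma> :: real assume s: "1 < \<sigma> \<and> \<sigma> \<le> 2"
    have "zetaY (of_real \<sigma>) = of_real (\<sigma> - 1) * zeta (of_real \<sigma>)" using s by (subst zetaY_eq) auto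
    hence "norm (zetaY (of_real \<sigma>)) = (\<sigma> - 1) * norm (zeta (of_real \<sigma>))"
      using s by (simp only: norm_mult norm_of_real) auto
    thus "norm (zeta (of_real \<sigma>)) \<le> C / (\<sigma> - 1)" using C(2)[of \<sigma>] s by (simp add: field_simps)
  qed fact
qed

lemma zeta_lower_bound_aux:
  fixes X c A B v \<delta> :: real
  assumes "c \<le> (A / \<delta>) ^ 3 * X ^ 4 * (B * v)" "\<delta> > 0" "A > 0" "B > 0" "v > 0"
  shows "c / (A ^ 3 * B) * (\<delta> ^ 3 / v) \<le> X ^ 4"
proof -
  have "c * \<delta> ^ 3 \<le> (A ^ 3 * B) * v * X ^ 4"
    using assms by (simp add: field_simps)
  thus ?thesis using assms by (simp add: field_simps)
qed

text \<open>The 3-4-1 inequality bounds \<open>zeta\<close> from below at distance \<open>\<alpha> ^ 4 (1 + \<bar>t\<bar>) powr (- 5 \<epsilon>)\<close> to the right of the line;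
  closer to the line one integrates the derivative. The exponents are chosen so that both contributions have the
  size \<open>(1 + \<bar>t\<bar>) powr (- 4 \<epsilon>)\<close>.\<close>

lemma slow_at_zeta_inverse:
  assumes t0: "t0 > 0" shows "slow_at t0 0 (\<lambda>s. 1 / zeta s)"
  unfolding slow_at_def
proof (intro allI impI)
  fix e :: real assume e: "e > 0"
  \<comment> \<open>The argument ends with the bound \<open>v ^ 4\<close>, where \<open>v\<close> is
    the power \<open>\<epsilon>\<close> of the height.\<close>
  define \<epsilon> where "\<epsilon> = e / 4"
  have \<epsilon>: "\<epsilon> > 0" using e by (simp add: \<epsilon>_def)
  have hol: "zeta holomorphic_on {s. Re s > 1}" and sl: "\<And>n. slow_at t0 n zeta" 
    using slow_zeta[OF t0] by (auto simp: slow_def)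
  obtain c where c: "c > 0" "\<And>\<sigma> t. \<sigma> > 1 \<Longrightarrow> norm (zeta (of_real \<sigma>)) ^ 3 * norm (zeta (Complex \<sigma> t)) ^ 4 * norm (zeta (Complex \<sigma> (2 * t))) \<ge> c"
    using zeta_341 by blast
  obtain C1 where C1: "C1 > 0" "\<And>\<sigma>. 1 < \<sigma> \<Longrightarrow> \<sigma> \<le> 2 \<Longrightarrow> norm (zeta (of_real \<sigma>)) \<le> C1 / (\<sigma> - 1)"
    using zeta_real_bound by blast
  obtain C2 where C2: "C2 \<ge> 0" "\<And>s. 1 < Re s \<Longrightarrow> Re s \<le> 2 \<Longrightarrow> t0 \<le> \<bar>Im s\<bar> \<Longrightarrow> norm ((deriv ^^ 0) zeta s) \<le> C2 * (1 + \<bar>Im s\<bar>) powr \<epsilon>"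
    using slow_atD[OF sl \<epsilon>] by blast
  obtain C3 where C3: "C3 \<ge> 0" "\<And>s. 1 < Re s \<Longrightarrow> Re s \<le> 2 \<Longrightarrow> t0 \<le> \<bar>Im s\<bar> \<Longrightarrow> norm ((deriv ^^ 1) zeta s) \<le> C3 * (1 + \<bar>Im s\<bar>) powr \<epsilon>"
    using slow_atD[OF sl \<epsilon>] by blast
  \<comment> \<open>\<open>2 powr \<epsilon>\<close> pays for passing from height
    \<open>2 * t\<close> to height \<open>t\<close>; the added 1 makes the constant positive, so
    that it can be divided by.\<close>
  define C2' where "C2' = C2 * 2 powr \<epsilon> + 1"
  have C2': "C2' > 0" using C2(1) by (auto simp: C2'_def intro!: add_nonneg_pos)
  define d where "d = root 4 (c / (C1 ^ 3 * C2'))"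
  have d: "d > 0" "d ^ 4 = c / (C1 ^ 3 * C2')" using c C1(1) C2' by (auto simp: d_def)
  have f1: "norm (zeta (Complex \<sigma> t)) ^ 4 \<ge> d ^ 4 * ((\<sigma> - 1) ^ 3 / (1 + \<bar>t\<bar>) powr \<epsilon>)" 
    if \<sigma>: "1 < \<sigma>" "\<sigma> \<le> 2" and t: "t0 \<le> \<bar>t\<bar>" for \<sigma> t
    unfolding d(2)
  proof (rule zeta_lower_bound_aux)
    have "norm (zeta (Complex \<sigma> (2 * t))) \<le> C2 * (1 + \<bar>2 * t\<bar>) powr \<epsilon>"
      using C2(2)[of "Complex \<sigma> (2 * t)"] \<sigma> t t0 by simp
    also have "\<dots> \<le> C2 * (2 * (1 + \<bar>t\<bar>)) powr \<epsilon>"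
      using \<epsilon> C2(1) by (intro mult_left_mono powr_mono2) auto
    also have "(2 * (1 + \<bar>t\<bar>)) powr \<epsilon> = 2 powr \<epsilon> * (1 + \<bar>t\<bar>) powr \<epsilon>" by (rule powr_mult)
    also have "C2 * (2 powr \<epsilon> * (1 + \<bar>t\<bar>) powr \<epsilon>) \<le> C2' * (1 + \<bar>t\<bar>) powr \<epsilon>"
      by (simp add: C2'_def algebra_simps)
    finally have z2: "norm (zeta (Complex \<sigma> (2 * t))) \<le> C2' * (1 + \<bar>t\<bar>) powr \<epsilon>" .
    have "c \<le> norm (zeta (of_real \<sigma>)) ^ 3 * norm (zeta (Complex \<sigma> t)) ^ 4 * norm (zeta (Complex \<sigma> (2 * t)))"
      by (rule c(2)[OF \<sigma>(1)])
    also have "\<dots> \<le> (C1 / (\<sigma> - 1)) ^ 3 * norm (zeta (Complex \<sigma> t)) ^ 4 * (C2' * (1 + \<bar>t\<bar>) powr \<epsilon>)"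
      using C1 \<sigma> by (intro mult_mono z2 power_mono C1(2)) auto
    finally show "c \<le> (C1 / (\<sigma> - 1)) ^ 3 * norm (zeta (Complex \<sigma> t)) ^ 4 * (C2' * (1 + \<bar>t\<bar>) powr \<epsilon>)" .
  qed (use \<sigma> C1 C2' in auto)
  \<comment> \<open>This gives \<open>C3 * \<alpha> \<le> d / 2\<close>: integrating the derivative
    over the short distance \<open>\<alpha> ^ 4 / v ^ 5\<close> uses up at most half of the lower
    bound at \<open>\<sigma>1\<close>.\<close>
  define \<alpha> where "\<alpha> = min 1 (d / (2 * (C3 + 1)))"
  have \<alpha>: "\<alpha> > 0" "\<alpha> \<le> 1" using d C3(1) by (auto simp: \<alpha>_def)
  have "C3 * \<alpha> \<le> (C3 + 1) * (d / (2 * (C3 + 1)))"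
    using \<alpha> C3(1) d by (intro mult_mono) (auto simp: \<alpha>_def)
  also have "\<dots> = d / 2" using C3(1) by (simp add: field_simps)
  finally have \<alpha>3: "C3 * \<alpha> \<le> d / 2" .
  have f2: "norm (zeta (Complex \<sigma> t)) \<ge> d * \<alpha> ^ 3 / ((1 + \<bar>t\<bar>) powr \<epsilon>) ^ 4" 
    if \<sigma>: "1 + \<alpha> ^ 4 / ((1 + \<bar>t\<bar>) powr \<epsilon>) ^ 5 \<le> \<sigma>" "\<sigma> \<le> 2" and t: "t0 \<le> \<bar>t\<bar>" for \<sigma> t
  proof -
    define v where "v = (1 + \<bar>t\<bar>) powr \<epsilon>"
    have v: "v > 0" by (auto simp: v_def)
    have pos: "\<alpha> ^ 4 / v ^ 5 > 0" using \<alpha> v by auto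
    \<comment> \<open>Here the exponents match: \<open>3 * 4 = 4 * 3\<close> for
      \<open>\<alpha>\<close> and \<open>4 * 4 = 5 * 3 + 1\<close> for \<open>v\<close>.\<close>
    have "(d * \<alpha> ^ 3 / v ^ 4) ^ 4 = d ^ 4 * ((\<alpha> ^ 4 / v ^ 5) ^ 3 / v)"
      using v by (simp add: power_mult_distrib power_divide flip: power_mult) (simp add: eval_nat_numeral)
    also have "\<dots> \<le> d ^ 4 * ((\<sigma> - 1) ^ 3 / v)"
      using \<sigma> pos v d(1) by (intro mult_left_mono divide_right_mono power_mono) (auto simp: v_def)
    also have "\<dots> \<le> norm (zeta (Complex \<sigma> t)) ^ 4"
      using f1[of \<sigma> t] \<sigma> t pos by (auto simp: v_def)
    finally show ?thesis by (simp add: v_def power_mono_iff d \<alpha>(1) less_imp_le)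
  qed
  define K where "K = 2 / (d * \<alpha> ^ 3)"
  show "\<exists>C\<ge>0. \<forall>s. 1 < Re s \<and> Re s \<le> 2 \<and> t0 \<le> \<bar>Im s\<bar> \<longrightarrow> norm ((deriv ^^ 0) (\<lambda>s. 1 / zeta s) s) \<le> C * (1 + \<bar>Im s\<bar>) powr e"
  proof (intro exI[of _ K] conjI allI impI)
    show "K \<ge> 0" using d \<alpha> by (auto simp: K_def)
    fix s assume s: "1 < Re s \<and> Re s \<le> 2 \<and> t0 \<le> \<bar>Im s\<bar>"
    define v where "v = (1 + \<bar>Im s\<bar>) powr \<epsilon>"
    have v: "v \<ge> 1" using \<epsilon> by (auto simp: v_def intro!: ge_one_powr_ge_zero)
    have v4: "(1 + \<bar>Im s\<bar>) powr e = v ^ 4" by (simp add: v_def \<epsilon>_def powr_power)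
    define \<sigma>1 where "\<sigma>1 = 1 + \<alpha> ^ 4 / v ^ 5"
    have "\<alpha> ^ 4 \<le> 1" using \<alpha> by (intro power_le_one) auto
    also have "1 \<le> v ^ 5" using v by (rule one_le_power)
    finally have \<sigma>1: "1 < \<sigma>1" "\<sigma>1 \<le> 2" using \<alpha> v by (auto simp: \<sigma>1_def divide_le_eq)
    have "norm (zeta s) \<ge> d * \<alpha> ^ 3 / 2 / v ^ 4"
    proof (cases "\<sigma>1 \<le> Re s")
      case True
      have "d * \<alpha> ^ 3 / 2 / v ^ 4 \<le> d * \<alpha> ^ 3 / v ^ 4" using d \<alpha> v by (intro divide_right_mono) auto
      also have "\<dots> \<le> norm (zeta (Complex (Re s) (Im s)))"
        using f2[of "Im s" "Re s"] True s by (simp add: \<sigma>1_def v_def)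
      finally show ?thesis by simp
    next
      case False
      define s1 where "s1 = Complex \<sigma>1 (Im s)"
      have "norm (zeta s1 - zeta s) \<le> (C3 * v) * norm (s1 - s)"
      proof (rule holomorphic_horizontal_bound[OF hol, of "Im s"])
        fix z assume "Im z = Im s" "1 < Re z" "Re z \<le> 2"
        thus "norm (deriv zeta z) \<le> C3 * v" using C3(2)[of z] s by (simp add: v_def)
      qed (use s \<sigma>1 in \<open>auto simp: s1_def\<close>)
      also have "s1 - s = of_real (\<sigma>1 - Re s)" by (simp add: s1_def complex_eq_iff)
      also have "(C3 * v) * norm (of_real (\<sigma>1 - Re s) :: complex) \<le> (C3 * v) * (\<alpha> ^ 4 / v ^ 5)"
        unfolding norm_of_real using False s C3 v by (intro mult_left_mono) (auto simp: \<sigma>1_def)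
      also have "\<dots> = (C3 * \<alpha>) * (\<alpha> ^ 3 / v ^ 4)" using v by (simp add: field_simps eval_nat_numeral)
      also have "\<dots> \<le> (d / 2) * (\<alpha> ^ 3 / v ^ 4)" using \<alpha>3 \<alpha> v by (intro mult_right_mono) auto
      finally have 1: "norm (zeta s1 - zeta s) \<le> d / 2 * (\<alpha> ^ 3 / v ^ 4)" .
      have "d * \<alpha> ^ 3 / v ^ 4 \<le> norm (zeta s1)"
        using f2[of "Im s" \<sigma>1] \<sigma>1 s by (simp add: \<sigma>1_def v_def s1_def)
      also have "norm (zeta s1) \<le> norm (zeta s) + norm (zeta s1 - zeta s)" by (metis add.commute diff_add_cancel norm_triangle_ineq)
      also have "\<dots> \<le> norm (zeta s) + d / 2 * (\<alpha> ^ 3 / v ^ 4)" using 1 by simp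
      finally have "d * \<alpha> ^ 3 / v ^ 4 \<le> norm (zeta s) + d / 2 * (\<alpha> ^ 3 / v ^ 4)" .
      moreover have "d / 2 * (\<alpha> ^ 3 / v ^ 4) = d * \<alpha> ^ 3 / 2 / v ^ 4" "d * \<alpha> ^ 3 / v ^ 4 = 2 * (d * \<alpha> ^ 3 / 2 / v ^ 4)" 
        by simp_all
      ultimately show ?thesis by linarith
    qed
    hence "inverse (norm (zeta s)) \<le> inverse (d * \<alpha> ^ 3 / 2 / v ^ 4)"
      using d \<alpha> v by (intro le_imp_inverse_le) auto
    also have "\<dots> = K * v ^ 4" by (simp add: K_def field_simps)
    finally show "norm ((deriv ^^ 0) (\<lambda>s. 1 / zeta s) s) \<le> K * (1 + \<bar>Im s\<bar>) powr e"
      by (simp add: v4 norm_divide inverse_eq_divide)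
  qed
qed

lemma slow_zeta_inverse: "t0 > 0 \<Longrightarrow> slow t0 (\<lambda>s. 1 / zeta s)"
  by (intro slow_inverse slow_zeta slow_at_zeta_inverse zeta_nonzero)

text \<open>Order 0 is recovered by integrating horizontally from \<open>Re s = 2\<close>, where
  absolute convergence bounds \<open>f\<close>. This serves \<open>log_zeta\<close>, for which only
  the derivative is accessible through \<open>zeta\<close> and \<open>1 / zeta\<close>.\<close>

lemma slow_of_deriv:
  assumes t0: "t0 > 0" and hol: "f holomorphic_on {s. Re s > 1}" and sl: "slow t0 (deriv f)" 
    and B: "\<And>t. norm (f (Complex 2 t)) \<le> B"
  shows "slow t0 f"
  unfolding slow_def
proof (intro conjI allI hol)
  fix n show "slow_at t0 n f"
  proof (cases n)
    case (Suc m)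
    have "slow_at t0 m (deriv f)" using sl by (auto simp: slow_def)
    thus ?thesis unfolding slow_at_def Suc funpow_Suc_right o_def .
  next
    case 0
    show ?thesis unfolding slow_at_def
    proof (intro allI impI)
      fix e :: real assume e: "e > 0"
      have "slow_at t0 0 (deriv f)" using sl by (auto simp: slow_def)
      then obtain C where C: "C \<ge> 0" "\<And>s. 1 < Re s \<Longrightarrow> Re s \<le> 2 \<Longrightarrow> t0 \<le> \<bar>Im s\<bar> \<Longrightarrow> norm (deriv f s) \<le> C * (1 + \<bar>Im s\<bar>) powr e"
        using e by (auto elim: slow_atD)
      have B0: "B \<ge> 0" using order.trans[OF norm_ge_zero B[of 0]] .
      show "\<exists>C\<ge>0. \<forall>s. 1 < Re s \<and> Re s \<le> 2 \<and> t0 \<le> \<bar>Im s\<bar> \<longrightarrow> norm ((deriv ^^ n) f s) \<le> C * (1 + \<bar>Im s\<bar>) powr e"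
      proof (intro exI[of _ "B + C"] conjI allI impI)
        fix s assume s: "1 < Re s \<and> Re s \<le> 2 \<and> t0 \<le> \<bar>Im s\<bar>"
        define s1 where "s1 = Complex 2 (Im s)"
        have v: "(1 + \<bar>Im s\<bar>) powr e \<ge> 1" using e by (intro ge_one_powr_ge_zero) auto
        have "norm (f s - f s1) \<le> (C * (1 + \<bar>Im s\<bar>) powr e) * norm (s - s1)"
        proof (rule holomorphic_horizontal_bound[OF hol, of "Im s"])
          fix z assume "Im z = Im s" "1 < Re z" "Re z \<le> 2"
          thus "norm (deriv f z) \<le> C * (1 + \<bar>Im s\<bar>) powr e" using C(2)[of z] s by auto
        qed (use s in \<open>auto simp: s1_def\<close>)
        also have "s - s1 = of_real (Re s - 2)" by (simp add: s1_def complex_eq_iff)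
        also have "(C * (1 + \<bar>Im s\<bar>) powr e) * norm (of_real (Re s - 2) :: complex) \<le> (C * (1 + \<bar>Im s\<bar>) powr e) * 1"
          unfolding norm_of_real using s C(1) by (intro mult_left_mono) auto
        finally have "norm (f s - f s1) \<le> C * (1 + \<bar>Im s\<bar>) powr e" by simp
        moreover have "norm (f s1) \<le> B * (1 + \<bar>Im s\<bar>) powr e"
          using B[of "Im s"] mult_left_mono[OF v B0] by (simp add: s1_def)
        moreover have "norm (f s) \<le> norm (f s1) + norm (f s - f s1)" by (metis add.commute diff_add_cancel norm_triangle_ineq)
        ultimately show "norm ((deriv ^^ n) f s) \<le> (B + C) * (1 + \<bar>Im s\<bar>) powr e"
          unfolding distrib_right 0 by simp
      qed (use B0 C in auto)
    qed
  qed
qed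

lemma slow_log_zeta:
  assumes t0: "t0 > 0" shows "slow t0 log_zeta"
proof (rule slow_of_deriv[OF t0])
  show "log_zeta holomorphic_on {s. Re s > 1}" using holomorphic_dser[OF abs_conv_log_zeta] by (simp add: log_zeta_def)
  have "slow t0 (\<lambda>s. deriv zeta s * (1 / zeta s))"
    by (intro slow_mult slow_deriv slow_zeta slow_zeta_inverse t0)
  thus "slow t0 (deriv log_zeta)"
  proof (rule slow_cong)
    fix s assume s: "Re s > 1"
    show "deriv zeta s * (1 / zeta s) = deriv log_zeta s"
      using DERIV_imp_deriv[OF has_field_derivative_zeta[OF s]] DERIV_imp_deriv[OF has_field_derivative_log_zeta[OF s]] zeta_nonzero[OF s]
      by simp
  qed
  show "norm (log_zeta (Complex 2 t)) \<le> (\<Sum>n. norm (ppow n / of_nat (big_omega n)) * real n powr (-2))" for t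
    unfolding log_zeta_def by (rule norm_dser_le[OF abs_conv_log_zeta]) auto
qed

lemma slow_D_mu:
  assumes t0: "t0 > 0" shows "slow t0 (D_mu k)"
proof (induction k rule: less_induct)
  case (less k)
  show ?case
  proof (cases k)
    case 0
    show ?thesis unfolding 0
    proof (rule slow_cong[OF slow_zeta_inverse[OF t0]])
      fix s assume "Re s > 1"
      thus "1 / zeta s = D_mu 0 s" using D_mu_0_zeta[of s] zeta_nonzero[of s] by (simp add: field_simps)
    qed
  next
    case (Suc m)
    have "slow t0 (\<lambda>s. - (\<Sum>i\<le>m. of_nat (m choose i) * (log_zeta s + D_corr i s) * D_mu (m - i) s))"
      by (intro slow_uminus slow_sum slow_mult slow_const slow_add slow_log_zeta slow_D_corr t0 less.IH) (auto simp: Suc)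
    thus ?thesis unfolding Suc by (rule slow_cong) (simp add: D_mu_Suc D_ppow_eq)
  qed
qed


section \<open>Behaviour near the point 1\<close>

text \<open>The cap \<open>1/4\<close> keeps \<open>1 + w\<close> in \<open>Re s > 3/4\<close>,
  inside the half-plane where \<open>D_corr\<close> is holomorphic.\<close>

lemma zetaY_nonzero_near_1: "\<exists>\<rho>. 0 < \<rho> \<and> \<rho> \<le> 1/4 \<and> (\<forall>w\<in>ball 0 \<rho>. zetaY (1 + w) \<noteq> 0)"
proof -
  have "isCont zetaY 1"
    using holomorphic_on_imp_continuous_on[OF holomorphic_zetaY] 
    by (simp add: continuous_on_eq_continuous_at open_halfspace_Re_gt)
  moreover have "zetaY 1 \<noteq> 0" by (simp add: zetaY_1)
  ultimately obtain r where r: "r > 0" "\<And>y. dist 1 y < r \<Longrightarrow> zetaY y \<noteq> 0"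
    using continuous_at_avoid[of 1 zetaY 0] by auto
  show ?thesis
    by (rule exI[of _ "min r (1/4)"]) (use r in \<open>auto simp: dist_norm\<close>)
qed

text \<open>Since \<open>zetaY (1 + w) = w * zeta (1 + w)\<close>, the logarithmic derivative of
  \<open>zeta\<close> at \<open>1 + w\<close> is \<open>h w - 1 / w\<close> with \<open>h\<close>
  holomorphic on the whole disc. A primitive of \<open>h\<close> yields \<open>q\<close>, which
  extends across \<open>Re w = 0\<close>; the singularity is carried by \<open>- Ln w\<close> alone.
  The two sides are compared on the convex half disc.\<close>

lemma log_zeta_near_1:
  assumes \<rho>: "0 < \<rho>" "\<rho> \<le> 1/4" and nz: "\<And>w. w \<in> ball 0 \<rho> \<Longrightarrow> zetaY (1 + w) \<noteq> 0"
  shows "\<exists>q. q holomorphic_on ball 0 \<rho> \<and> (\<forall>w\<in>ball 0 \<rho>. Re w > 0 \<longrightarrow> log_zeta (1 + w) = q w - Ln w)"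
proof -
  have Re: "Re (1 + w) > 0" if "w \<in> ball 0 \<rho>" for w
    using that \<rho> abs_Re_le_cmod[of w] by auto
  have opY: "open {s. Re s > 0}" by (rule open_halfspace_Re_gt)
  define h where "h w = deriv zetaY (1 + w) / zetaY (1 + w)" for w
  have "deriv zetaY holomorphic_on {s. Re s > 0}" by (rule holomorphic_deriv[OF holomorphic_zetaY opY])
  hence "(deriv zetaY \<circ> (\<lambda>w. 1 + w)) holomorphic_on ball 0 \<rho>" "(zetaY \<circ> (\<lambda>w. 1 + w)) holomorphic_on ball 0 \<rho>"
    using Re holomorphic_zetaY by (auto intro!: holomorphic_on_compose_gen[where t = "{s. Re s > 0}"] holomorphic_intros)
  hence "h holomorphic_on ball 0 \<rho>"
    unfolding h_def o_def using nz by (intro holomorphic_on_divide) auto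
  then obtain q0 where q0: "\<And>w. w \<in> ball 0 \<rho> \<Longrightarrow> (q0 has_field_derivative h w) (at w within ball 0 \<rho>)"
    using holomorphic_convex_primitive'[of "ball 0 \<rho>" h] by auto
  let ?H = "ball 0 \<rho> \<inter> {w. Re w > 0}"
  have "\<exists>c. \<forall>w\<in>?H. log_zeta (1 + w) + Ln w - q0 w = c"
  proof (rule has_field_derivative_zero_constant)
    show "convex ?H" by (intro convex_Int convex_ball convex_halfspace_Re_gt)
    fix w assume w: "w \<in> ?H"
    hence w0: "w \<noteq> 0" and wn: "w \<notin> \<real>\<^sub>\<le>\<^sub>0" by (auto simp: complex_nonpos_Reals_iff)
    have s: "Re (1 + w) > 1" using w by auto
    define M where "M = dser mangoldt (1 + w)"
    have "((\<lambda>s. (s - 1) * zeta s) has_field_derivative (zeta (1 + w) - w * (zeta (1 + w) * M))) (at (1 + w))"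
      using has_field_derivative_zeta[OF s] by (auto intro!: derivative_eq_intros simp: M_def)
    hence "(zetaY has_field_derivative (zeta (1 + w) - w * (zeta (1 + w) * M))) (at (1 + w))"
      by (rule has_field_derivative_transform_within_open[OF _ open_Re_gt_1]) (use s in \<open>auto simp: zetaY_eq\<close>)
    hence "deriv zetaY (1 + w) = zeta (1 + w) * (1 - w * M)" by (simp add: DERIV_imp_deriv algebra_simps)
    hence hw: "h w = 1 / w - M"
      using zetaY_eq[OF s] zeta_nonzero[OF s] w0 by (simp add: h_def field_simps)
    have "(log_zeta has_field_derivative - M) (at (w + 1))"
      using has_field_derivative_log_zeta[OF s] by (simp add: M_def add.commute)
    hence "((\<lambda>w. log_zeta (w + 1)) has_field_derivative - M) (at w)" by (simp add: DERIV_shift)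
    moreover have "(Ln has_field_derivative 1 / w) (at w)" using has_field_derivative_Ln[OF wn] by (simp add: inverse_eq_divide)
    moreover have "(q0 has_field_derivative h w) (at w)" using q0[of w] w by (simp add: at_within_open[of w "ball 0 \<rho>"])
    ultimately have "((\<lambda>w. log_zeta (w + 1) + Ln w - q0 w) has_field_derivative (- M + 1 / w - h w)) (at w)"
      by (intro DERIV_diff DERIV_add)
    hence "((\<lambda>w. log_zeta (1 + w) + Ln w - q0 w) has_field_derivative 0) (at w)"
      by (simp add: hw add.commute[of 1])
    thus "((\<lambda>w. log_zeta (1 + w) + Ln w - q0 w) has_field_derivative 0) (at w within ?H)"
      by (rule has_field_derivative_at_within)
  qed
  then obtain c where c: "\<And>w. w \<in> ?H \<Longrightarrow> log_zeta (1 + w) + Ln w - q0 w = c" by blast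
  show ?thesis
  proof (intro exI[of _ "\<lambda>w. q0 w + c"] conjI ballI impI)
    have "q0 holomorphic_on ball 0 \<rho>" unfolding holomorphic_on_def field_differentiable_def using q0 by blast
    thus "(\<lambda>w. q0 w + c) holomorphic_on ball 0 \<rho>" by (intro holomorphic_intros)
    fix w assume "w \<in> ball 0 \<rho>" "Re w > 0"
    thus "log_zeta (1 + w) = q0 w + c - Ln w" using c[of w] by (auto simp: algebra_simps)
  qed
qed

text \<open>The recursion \<open>D_mu_Suc\<close> near 1, read as an identity of polynomials in the
  variable \<open>Ln w\<close>: the series \<open>D_ppow i (1 + w)\<close> becomes the linear
  polynomial with value \<open>q w + D_corr i (1 + w) - Ln w\<close>. The factor \<open>w\<close> of
  \<open>1 / zeta (1 + w) = w / zetaY (1 + w)\<close> is split off.\<close>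

fun log_coeff_poly :: "(complex \<Rightarrow> complex) \<Rightarrow> nat \<Rightarrow> complex \<Rightarrow> complex poly" where
  "log_coeff_poly q 0 w = [:1 / zetaY (1 + w):]"
| "log_coeff_poly q (Suc k) w = - (\<Sum>i\<le>k. of_nat (k choose i) * ([:q w + D_corr i (1 + w), - 1:] * log_coeff_poly q (k - i) w))"

lemma poly_of_nat [simp]: "poly (of_nat n) x = of_nat n"
  by (simp add: of_nat_poly)

lemma coeff_of_nat_mult: "coeff (of_nat n * p) i = of_nat n * coeff (p :: 'a :: comm_semiring_1 poly) i"
  by (simp add: of_nat_poly)

lemma coeff_linear_mult: "coeff ([:a, b:] * p) i = a * coeff p i + (case i of 0 \<Rightarrow> 0 | Suc j \<Rightarrow> b * coeff (p :: complex poly) j)"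
  by (cases i) (auto simp: coeff_pCons)

lemma log_coeff_poly_coeff_holomorphic:
  assumes \<rho>: "0 < \<rho>" "\<rho> \<le> 1/4" and nz: "\<And>w. w \<in> ball 0 \<rho> \<Longrightarrow> zetaY (1 + w) \<noteq> 0" and q: "q holomorphic_on ball 0 \<rho>"
  shows "(\<lambda>w. coeff (log_coeff_poly q k w) i) holomorphic_on ball 0 \<rho>"
proof -
  have Re: "Re (1 + w) > 3/4" if "w \<in> ball 0 \<rho>" for w
    using that \<rho> abs_Re_le_cmod[of w] by auto
  have "(zetaY \<circ> (\<lambda>w. 1 + w)) holomorphic_on ball 0 \<rho>"
    using Re by (intro holomorphic_on_compose_gen[OF _ holomorphic_zetaY] holomorphic_intros) force
  hence hY: "(\<lambda>w. zetaY (1 + w)) holomorphic_on ball 0 \<rho>" by (simp add: o_def)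
  have hG: "(\<lambda>w. D_corr i (1 + w)) holomorphic_on ball 0 \<rho>" for i
  proof -
    have "D_corr i holomorphic_on {s. Re s > 1/2}"
      using holomorphic_dser[OF abs_conv_D_corr[of i]] by (simp add: D_corr_def)
    moreover have "(\<lambda>w. 1 + w) ` ball 0 \<rho> \<subseteq> {s. Re s > 1/2}"
    proof safe
      fix w assume "w \<in> ball (0::complex) \<rho>"
      from Re[OF this] show "Re (1 + w) > 1/2" by simp
    qed
    ultimately have "(D_corr i \<circ> (\<lambda>w. 1 + w)) holomorphic_on ball 0 \<rho>"
      by (intro holomorphic_on_compose_gen[of _ _ "D_corr i"] holomorphic_intros)
    thus ?thesis by (simp add: o_def)
  qed
  show ?thesis
  proof (induction k arbitrary: i rule: less_induct)
    case (less k)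
    show ?case
    proof (cases k)
      case 0
      have "(\<lambda>w. 1 / zetaY (1 + w)) holomorphic_on ball 0 \<rho>"
        by (intro holomorphic_on_divide hY nz) auto
      thus ?thesis unfolding 0 by (cases i) auto
    next
      case (Suc m)
      have IH: "(\<lambda>w. coeff (log_coeff_poly q (m - j) w) i) holomorphic_on ball 0 \<rho>" for j i
        by (rule less.IH) (simp add: Suc)
      show ?thesis unfolding Suc log_coeff_poly.simps coeff_minus coeff_sum coeff_of_nat_mult coeff_linear_mult
        by (cases i) (auto intro!: holomorphic_intros q hG IH)
    qed
  qed
qed

lemma log_coeff_poly_degree: "i > k \<Longrightarrow> coeff (log_coeff_poly q k w) i = 0"
proof (induction k arbitrary: i rule: less_induct)
  case (less k)
  show ?case
  proof (cases k)
    case 0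
    thus ?thesis using less.prems by (cases i) auto
  next
    case (Suc m)
    obtain i' where i': "i = Suc i'" "i' > m" using less.prems Suc by (cases i) auto
    have "coeff (log_coeff_poly q (m - j) w) i = 0" "coeff (log_coeff_poly q (m - j) w) i' = 0" for j
      by (rule less.IH; use i' Suc in simp)+
    thus ?thesis unfolding Suc log_coeff_poly.simps coeff_minus coeff_sum coeff_of_nat_mult coeff_linear_mult by (simp add: i')
  qed
qed

text \<open>Only the summand \<open>i = 0\<close> of the recursion reaches the top degree, and its
  two minus signs cancel.\<close>

lemma log_coeff_poly_top_coeff: "coeff (log_coeff_poly q k w) k = 1 / zetaY (1 + w)"
proof (induction k)
  case (Suc m)
  have "coeff (of_nat (m choose i) * ([:q w + D_corr i (1 + w), - 1:] * log_coeff_poly q (m - i) w)) (Suc m) = 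
       (if i = 0 then - (1 / zetaY (1 + w)) else 0)" if "i \<le> m" for i
    unfolding coeff_of_nat_mult coeff_linear_mult using that Suc
    by (cases "i = 0") (auto simp: log_coeff_poly_degree)
  hence "coeff (log_coeff_poly q (Suc m) w) (Suc m) = - (\<Sum>i\<le>m. if i = 0 then - (1 / zetaY (1 + w)) else 0)"
    unfolding log_coeff_poly.simps coeff_minus coeff_sum by (intro arg_cong[of _ _ uminus] sum.cong) auto
  thus ?case by simp
qed auto

lemma D_mu_near_1:
  assumes nz: "zetaY (1 + w) \<noteq> 0" and q: "log_zeta (1 + w) = q w - Ln w" and w: "Re w > 0"
  shows "D_mu k (1 + w) = w * poly (log_coeff_poly q k w) (Ln w)"
proof (induction k rule: less_induct)
  case (less k)
  have s: "Re (1 + w) > 1" using w by simp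
  show ?case
  proof (cases k)
    case 0
    have "zetaY (1 + w) = w * zeta (1 + w)" using zetaY_eq[OF s] by simp
    thus ?thesis using D_mu_0_zeta[OF s] zeta_nonzero[OF s] nz 0 by (auto simp: field_simps)
  next
    case (Suc m)
    have "D_mu (Suc m) (1 + w) = - (\<Sum>i\<le>m. of_nat (m choose i) * D_ppow i (1 + w) * D_mu (m - i) (1 + w))"
      by (rule D_mu_Suc[OF s])
    also have "\<dots> = - (\<Sum>i\<le>m. of_nat (m choose i) * (q w - Ln w + D_corr i (1 + w)) * (w * poly (log_coeff_poly q (m - i) w) (Ln w)))"
      using Suc by (simp add: D_ppow_eq[OF s] q less.IH)
    also have "\<dots> = w * poly (log_coeff_poly q (Suc m) w) (Ln w)"
      unfolding log_coeff_poly.simps poly_minus poly_sum poly_mult poly_of_nat poly_pCons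
      by (simp add: sum_distrib_left algebra_simps sum_negf)
    finally show ?thesis using Suc by simp
  qed
qed

text \<open>The common factor \<open>w\<close> is the simple zero of \<open>1 / zeta\<close> at 1.
  Because of it the expansion of the transform begins with \<open>w ^ 1\<close>, and that of the
  summatory function with the inverse square of \<open>y\<close>.\<close>

lemma D_mu_expansion:
  obtains \<rho> H where "0 < \<rho>" "\<rho> \<le> 1/4" "\<And>i. H i holomorphic_on ball 0 \<rho>" "H k 0 = 1"
    "\<And>w. w \<in> ball 0 \<rho> \<Longrightarrow> Re w > 0 \<Longrightarrow> D_mu k (1 + w) / (1 + w) = (\<Sum>i\<le>k. w * H i w * Ln w ^ i)"
proof -
  obtain \<rho> where \<rho>: "0 < \<rho>" "\<rho> \<le> 1/4" "\<And>w. w \<in> ball 0 \<rho> \<Longrightarrow> zetaY (1 + w) \<noteq> 0"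
    using zetaY_nonzero_near_1 by blast
  obtain q where q: "q holomorphic_on ball 0 \<rho>" "\<And>w. w \<in> ball 0 \<rho> \<Longrightarrow> Re w > 0 \<Longrightarrow> log_zeta (1 + w) = q w - Ln w"
    using log_zeta_near_1[OF \<rho>] by blast
  have Re: "Re (1 + w) > 3/4" if "w \<in> ball 0 \<rho>" for w
    using that \<rho> abs_Re_le_cmod[of w] by auto
  define H where "H i w = coeff (log_coeff_poly q k w) i / (1 + w)" for i w
  show ?thesis
  proof (rule that[OF \<rho>(1,2)])
    show "H i holomorphic_on ball 0 \<rho>" for i
      unfolding H_def
    proof (intro holomorphic_intros log_coeff_poly_coeff_holomorphic[OF \<rho> q(1)])
      fix w assume "w \<in> ball (0::complex) \<rho>"
      from Re[OF this] show "1 + w \<noteq> 0" by (metis less_le_not_le zero_complex.sel(1) zero_le_divide_iff zero_le_numeral)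
    qed
    show "H k 0 = 1" by (simp add: H_def log_coeff_poly_top_coeff zetaY_1)
    fix w assume w: "w \<in> ball 0 \<rho>" "Re w > 0"
    have "poly (log_coeff_poly q k w) (Ln w) = (\<Sum>i\<le>k. coeff (log_coeff_poly q k w) i * Ln w ^ i)"
      unfolding poly_altdef by (rule sum.mono_neutral_left) (auto simp: log_coeff_poly_degree coeff_eq_0 intro!: degree_le)
    thus "D_mu k (1 + w) / (1 + w) = (\<Sum>i\<le>k. w * H i w * Ln w ^ i)"
      unfolding D_mu_near_1[of w q, OF \<rho>(3)[OF w(1)] q(2)[OF w] w(2)]
      by (simp add: H_def sum_distrib_left sum_divide_distrib mult_ac)
  qed
qed


section \<open>Laplace transforms\<close>

text \<open>Vanishing for \<open>y < 0\<close> makes the integral over the whole line in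
  \<open>laplace\<close> a one-sided transform. Leaving the exponent \<open>A\<close> free makes the
  class closed under multiplication by \<open>y\<close>, that is, under differentiation of the
  transform.\<close>

definition poly_bdd :: "(real \<Rightarrow> complex) \<Rightarrow> bool" where
  "poly_bdd h \<longleftrightarrow> h \<in> borel_measurable borel \<and> (\<forall>y<0. h y = 0) \<and> (\<exists>C\<ge>0. \<exists>A::nat. \<forall>y\<ge>0. norm (h y) \<le> C * (1 + y) ^ A)"

definition laplace :: "(real \<Rightarrow> complex) \<Rightarrow> complex \<Rightarrow> complex" where
  "laplace h w = (\<integral>y. h y * exp (- (w * of_real y)) \<partial>lborel)"

lemma pbE:
  assumes "poly_bdd h"
  obtains C A where "C \<ge> 0" "\<And>y. y \<ge> 0 \<Longrightarrow> norm (h y) \<le> C * (1 + y) ^ A"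
  using assms unfolding poly_bdd_def by blast

lemma poly_bdd_measurable [measurable_dest]: "poly_bdd h \<Longrightarrow> h \<in> borel_measurable borel" by (simp add: poly_bdd_def)

lemma power_le_fact_exp: "x \<ge> 0 \<Longrightarrow> x ^ n \<le> fact n * exp (x :: real)"
proof -
  assume x: "x \<ge> 0"
  have "(\<Sum>k\<in>{n}. x ^ k /\<^sub>R fact k) \<le> (\<Sum>k. x ^ k /\<^sub>R fact k)"
    by (rule sum_le_suminf[OF summable_exp_generic]) (use x in auto)
  hence "x ^ n / fact n \<le> exp x" by (simp add: exp_def divide_inverse mult.commute)
  thus ?thesis by (simp add: field_simps)
qed

lemma poly_bdd_integrable_norm:
  assumes "poly_bdd h" "l > 0"
  shows "integrable lborel (\<lambda>y. norm (h y) * exp (- (l * y)))"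
proof -
  obtain C A where C: "C \<ge> 0" "\<And>y. y \<ge> 0 \<Longrightarrow> norm (h y) \<le> C * (1 + y) ^ A"
    using pbE[OF assms(1)] by blast
  define c where "c = l / 2"
  have c: "c > 0" using assms by (simp add: c_def)
  define K where "K = C * (fact A / c ^ A * exp c)"
  have "integrable lborel (\<lambda>y. K * (indicator {0<..} y *\<^sub>R exp (- (y * c))))"
    using integrable_I0i_exp_mscale[OF c] unfolding set_integrable_def by (rule integrable_mult_right)
  thus ?thesis
  proof (rule Bochner_Integration.integrable_bound)
    show "AE y in lborel. norm (norm (h y) * exp (- (l * y))) \<le> norm (K * (indicator {0<..} y *\<^sub>R exp (- (y * c))))"
      using AE_lborel_singleton[of 0]
    proof eventually_elim
      case (elim y)
      show ?case
      proof (cases "y > 0")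
        case True
        have "(c * (1 + y)) ^ A \<le> fact A * exp (c * (1 + y))"
          using True c by (intro power_le_fact_exp) auto
        hence "(1 + y) ^ A \<le> fact A / c ^ A * exp c * exp (c * y)"
        proof -
          have "exp (c * (1 + y)) = exp c * exp (c * y)" by (simp add: distrib_left exp_add)
          moreover assume "(c * (1 + y)) ^ A \<le> fact A * exp (c * (1 + y))"
          ultimately have "c ^ A * (1 + y) ^ A \<le> fact A * (exp c * exp (c * y))" by (simp only: power_mult_distrib)
          thus ?thesis using c by (simp add: pos_le_divide_eq mult_ac)
        qed
        from mult_left_mono[OF this C(1)] have "C * (1 + y) ^ A \<le> K * exp (c * y)"
          by (simp add: K_def mult.assoc)
        hence "norm (h y) \<le> K * exp (c * y)" using C(2)[of y] True by linarith
        hence "norm (h y) * exp (- (l * y)) \<le> K * exp (c * y) * exp (- (l * y))"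
          by (intro mult_right_mono) auto
        also have "\<dots> = K * exp (- (y * c))" by (simp add: c_def field_simps flip: exp_add)
        finally show ?thesis using True by simp
      qed (use elim assms(1) in \<open>auto simp: poly_bdd_def\<close>)
    qed
  qed (use assms(1) in \<open>auto dest: poly_bdd_measurable\<close>)
qed

lemma poly_bdd_laplace_integrable:
  assumes "poly_bdd h" "Re w > 0"
  shows "integrable lborel (\<lambda>y. h y * exp (- (w * of_real y)))"
  by (rule Bochner_Integration.integrable_bound[OF poly_bdd_integrable_norm[OF assms]])
     (use assms(1) in \<open>auto simp: norm_mult dest: poly_bdd_measurable\<close>)

lemma poly_bdd_cmult: 
  assumes "poly_bdd h" shows "poly_bdd (\<lambda>y. c * h y)"
proof -
  obtain C A where C: "C \<ge> 0" "\<And>y. y \<ge> 0 \<Longrightarrow> norm (h y) \<le> C * (1 + y) ^ A"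
    using pbE[OF assms(1)] by blast
  have "\<exists>C\<ge>0. \<exists>A::nat. \<forall>y\<ge>0. norm (c * h y) \<le> C * (1 + y) ^ A"
    by (rule exI[of _ "norm c * C"], intro conjI, use C in simp, rule exI[of _ A])
       (auto simp: norm_mult mult.assoc intro!: mult_left_mono C)
  thus ?thesis using assms by (auto simp: poly_bdd_def)
qed

lemma poly_bdd_add: 
  assumes "poly_bdd h" "poly_bdd g" shows "poly_bdd (\<lambda>y. h y + g y)"
proof -
  obtain C A where C: "C \<ge> 0" "\<And>y. y \<ge> 0 \<Longrightarrow> norm (h y) \<le> C * (1 + y) ^ A"
    using pbE[OF assms(1)] by blast
  obtain D B where D: "D \<ge> 0" "\<And>y. y \<ge> 0 \<Longrightarrow> norm (g y) \<le> D * (1 + y) ^ B"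
    using pbE[OF assms(2)] by blast
  have "norm (h y + g y) \<le> (C + D) * (1 + y) ^ (A + B)" if "y \<ge> 0" for y
  proof -
    have "C * (1 + y) ^ A \<le> C * (1 + y) ^ (A + B)" "D * (1 + y) ^ B \<le> D * (1 + y) ^ (A + B)"
      using that C D by (auto intro!: mult_left_mono power_increasing)
    thus ?thesis using C(2)[OF that] D(2)[OF that] norm_triangle_ineq[of "h y" "g y"]
      unfolding distrib_right by linarith
  qed
  hence "\<exists>C\<ge>0. \<exists>A::nat. \<forall>y\<ge>0. norm (h y + g y) \<le> C * (1 + y) ^ A"
    using C(1) D(1) by (metis add_nonneg_nonneg)
  thus ?thesis using assms by (auto simp: poly_bdd_def)
qed

lemma poly_bdd_zero: "poly_bdd (\<lambda>_. 0)"
  unfolding poly_bdd_def by (auto intro!: exI[of _ 0])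

lemma poly_bdd_sum: "(\<And>i. i \<in> I \<Longrightarrow> poly_bdd (h i)) \<Longrightarrow> poly_bdd (\<lambda>y. \<Sum>i\<in>I. h i y)"
  by (induction I rule: infinite_finite_induct) (auto intro: poly_bdd_zero poly_bdd_add)

lemma poly_bdd_diff: "poly_bdd h \<Longrightarrow> poly_bdd g \<Longrightarrow> poly_bdd (\<lambda>y. h y - g y)"
  using poly_bdd_add[of h "\<lambda>y. (-1) * g y"] poly_bdd_cmult[of g "-1"] by simp

lemma poly_bdd_mult_y: 
  assumes "poly_bdd h" shows "poly_bdd (\<lambda>y. of_real y * h y)"
proof -
  obtain C A where C: "C \<ge> 0" "\<And>y. y \<ge> 0 \<Longrightarrow> norm (h y) \<le> C * (1 + y) ^ A"
    using pbE[OF assms(1)] by blast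
  have "norm (of_real y * h y) \<le> C * (1 + y) ^ Suc A" if "y \<ge> 0" for y
  proof -
    have "norm (of_real y * h y) \<le> (1 + y) * (C * (1 + y) ^ A)"
      unfolding norm_mult norm_of_real using that C by (intro mult_mono C) auto
    thus ?thesis by (simp add: mult_ac)
  qed
  hence "\<exists>C\<ge>0. \<exists>A::nat. \<forall>y\<ge>0. norm (of_real y * h y) \<le> C * (1 + y) ^ A"
    using C(1) by blast
  thus ?thesis using assms by (auto simp: poly_bdd_def)
qed

lemma poly_bdd_mult_power: "poly_bdd h \<Longrightarrow> poly_bdd (\<lambda>y. of_real y ^ n * h y)"
proof (induction n)
  case (Suc n)
  from poly_bdd_mult_y[OF Suc.IH[OF Suc.prems]] show ?case by (simp add: mult.assoc)
qed simp

lemma laplace_cmult: "laplace (\<lambda>y. c * h y) w = c * laplace h w"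
  unfolding laplace_def mult.assoc by simp

lemma laplace_add: "poly_bdd h \<Longrightarrow> poly_bdd g \<Longrightarrow> Re w > 0 \<Longrightarrow> laplace (\<lambda>y. h y + g y) w = laplace h w + laplace g w"
  unfolding laplace_def distrib_right by (intro Bochner_Integration.integral_add poly_bdd_laplace_integrable)

lemma laplace_diff: "poly_bdd h \<Longrightarrow> poly_bdd g \<Longrightarrow> Re w > 0 \<Longrightarrow> laplace (\<lambda>y. h y - g y) w = laplace h w - laplace g w"
  unfolding laplace_def left_diff_distrib by (intro Bochner_Integration.integral_diff poly_bdd_laplace_integrable)

lemma laplace_zero [simp]: "laplace (\<lambda>_. 0) w = 0" by (simp add: laplace_def)

lemma laplace_sum: "Re w > 0 \<Longrightarrow> (\<And>i. i \<in> I \<Longrightarrow> poly_bdd (h i)) \<Longrightarrow> laplace (\<lambda>y. \<Sum>i\<in>I. h i y) w = (\<Sum>i\<in>I. laplace (h i) w)"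
  by (induction I rule: infinite_finite_induct) (auto simp: laplace_add poly_bdd_sum)

text \<open>With \<open>u = - (z * y)\<close> the second-order remainder of \<open>exp u\<close> is
  at most \<open>norm u ^ 2 * exp (norm u)\<close>. For \<open>norm z\<close> below
  \<open>Re w / 2\<close> half of the exponential decay is left, and it integrates \<open>g\<close>,
  so the difference quotient errs by at most \<open>M * norm z\<close>.\<close>

lemma has_field_derivative_laplace:
  assumes h: "poly_bdd h" and w: "Re w > 0"
  shows "(laplace h has_field_derivative - laplace (\<lambda>y. of_real y * h y) w) (at w)"
proof -
  define c where "c = Re w / 2"
  have c: "c > 0" using w by (simp add: c_def)
  define g where "g y = of_real y * (of_real y * h y)" for y
  have pg: "poly_bdd g" unfolding g_def by (intro poly_bdd_mult_y h)
  have ph: "poly_bdd (\<lambda>y. of_real y * h y)" by (intro poly_bdd_mult_y h)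
  define M where "M = (\<integral>y. norm (g y) * exp (- (c * y)) \<partial>lborel)"
  have bd: "norm ((laplace h (w + z) - laplace h w) / z - (- laplace (\<lambda>y. of_real y * h y) w)) \<le> M * norm z"
    if z: "z \<noteq> 0" "norm z < c" for z
  proof -
    have wz: "Re (w + z) > 0" using z abs_Re_le_cmod[of z] w by (auto simp: c_def)
    have i1: "integrable lborel (\<lambda>y. h y * exp (- ((w + z) * of_real y)))" by (rule poly_bdd_laplace_integrable[OF h wz])
    have i2: "integrable lborel (\<lambda>y. h y * exp (- (w * of_real y)))" by (rule poly_bdd_laplace_integrable[OF h w])
    have i3: "integrable lborel (\<lambda>y. z * (of_real y * h y * exp (- (w * of_real y))))" 
      using poly_bdd_laplace_integrable[OF ph w] by (intro integrable_mult_right) auto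
    have "laplace h (w + z) - laplace h w + z * laplace (\<lambda>y. of_real y * h y) w = 
      (\<integral>y. h y * exp (- ((w + z) * of_real y)) - h y * exp (- (w * of_real y)) + z * (of_real y * h y * exp (- (w * of_real y))) \<partial>lborel)"
      unfolding laplace_def using i1 i2 i3 by simp
    also have "norm \<dots> \<le> (\<integral>y. norm z ^ 2 * (norm (g y) * exp (- (c * y))) \<partial>lborel)"
    proof (rule Bochner_Integration.integral_norm_bound_integral)
      show "integrable lborel (\<lambda>y. norm z ^ 2 * (norm (g y) * exp (- (c * y))))"
        by (intro integrable_mult_right poly_bdd_integrable_norm pg c)
      fix y :: real
      show "norm (h y * exp (- ((w + z) * of_real y)) - h y * exp (- (w * of_real y)) + z * (of_real y * h y * exp (- (w * of_real y))))
         \<le> norm z ^ 2 * (norm (g y) * exp (- (c * y)))"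
      proof (cases "y \<ge> 0")
        case True
        define u where "u = - (z * of_real y)"
        have "h y * exp (- ((w + z) * of_real y)) - h y * exp (- (w * of_real y)) + z * (of_real y * h y * exp (- (w * of_real y))) =
          h y * exp (- (w * of_real y)) * (exp u - (\<Sum>i\<le>1. u ^ i / fact i))"
          by (simp add: u_def algebra_simps flip: exp_add)
        also have "norm \<dots> \<le> norm (h y) * exp (- (Re w * y)) * (exp (norm u) * norm u ^ Suc 1 / fact 1)"
          unfolding norm_mult by (intro mult_mono Taylor_exp_field) auto
        also have "norm u = norm z * y" using True by (simp add: u_def norm_mult)
        also have "norm (h y) * exp (- (Re w * y)) * (exp (norm z * y) * (norm z * y) ^ Suc 1 / fact 1) =
           norm z ^ 2 * norm (g y) * (exp (- (Re w * y)) * exp (norm z * y))"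
          using True by (simp add: g_def norm_mult power2_eq_square)
        also have "\<dots> \<le> norm z ^ 2 * norm (g y) * exp (- (c * y))"
        proof (rule mult_left_mono)
          have "norm z * y \<le> c * y" using z True by (intro mult_right_mono) auto
          thus "exp (- (Re w * y)) * exp (norm z * y) \<le> exp (- (c * y))"
            by (simp add: c_def flip: exp_add)
        qed auto
        finally show ?thesis by (simp add: mult.assoc)
      qed (use h in \<open>auto simp: poly_bdd_def g_def\<close>)
    qed (use i1 i2 i3 in auto)
    also have "\<dots> = norm z ^ 2 * M" by (simp add: M_def)
    finally have "norm (laplace h (w + z) - laplace h w + z * laplace (\<lambda>y. of_real y * h y) w) \<le> norm z ^ 2 * M" .
    hence "norm (laplace h (w + z) - laplace h w + z * laplace (\<lambda>y. of_real y * h y) w) / norm z \<le> norm z ^ 2 * M / norm z"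
      by (intro divide_right_mono) auto
    also have "norm z ^ 2 * M / norm z = M * norm z" using z by (simp add: power2_eq_square)
    also have "norm (laplace h (w + z) - laplace h w + z * laplace (\<lambda>y. of_real y * h y) w) / norm z =
       norm ((laplace h (w + z) - laplace h w) / z - (- laplace (\<lambda>y. of_real y * h y) w))"
      unfolding norm_divide[symmetric] using z by (simp add: field_simps)
    finally show ?thesis .
  qed
  have "((\<lambda>z. (laplace h (w + z) - laplace h w) / z) \<longlongrightarrow> - laplace (\<lambda>y. of_real y * h y) w) (at 0)"
  proof (rule LIM_zero_cancel, rule Lim_null_comparison)
    show "\<forall>\<^sub>F z in at 0. norm ((laplace h (w + z) - laplace h w) / z - - laplace (\<lambda>y. of_real y * h y) w) \<le> M * norm z"
      unfolding eventually_at using c bd by (auto intro!: exI[of _ c])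
    show "((\<lambda>z::complex. M * norm z) \<longlongrightarrow> 0) (at 0)" by (auto intro!: tendsto_eq_intros)
  qed
  thus ?thesis by (simp add: DERIV_def)
qed

lemma open_Re_pos: "open {w. Re w > 0}" by (rule open_halfspace_Re_gt)

lemma holomorphic_laplace: "poly_bdd h \<Longrightarrow> laplace h holomorphic_on {w. Re w > 0}"
  using has_field_derivative_laplace[of h] by (subst holomorphic_on_open[OF open_Re_pos]) auto

lemma deriv_cong_Re_pos:
  assumes "\<And>w. Re w > 0 \<Longrightarrow> f w = g w" "Re w > 0"
  shows "deriv f w = deriv g w"
  by (rule deriv_cong_ev) (use assms eventually_nhds_in_open[OF open_Re_pos, of w] in \<open>auto elim!: eventually_mono\<close>)

lemma higher_deriv_laplace:
  assumes h: "poly_bdd h" and w: "Re w > 0"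
  shows "(deriv ^^ N) (laplace h) w = (-1) ^ N * laplace (\<lambda>y. of_real y ^ N * h y) w"
  using w
proof (induction N arbitrary: w)
  case (Suc N)
  have "deriv ((deriv ^^ N) (laplace h)) w = deriv (\<lambda>w. (-1) ^ N * laplace (\<lambda>y. of_real y ^ N * h y) w) w"
    using Suc by (intro deriv_cong_Re_pos) auto
  also have "\<dots> = (-1) ^ N * (- laplace (\<lambda>y. of_real y * (of_real y ^ N * h y)) w)"
    by (rule DERIV_imp_deriv, rule DERIV_cmult, rule has_field_derivative_laplace) (use h Suc in \<open>auto intro: poly_bdd_mult_power\<close>)
  finally show ?case by (simp add: mult.assoc)
qed simp

section \<open>Transforms of products of powers of \<open>y\<close> and \<open>ln y\<close>\<close>

definition pow_ln :: "nat \<Rightarrow> nat \<Rightarrow> real \<Rightarrow> complex" where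
  "pow_ln n i y = (if y > 0 then of_real y ^ n * of_real (ln y) ^ i else 0)"

text \<open>Below 1 the logarithm is tamed by a single factor \<open>y\<close>, because
  \<open>\<bar>ln y\<bar> ^ i \<le> fact i / y\<close>; hence \<open>n \<ge> 1\<close>.\<close>

lemma pow_ln_bound:
  assumes n: "n \<ge> 1" and y: "y \<ge> 0"
  shows "norm (pow_ln n i y) \<le> fact i * (1 + y) ^ (n + i)"
proof (cases "y > 0")
  case True
  have "y ^ n * \<bar>ln y\<bar> ^ i \<le> fact i * (1 + y) ^ (n + i)"
  proof (cases "y \<ge> 1")
    case 1: True
    have "ln y \<le> 1 + y" using ln_le_minus_one[of y] 1 by simp
    hence "y ^ n * \<bar>ln y\<bar> ^ i \<le> (1 + y) ^ n * (1 + y) ^ i"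
      using 1 by (intro mult_mono power_mono) auto
    also have "\<dots> = 1 * (1 + y) ^ (n + i)" by (simp add: power_add)
    also have "\<dots> \<le> fact i * (1 + y) ^ (n + i)" using y by (intro mult_right_mono) (auto simp: fact_ge_1)
    finally show ?thesis .
  next
    case False
    have "(- ln y) ^ i \<le> fact i * exp (- ln y)" using False True by (intro power_le_fact_exp) auto
    hence "y * \<bar>ln y\<bar> ^ i \<le> y * (fact i * exp (- ln y))" using False True by (intro mult_left_mono) auto
    also have "\<dots> = fact i" using True by (simp add: exp_minus)
    finally have "y * \<bar>ln y\<bar> ^ i \<le> fact i" .
    moreover have "y ^ n \<le> y" using power_decreasing[of 1 n y] n True False by auto
    hence "y ^ n * \<bar>ln y\<bar> ^ i \<le> y * \<bar>ln y\<bar> ^ i" by (intro mult_right_mono) auto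
    moreover have "fact i * 1 \<le> fact i * (1 + y) ^ (n + i)" using y by (intro mult_left_mono one_le_power) auto
    ultimately show ?thesis by linarith
  qed
  thus ?thesis using True by (simp add: pow_ln_def norm_mult norm_power)
qed (use y in \<open>simp add: pow_ln_def\<close>)

lemma poly_bdd_pow_ln: "n \<ge> 1 \<Longrightarrow> poly_bdd (pow_ln n i)"
proof -
  assume n: "n \<ge> 1"
  have "pow_ln n i \<in> borel_measurable borel" unfolding pow_ln_def by measurable
  moreover have "\<exists>C\<ge>0. \<exists>A::nat. \<forall>y\<ge>0. norm (pow_ln n i y) \<le> C * (1 + y) ^ A"
    using pow_ln_bound[OF n] by (intro exI[of _ "fact i"]) auto
  ultimately show ?thesis by (auto simp: poly_bdd_def pow_ln_def)
qed

lemma mult_pow_ln: "of_real y * pow_ln n i y = pow_ln (Suc n) i y"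
  by (simp add: pow_ln_def)

text \<open>Integration by parts: \<open>f\<close> is the derivative of \<open>F\<close>, which
  tends to 0 at both ends, so its integral vanishes. For \<open>i = 0\<close> the truncated index
  \<open>i - 1\<close> is harmless because of the factor \<open>of_nat i\<close>.\<close>

lemma laplace_pow_ln_2:
  assumes w: "Re w > 0"
  shows "w * laplace (pow_ln 2 i) w = 2 * laplace (pow_ln 1 i) w + of_nat i * laplace (pow_ln 1 (i - 1)) w"
proof -
  define F where "F z = z ^ 2 * Ln z ^ i * exp (- (w * z))" for z
  define f where "f z = (2 * (z * Ln z ^ i) + of_nat i * (z * Ln z ^ (i - 1)) - w * (z ^ 2 * Ln z ^ i)) * exp (- (w * z))" for z
  define g where "g y = 2 * pow_ln 1 i y + of_nat i * pow_ln 1 (i - 1) y - w * pow_ln 2 i y" for y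
  have g: "poly_bdd g" unfolding g_def by (intro poly_bdd_add poly_bdd_diff poly_bdd_cmult poly_bdd_pow_ln) auto
  have fg: "indicator {0<..} y *\<^sub>R f (of_real y) = g y * exp (- (w * of_real y))" for y :: real
    by (auto simp: f_def g_def pow_ln_def Ln_of_real indicator_def)
  have "(LBINT y=0..\<infinity>. f (of_real y)) = 0 - 0"
  proof (rule interval_integral_FTC_integrable)
    fix y :: real assume "(0::ereal) < ereal y" "ereal y < \<infinity>"
    hence y: "y > 0" by simp
    hence nn: "complex_of_real y \<notin> \<real>\<^sub>\<le>\<^sub>0" by (auto simp: complex_nonpos_Reals_iff)
    have "(F has_field_derivative f (of_real y)) (at (of_real y))"
      unfolding F_def f_def
      by (rule derivative_eq_intros refl nn | simp)+ (use y in \<open>auto simp: algebra_simps power2_eq_square\<close>)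
    thus "((\<lambda>y. F (of_real y)) has_vector_derivative f (of_real y)) (at y)"
      by (rule has_vector_derivative_real_field)
    show "isCont (\<lambda>y. f (of_real y)) y"
      unfolding f_def using nn y by (intro continuous_intros) auto
  next
    have "set_integrable lborel {0<..} (\<lambda>y. f (of_real y))"
      unfolding set_integrable_def fg by (rule poly_bdd_laplace_integrable[OF g w])
    moreover have "einterval 0 \<infinity> = {0::real<..}" by (auto simp: einterval_def)
    ultimately show "set_integrable lborel (einterval 0 \<infinity>) (\<lambda>y. f (of_real y))" by simp
    have Fn: "norm (F (of_real y)) = y * norm (pow_ln 1 i y) * exp (- (Re w * y))" if "y > 0" for y
      using that by (simp add: F_def pow_ln_def Ln_of_real norm_mult norm_power power2_eq_square)
    have "((\<lambda>y. F (of_real y)) \<longlongrightarrow> 0) (at_right 0)"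
    proof (rule Lim_null_comparison)
      show "\<forall>\<^sub>F y in at_right 0. norm (F (of_real y)) \<le> y * (fact i * (1 + y) ^ (1 + i)) * exp (- (Re w * y))"
        unfolding eventually_at_filter
      proof (intro always_eventually allI impI)
        fix y :: real assume "y \<in> {0<..}"
        thus "norm (F (of_real y)) \<le> y * (fact i * (1 + y) ^ (1 + i)) * exp (- (Re w * y))"
          unfolding Fn[of y, simplified] by (subst Fn) (auto intro!: mult_right_mono mult_left_mono pow_ln_bound[of 1 y i, simplified])
      qed
      have "((\<lambda>y::real. y * (fact i * (1 + y) ^ (1 + i)) * exp (- (Re w * y))) \<longlongrightarrow> 0 * (fact i * (1 + 0) ^ (1 + i)) * exp (- (Re w * 0))) (at_right 0)"
        by (intro tendsto_intros)
      thus "((\<lambda>y::real. y * (fact i * (1 + y) ^ (1 + i)) * exp (- (Re w * y))) \<longlongrightarrow> 0) (at_right 0)" by simp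
    qed
    thus "(((\<lambda>y. F (of_real y)) \<circ> real_of_ereal) \<longlongrightarrow> 0) (at_right 0)"
      unfolding zero_ereal_def by (simp add: ereal_tendsto_simps1)
    have "((\<lambda>y. F (of_real y)) \<longlongrightarrow> 0) at_top"
    proof (rule Lim_null_comparison)
      show "\<forall>\<^sub>F y in at_top. norm (F (of_real y)) \<le> fact i * ((1 + y) ^ (2 + i) * exp (- (Re w * y)))"
      proof (rule eventually_mono[OF eventually_gt_at_top[of 0]])
        fix y :: real assume y: "y > 0"
        have "norm (F (of_real y)) \<le> (1 + y) * (fact i * (1 + y) ^ (1 + i)) * exp (- (Re w * y))"
          unfolding Fn[OF y] using y by (intro mult_right_mono mult_mono pow_ln_bound) auto
        thus "norm (F (of_real y)) \<le> fact i * ((1 + y) ^ (2 + i) * exp (- (Re w * y)))" by (simp add: mult_ac)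
      qed
      have "((\<lambda>y::real. (1 + y) ^ (2 + i) * exp (- (Re w * y))) \<longlongrightarrow> 0) at_top" using w by real_asymp
      from tendsto_mult_right_zero[OF this] show "((\<lambda>y::real. fact i * ((1 + y) ^ (2 + i) * exp (- (Re w * y)))) \<longlongrightarrow> 0) at_top" .
    qed
    thus "(((\<lambda>y. F (of_real y)) \<circ> real_of_ereal) \<longlongrightarrow> 0) (at_left \<infinity>)"
      by (simp add: ereal_tendsto_simps1)
  qed simp
  hence "laplace g w = 0"
    by (simp add: interval_lebesgue_integral_0_infty set_lebesgue_integral_def fg laplace_def)
  moreover have "laplace g w = 2 * laplace (pow_ln 1 i) w + of_nat i * laplace (pow_ln 1 (i - 1)) w - w * laplace (pow_ln 2 i) w"
    unfolding g_def by (subst laplace_diff | subst laplace_add | intro poly_bdd_add poly_bdd_cmult poly_bdd_pow_ln w | simp add: laplace_cmult)+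
  ultimately show ?thesis by simp
qed


section \<open>Inverse Laplace transforms of powers of the logarithm\<close>

lemma exists_antiderivative_poly: "\<exists>P :: 'a :: field_char_0 poly. pderiv P = p \<and> (\<forall>i. coeff P (Suc i) = coeff p i / of_nat (Suc i)) \<and> degree P \<le> Suc (degree p)"
proof -
  define P where "P = (\<Sum>i\<le>degree p. monom (coeff p i / of_nat (Suc i)) (Suc i))"
  have cP: "coeff P (Suc i) = coeff p i / of_nat (Suc i)" for i
  proof -
    have "coeff P (Suc i) = (\<Sum>j\<le>degree p. if j = i then coeff p i / of_nat (Suc i) else 0)"
      unfolding P_def coeff_sum coeff_monom by (intro sum.cong) auto
    also have "\<dots> = coeff p i / of_nat (Suc i)" by (simp add: coeff_eq_0)
    finally show ?thesis .
  qed
  have "pderiv P = p"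
    by (rule poly_eqI) (simp add: coeff_pderiv cP del: of_nat_Suc)
  moreover have "degree P \<le> Suc (degree p)"
  proof (rule degree_le, intro allI impI)
    fix i assume "Suc (degree p) < i"
    thus "coeff P i = 0" by (cases i) (auto simp: cP coeff_eq_0)
  qed
  ultimately show ?thesis using cP by blast
qed

lemma Re_pos_not_nonpos: "Re w > 0 \<Longrightarrow> w \<notin> \<real>\<^sub>\<le>\<^sub>0" "Re w > 0 \<Longrightarrow> w \<noteq> 0"
  by (auto simp: complex_nonpos_Reals_iff)

lemma constant_on_Re_pos:
  assumes "\<And>w. Re w > 0 \<Longrightarrow> (f has_field_derivative 0) (at w)"
  shows "\<exists>c. \<forall>w. Re w > 0 \<longrightarrow> f w = c"
proof -
  have "\<exists>c. \<forall>w\<in>{w. Re w > 0}. f w = c"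
    by (rule has_field_derivative_zero_constant[OF convex_halfspace_Re_gt])
       (use assms in \<open>auto intro: has_field_derivative_at_within\<close>)
  thus ?thesis by auto
qed

lemma has_field_derivative_poly_Ln:
  assumes "Re w > 0"
  shows "((\<lambda>w. poly P (Ln w)) has_field_derivative poly (pderiv P) (Ln w) / w) (at w)"
  using DERIV_chain2[OF poly_DERIV has_field_derivative_Ln[OF Re_pos_not_nonpos(1)[OF assms]], of P]
  by (simp add: divide_inverse)

lemma has_field_derivative_square_laplace_pow_ln:
  assumes w: "Re w > 0"
  shows "((\<lambda>w. w ^ 2 * laplace (pow_ln 1 i) w) has_field_derivative - of_nat i * w * laplace (pow_ln 1 (i - 1)) w) (at w)"
proof -
  have "(laplace (pow_ln 1 i) has_field_derivative - laplace (pow_ln 2 i) w) (at w)"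
    using has_field_derivative_laplace[OF poly_bdd_pow_ln[of 1 i] w] by (simp add: mult_pow_ln numeral_2_eq_2)
  hence "((\<lambda>w. w ^ 2 * laplace (pow_ln 1 i) w) has_field_derivative 2 * w * laplace (pow_ln 1 i) w - w * (w * laplace (pow_ln 2 i) w)) (at w)"
    by (auto intro!: derivative_eq_intros simp: power2_eq_square)
  thus ?thesis unfolding laplace_pow_ln_2[OF w] by (simp add: algebra_simps)
qed

text \<open>The derivative vanishes, so the value at \<open>w = 1\<close>, which is the integral of
  \<open>y * exp (- y)\<close>, decides.\<close>

lemma laplace_pow_ln_0:
  assumes w: "Re w > 0" shows "w ^ 2 * laplace (pow_ln 1 0) w = 1"
proof -
  obtain c where c: "\<And>w. Re w > 0 \<Longrightarrow> w ^ 2 * laplace (pow_ln 1 0) w = c"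
    using constant_on_Re_pos[of "\<lambda>w. w ^ 2 * laplace (pow_ln 1 0) w"] has_field_derivative_square_laplace_pow_ln[of _ 0] by auto
  have "laplace (pow_ln 1 0) 1 = (\<integral>y. of_real (y ^ 1 * exp (-y) * indicator {0 <..} y) \<partial>lborel)"
    unfolding laplace_def by (intro Bochner_Integration.integral_cong) (auto simp: pow_ln_def exp_of_real[symmetric])
  also have "\<dots> = of_real (\<integral>y. y ^ 1 * exp (-y) * indicator {0 <..} y \<partial>lborel)"
    by (rule integral_complex_of_real)
  also have "(\<integral>y. y ^ 1 * exp (-y) * indicator {0 <..} y \<partial>lborel) = (1::real)"
    using has_bochner_integral_integral_eq[OF has_bochner_integral_I0i_power_exp_m[of 1]] by simp
  finally have "laplace (pow_ln 1 0) 1 = 1" by simp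
  with c[of 1] c[OF w] show ?thesis by simp
qed

text \<open>The derivative of \<open>w ^ 2 * laplace (pow_ln 1 d) w\<close> only involves \<open>pow_ln 1 (d - 1)\<close>, which gives an induction on \<open>d\<close>
  that avoids the derivatives of the Gamma function.\<close>

lemma laplace_pow_ln_1_poly:
  "\<exists>P. degree P \<le> d \<and> coeff P d = (-1) ^ d \<and> (\<forall>w. Re w > 0 \<longrightarrow> laplace (pow_ln 1 d) w = poly P (Ln w) / w ^ 2)"
proof (induction d)
  case 0
  show ?case
  proof (rule exI[of _ 1], intro conjI allI impI)
    fix w :: complex assume "Re w > 0"
    thus "laplace (pow_ln 1 0) w = poly 1 (Ln w) / w ^ 2"
      using laplace_pow_ln_0[of w] Re_pos_not_nonpos(2)[of w] by (simp add: field_simps)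
  qed auto
next
  case (Suc d)
  then obtain p where p: "degree p \<le> d" "coeff p d = (-1) ^ d" "\<And>w. Re w > 0 \<Longrightarrow> laplace (pow_ln 1 d) w = poly p (Ln w) / w ^ 2" by blast
  obtain P0 where P0: "pderiv P0 = smult (- of_nat (Suc d)) p" "\<And>i. coeff P0 (Suc i) = coeff (smult (- of_nat (Suc d)) p) i / of_nat (Suc i)"
    "degree P0 \<le> Suc (degree (smult (- of_nat (Suc d)) p))" using exists_antiderivative_poly by blast
  have "\<exists>c. \<forall>w. Re w > 0 \<longrightarrow> w ^ 2 * laplace (pow_ln 1 (Suc d)) w - poly P0 (Ln w) = c"
  proof (rule constant_on_Re_pos)
    fix w :: complex assume w: "Re w > 0"
    have "((\<lambda>w. w ^ 2 * laplace (pow_ln 1 (Suc d)) w - poly P0 (Ln w)) has_field_derivative 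
        - of_nat (Suc d) * w * laplace (pow_ln 1 (Suc d - 1)) w - poly (pderiv P0) (Ln w) / w) (at w)"
      by (intro DERIV_diff has_field_derivative_square_laplace_pow_ln has_field_derivative_poly_Ln w)
    also have "- of_nat (Suc d) * w * laplace (pow_ln 1 (Suc d - 1)) w - poly (pderiv P0) (Ln w) / w = 0"
      using Re_pos_not_nonpos(2)[OF w] unfolding diff_Suc_1 p(3)[OF w] P0(1) by (simp add: power2_eq_square del: of_nat_Suc)
    finally show "((\<lambda>w. w ^ 2 * laplace (pow_ln 1 (Suc d)) w - poly P0 (Ln w)) has_field_derivative 0) (at w)" .
  qed
  then obtain c where c: "\<And>w. Re w > 0 \<Longrightarrow> w ^ 2 * laplace (pow_ln 1 (Suc d)) w - poly P0 (Ln w) = c" by blast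
  show ?case
  proof (rule exI[of _ "P0 + [:c:]"], intro conjI allI impI)
    have "degree P0 \<le> Suc d" using P0(3) p(1) degree_smult_le[of "- of_nat (Suc d)" p] by linarith
    thus "degree (P0 + [:c:]) \<le> Suc d" by (intro degree_add_le) auto
    show "coeff (P0 + [:c:]) (Suc d) = (-1) ^ Suc d"
      by (simp add: P0(2) p(2) del: of_nat_Suc)
    fix w :: complex assume w: "Re w > 0"
    show "laplace (pow_ln 1 (Suc d)) w = poly (P0 + [:c:]) (Ln w) / w ^ 2"
      using c[OF w] Re_pos_not_nonpos(2)[OF w] by (simp add: field_simps)
  qed
qed

definition pow_ln_poly :: "nat \<Rightarrow> complex poly \<Rightarrow> real \<Rightarrow> complex" where
  "pow_ln_poly n q y = (if y > 0 then of_real y ^ n * poly q (of_real (ln y)) else 0)"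

lemma pow_ln_poly_add: "pow_ln_poly n (p + q) = (\<lambda>y. pow_ln_poly n p y + pow_ln_poly n q y)"
  by (auto simp: pow_ln_poly_def algebra_simps)

lemma pow_ln_poly_monom: "pow_ln_poly n (monom c i) = (\<lambda>y. c * pow_ln n i y)"
  by (auto simp: pow_ln_poly_def pow_ln_def poly_monom)

lemma pow_ln_poly_eq_sum: "pow_ln_poly n q = (\<lambda>y. \<Sum>i\<le>degree q. coeff q i * pow_ln n i y)"
  by (auto simp: pow_ln_poly_def pow_ln_def poly_altdef sum_distrib_left mult_ac)

lemma poly_bdd_pow_ln_poly: "n \<ge> 1 \<Longrightarrow> poly_bdd (pow_ln_poly n q)"
  unfolding pow_ln_poly_eq_sum by (intro poly_bdd_sum poly_bdd_cmult poly_bdd_pow_ln)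

lemma mult_pow_ln_poly: "of_real y * pow_ln_poly n q y = pow_ln_poly (Suc n) q y"
  by (simp add: pow_ln_poly_def)

text \<open>The transform of \<open>pow_ln 1 d\<close> is a polynomial in \<open>Ln w\<close> over
  \<open>w ^ 2\<close> with top coefficient \<open>(-1) ^ d\<close>. The correspondence is therefore
  triangular and is inverted by splitting off the top degree. The number \<open>d\<close> only
  bounds the degree, so that the remainder \<open>p'\<close> fits the induction.\<close>

lemma exists_inverse_Laplace_log_poly:
  "degree p \<le> d \<Longrightarrow> \<exists>q. degree q \<le> d \<and> coeff q d = (-1) ^ d * coeff p d \<and> (\<forall>w. Re w > 0 \<longrightarrow> laplace (pow_ln_poly 1 q) w = poly p (Ln w) / w ^ 2)"
proof (induction d arbitrary: p)
  case 0
  then obtain c where p: "p = [:c:]" by (auto elim: degree_eq_zeroE)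
  show ?case
  proof (rule exI[of _ "monom c 0"], intro conjI allI impI)
    fix w :: complex assume w: "Re w > 0"
    show "laplace (pow_ln_poly 1 (monom c 0)) w = poly p (Ln w) / w ^ 2"
      using laplace_pow_ln_0[OF w] Re_pos_not_nonpos(2)[OF w] unfolding pow_ln_poly_monom laplace_cmult by (simp add: p field_simps)
  qed (auto simp: p monom_0)
next
  case (Suc d)
  obtain P where P: "degree P \<le> Suc d" "coeff P (Suc d) = (-1) ^ Suc d" "\<And>w. Re w > 0 \<Longrightarrow> laplace (pow_ln 1 (Suc d)) w = poly P (Ln w) / w ^ 2"
    using laplace_pow_ln_1_poly[of "Suc d"] by blast
  define c where "c = (-1) ^ Suc d * coeff p (Suc d)"
  define p' where "p' = p - smult c P"
  have "degree p' \<le> d"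
  proof (rule degree_le, intro allI impI)
    fix i assume i: "d < i"
    show "coeff p' i = 0"
    proof (cases "i = Suc d")
      case True
      thus ?thesis by (simp add: p'_def c_def P(2) flip: power_mult_distrib)
    next
      case False
      hence "i > degree p" "i > degree P" using i Suc.prems P(1) by auto
      thus ?thesis by (simp add: p'_def coeff_eq_0)
    qed
  qed
  from Suc.IH[OF this] obtain q where q: "degree q \<le> d" "\<And>w. Re w > 0 \<Longrightarrow> laplace (pow_ln_poly 1 q) w = poly p' (Ln w) / w ^ 2" by blast
  show ?case
  proof (rule exI[of _ "monom c (Suc d) + q"], intro conjI allI impI)
    show "degree (monom c (Suc d) + q) \<le> Suc d" using q(1) by (intro degree_add_le degree_monom_le) auto
    show "coeff (monom c (Suc d) + q) (Suc d) = (- 1) ^ Suc d * coeff p (Suc d)"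
      using q(1) by (simp add: coeff_eq_0 c_def)
    fix w :: complex assume w: "Re w > 0"
    have "laplace (pow_ln_poly 1 (monom c (Suc d) + q)) w = c * laplace (pow_ln 1 (Suc d)) w + laplace (pow_ln_poly 1 q) w"
      unfolding pow_ln_poly_add pow_ln_poly_monom by (subst laplace_add) (auto intro!: poly_bdd_cmult poly_bdd_pow_ln poly_bdd_pow_ln_poly simp: w laplace_cmult)
    also have "\<dots> = c * (poly P (Ln w) / w ^ 2) + poly p' (Ln w) / w ^ 2" by (simp only: P(3)[OF w] q(2)[OF w])
    also have "\<dots> = poly p (Ln w) / w ^ 2" by (simp add: p'_def diff_divide_distrib)
    finally show "laplace (pow_ln_poly 1 (monom c (Suc d) + q)) w = poly p (Ln w) / w ^ 2" .
  qed
qed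

text \<open>One differentiation turns \<open>w ^ Suc a * poly r (Ln w)\<close> into
  \<open>w ^ a\<close> times the value of \<open>smult (of_nat (Suc a)) r + pderiv r\<close>. The
  second summand does not reach degree \<open>i\<close>, so the top coefficient is just multiplied
  by \<open>Suc a\<close>.\<close>

lemma higher_deriv_power_Ln:
  assumes "N \<le> m"
  shows "\<exists>r. degree r \<le> i \<and> coeff r i = fact m / fact (m - N) \<and> 
     (\<forall>w. Re w > 0 \<longrightarrow> (deriv ^^ N) (\<lambda>w. w ^ m * Ln w ^ i) w = w ^ (m - N) * poly r (Ln w))"
  using assms
proof (induction N)
  case 0
  show ?case
    by (rule exI[of _ "monom 1 i"]) (auto simp: degree_monom_le poly_monom)
next
  case (Suc N)
  then obtain r where r: "degree r \<le> i" "coeff r i = fact m / fact (m - N)" 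
     "\<And>w. Re w > 0 \<Longrightarrow> (deriv ^^ N) (\<lambda>w. w ^ m * Ln w ^ i) w = w ^ (m - N) * poly r (Ln w)" by auto
  obtain a where a: "m - N = Suc a" "m - Suc N = a" using Suc.prems by (cases "m - N") auto
  define r' where "r' = smult (of_nat (Suc a)) r + pderiv r"
  have "coeff (pderiv r) i = 0" using r(1) by (simp add: coeff_pderiv coeff_eq_0)
  hence "coeff r' i = of_nat (Suc a) * (fact m / fact (Suc a))" by (simp add: r'_def r(2) a(1) del: of_nat_Suc fact_Suc)
  also have "\<dots> = fact m / fact a" by (simp add: fact_Suc del: of_nat_Suc)
  finally have c: "coeff r' i = fact m / fact a" .
  have deg: "degree r' \<le> i" unfolding r'_def using r(1) degree_pderiv[of r]
    by (intro degree_add_le order.trans[OF degree_smult_le]) auto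
  have "(deriv ^^ Suc N) (\<lambda>w. w ^ m * Ln w ^ i) w = w ^ a * poly r' (Ln w)" if w: "Re w > 0" for w
  proof -
    have "(deriv ^^ Suc N) (\<lambda>w. w ^ m * Ln w ^ i) w = deriv (\<lambda>w. w ^ Suc a * poly r (Ln w)) w"
      unfolding funpow.simps o_def by (rule deriv_cong_Re_pos[OF _ w]) (simp only: r(3) a)
    also have "\<dots> = w ^ a * poly r' (Ln w)"
    proof (rule DERIV_imp_deriv)
      have 1: "((\<lambda>w. w ^ Suc a) has_field_derivative of_nat (Suc a) * w ^ a) (at w)"
        by (rule DERIV_cong, rule DERIV_power, rule DERIV_ident) (simp del: power_Suc of_nat_Suc)
      have "((\<lambda>w. w ^ Suc a * poly r (Ln w)) has_field_derivative 
         of_nat (Suc a) * w ^ a * poly r (Ln w) + poly (pderiv r) (Ln w) / w * w ^ Suc a) (at w)"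
        by (rule DERIV_mult[OF 1 has_field_derivative_poly_Ln[OF w]])
      also have "of_nat (Suc a) * w ^ a * poly r (Ln w) + poly (pderiv r) (Ln w) / w * w ^ Suc a = w ^ a * poly r' (Ln w)"
        using Re_pos_not_nonpos(2)[OF w] by (simp add: r'_def algebra_simps)
      finally show "((\<lambda>w. w ^ Suc a * poly r (Ln w)) has_field_derivative w ^ a * poly r' (Ln w)) (at w)" .
    qed
    finally show ?thesis .
  qed
  thus ?case using c deg a(2) by blast
qed

text \<open>\<open>q\<close> does not depend on \<open>N\<close>: it is the factor in the formal inverse transform \<open>y powr (- m - 1) * q (ln y)\<close> of
  \<open>w ^ m * Ln w ^ i\<close>, made integrable at \<open>0\<close> by the factor \<open>y ^ N\<close>.\<close>

lemma exists_main_term: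
  "\<exists>q. degree q \<le> i - 1 \<and> (i \<ge> 1 \<longrightarrow> coeff q (i - 1) = (-1) ^ (m + i) * of_nat i * fact m) \<and> (i = 0 \<longrightarrow> q = 0) \<and>
     (\<forall>N w. N \<ge> m + 2 \<longrightarrow> Re w > 0 \<longrightarrow> laplace (pow_ln_poly (N - m - 1) q) w = (-1) ^ N * (deriv ^^ N) (\<lambda>w. w ^ m * Ln w ^ i) w)"
proof -
  obtain r where r': "degree r \<le> i \<and> coeff r i = fact m / fact (m - m) \<and> 
     (\<forall>w. Re w > 0 \<longrightarrow> (deriv ^^ m) (\<lambda>w. w ^ m * Ln w ^ i) w = w ^ (m - m) * poly r (Ln w))"
    using higher_deriv_power_Ln[OF le_refl, of i m] by blast
  hence r: "degree r \<le> i" "coeff r i = fact m" 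
     "\<And>w. Re w > 0 \<Longrightarrow> (deriv ^^ m) (\<lambda>w. w ^ m * Ln w ^ i) w = poly r (Ln w)" by simp_all
  \<comment> \<open>After \<open>m\<close> derivatives no power of \<open>w\<close> is left, so the
    next one acts on the logarithms only. Here the degree drops from \<open>i\<close> to
    \<open>i - 1\<close>, and for \<open>i = 0\<close> everything vanishes.\<close>
  have d1: "(deriv ^^ Suc m) (\<lambda>w. w ^ m * Ln w ^ i) w = poly (pderiv r) (Ln w) / w" if w: "Re w > 0" for w
  proof -
    have "(deriv ^^ Suc m) (\<lambda>w. w ^ m * Ln w ^ i) w = deriv (\<lambda>w. poly r (Ln w)) w"
      unfolding funpow.simps o_def by (rule deriv_cong_Re_pos[OF _ w]) (simp only: r(3))
    also have "\<dots> = poly (pderiv r) (Ln w) / w"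
      by (rule DERIV_imp_deriv, rule has_field_derivative_poly_Ln[OF w])
    finally show ?thesis .
  qed
  define s where "s = pderiv (pderiv r) - pderiv r"
  have d2: "(deriv ^^ Suc (Suc m)) (\<lambda>w. w ^ m * Ln w ^ i) w = poly s (Ln w) / w ^ 2" if w: "Re w > 0" for w
  proof -
    have "(deriv ^^ Suc (Suc m)) (\<lambda>w. w ^ m * Ln w ^ i) w = deriv (\<lambda>w. poly (pderiv r) (Ln w) / w) w"
      unfolding funpow.simps(2)[of "Suc m"] o_def by (rule deriv_cong_Re_pos[OF _ w]) (simp only: d1)
    also have "\<dots> = poly s (Ln w) / w ^ 2"
    proof (rule DERIV_imp_deriv)
      have "((\<lambda>w. poly (pderiv r) (Ln w) / w) has_field_derivative 
         (poly (pderiv (pderiv r)) (Ln w) / w * w - poly (pderiv r) (Ln w) * 1) / (w * w)) (at w)"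
        by (rule DERIV_divide[OF has_field_derivative_poly_Ln[OF w] DERIV_ident]) (rule Re_pos_not_nonpos(2)[OF w])
      also have "(poly (pderiv (pderiv r)) (Ln w) / w * w - poly (pderiv r) (Ln w) * 1) / (w * w) = poly s (Ln w) / w ^ 2"
        using Re_pos_not_nonpos(2)[OF w] by (simp add: s_def power2_eq_square)
      finally show "((\<lambda>w. poly (pderiv r) (Ln w) / w) has_field_derivative poly s (Ln w) / w ^ 2) (at w)" .
    qed
    finally show ?thesis .
  qed
  have degs: "degree s \<le> i - 1" unfolding s_def
    using r(1) degree_pderiv[of r] degree_pderiv[of "pderiv r"] by (intro degree_diff_le) auto
  \<comment> \<open>The sign is that of \<open>(-1) ^ N\<close> at the first admissible value
    \<open>N = m + 2\<close>.\<close>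
  define p where "p = smult ((-1) ^ m) s"
  have "degree p \<le> i - 1" using degs unfolding p_def by (rule order.trans[OF degree_smult_le])
  from exists_inverse_Laplace_log_poly[OF this] obtain q where q: "degree q \<le> i - 1" "coeff q (i - 1) = (-1) ^ (i - 1) * coeff p (i - 1)"
    "\<And>w. Re w > 0 \<Longrightarrow> laplace (pow_ln_poly 1 q) w = poly p (Ln w) / w ^ 2" by blast
  have lead: "coeff q (i - 1) = (-1) ^ (m + i) * of_nat i * fact m" if i1: "i \<ge> 1"
  proof -
    obtain j where j: "i = Suc j" using i1 by (cases i) auto
    have "coeff (pderiv (pderiv r)) j = 0" using r(1) j by (simp add: coeff_pderiv coeff_eq_0)
    hence "coeff s j = - (of_nat i * fact m)" using r(2) by (simp add: s_def coeff_pderiv j del: of_nat_Suc)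
    thus ?thesis using q(2) by (simp add: p_def j power_add del: of_nat_Suc)
  qed
  have zero: "q = 0" if "i = 0"
  proof -
    have "pderiv r = 0" using r(1) that by (simp add: pderiv_eq_0_iff)
    hence "p = 0" by (simp add: p_def s_def)
    hence "coeff q 0 = 0" using q(2) that by simp
    moreover have "degree q = 0" using q(1) that by simp
    ultimately show ?thesis by (metis leading_coeff_0_iff)
  qed
  have main: "laplace (pow_ln_poly (Suc n) q) w = (-1) ^ (m + 2 + n) * (deriv ^^ (m + 2 + n)) (\<lambda>w. w ^ m * Ln w ^ i) w" if "Re w > 0" for n w
    using that
  proof (induction n arbitrary: w)
    case 0
    thus ?case using q(3)[of w] d2[of w] by (simp add: p_def)
  next
    case (Suc n)
    have "laplace (pow_ln_poly (Suc (Suc n)) q) w = laplace (\<lambda>y. of_real y * pow_ln_poly (Suc n) q y) w" by (simp only: mult_pow_ln_poly)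
    also have "\<dots> = - deriv (laplace (pow_ln_poly (Suc n) q)) w"
      using DERIV_imp_deriv[OF has_field_derivative_laplace[OF poly_bdd_pow_ln_poly[of "Suc n" q] Suc.prems]] by simp
    also have "deriv (laplace (pow_ln_poly (Suc n) q)) w = deriv (\<lambda>w. (-1) ^ (m + 2 + n) * (deriv ^^ (m + 2 + n)) (\<lambda>w. w ^ m * Ln w ^ i) w) w"
      by (rule deriv_cong_Re_pos[OF Suc.IH Suc.prems])
    also have "\<dots> = (-1) ^ (m + 2 + n) * deriv ((deriv ^^ (m + 2 + n)) (\<lambda>w. w ^ m * Ln w ^ i)) w"
    proof (rule deriv_cmult)
      have "(\<lambda>w. w ^ m * Ln w ^ i) holomorphic_on {w. Re w > 0}"
        using Re_pos_not_nonpos(1) by (intro holomorphic_intros) auto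
      hence "(deriv ^^ (m + 2 + n)) (\<lambda>w. w ^ m * Ln w ^ i) holomorphic_on {w. Re w > 0}"
        by (rule holomorphic_higher_deriv[OF _ open_Re_pos])
      thus "(deriv ^^ (m + 2 + n)) (\<lambda>w. w ^ m * Ln w ^ i) field_differentiable at w"
        using Suc.prems by (intro holomorphic_on_imp_differentiable_at[OF _ open_Re_pos]) auto
    qed
    finally show ?case by simp
  qed
  show ?thesis
  proof (intro exI[of _ q] conjI allI impI)
    fix N w assume N: "N \<ge> m + 2" and w: "Re w > 0"
    then obtain n where n: "N = m + 2 + n" using le_Suc_ex by blast
    thus "laplace (pow_ln_poly (N - m - 1) q) w = (-1) ^ N * (deriv ^^ N) (\<lambda>w. w ^ m * Ln w ^ i) w"
      using main[OF w, of n] by simp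
  qed (use q lead zero in auto)
qed


section \<open>A Tauberian theorem by Gaussian smoothing\<close>

text \<open>Completing the square compares the function with a normal density of variance 2.\<close>

lemma integrable_std_normal_exp_abs: "integrable lborel (\<lambda>z. std_normal_density z * exp (c * \<bar>z\<bar>))"
proof -
  have "integrable lborel (\<lambda>z. (sqrt 2 * exp (c ^ 2)) * normal_density 0 (sqrt 2) z)"
    by (intro integrable_mult_right integrable_normal_density) auto
  thus ?thesis
  proof (rule Bochner_Integration.integrable_bound)
    show "AE z in lborel. norm (std_normal_density z * exp (c * \<bar>z\<bar>)) \<le> norm ((sqrt 2 * exp (c ^ 2)) * normal_density 0 (sqrt 2) z)"
    proof (intro always_eventually allI)
      fix z :: real
      have "0 \<le> (c - \<bar>z\<bar> / 2) ^ 2" by simp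
      hence "- (z ^ 2 / 2) + c * \<bar>z\<bar> \<le> c ^ 2 + - (z ^ 2 / 4)" by (simp add: power2_eq_square algebra_simps)
      hence "exp (- (z ^ 2 / 2)) * exp (c * \<bar>z\<bar>) \<le> exp (c ^ 2) * exp (- (z ^ 2 / 4))"
        by (simp flip: exp_add)
      hence "1 / sqrt (2 * pi) * (exp (- (z ^ 2 / 2)) * exp (c * \<bar>z\<bar>)) \<le> 1 / sqrt (2 * pi) * (exp (c ^ 2) * exp (- (z ^ 2 / 4)))"
        by (rule mult_left_mono) auto
      moreover have "(sqrt 2 * exp (c ^ 2)) * normal_density 0 (sqrt 2) z = 1 / sqrt (2 * pi) * (exp (c ^ 2) * exp (- (z ^ 2 / 4)))"
        by (simp add: normal_density_def real_sqrt_mult field_simps)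
      moreover have "norm (std_normal_density z * exp (c * \<bar>z\<bar>)) = 1 / sqrt (2 * pi) * (exp (- (z ^ 2 / 2)) * exp (c * \<bar>z\<bar>))"
        by (simp add: std_normal_density_def abs_mult)
      ultimately show "norm (std_normal_density z * exp (c * \<bar>z\<bar>)) \<le> norm ((sqrt 2 * exp (c ^ 2)) * normal_density 0 (sqrt 2) z)"
        by simp
    qed
  qed auto
qed

lemma std_normal_Fourier:
  "complex_of_real (sqrt (2 * pi) * std_normal_density z) = (\<integral>u. of_real (std_normal_density u) * exp (\<i> * of_real (z * u)) \<partial>lborel)"
proof -
  have "complex_of_real (exp (- (z ^ 2) / 2)) = char std_normal_distribution z"
    by (simp add: char_std_normal_distribution)
  also have "\<dots> = (\<integral>u. std_normal_density u *\<^sub>R exp (\<i> * of_real (z * u)) \<partial>lborel)"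
    unfolding char_def by (subst integral_density) auto
  finally show ?thesis by (simp add: std_normal_density_def scaleR_conv_of_real)
qed

text \<open>The Gaussian weight is replaced by its own Fourier integral and the integrations are
  exchanged. After the substitution \<open>y = Y - \<delta> * z\<close> the inner integral is
  \<open>laplace h\<close> on the line with real part \<open>l\<close>. This serves instead of an
  inversion formula: the weight makes the integral along the line converge although the transform
  need not be integrable there.\<close>

lemma gaussian_smoothing_Laplace:
  fixes Y :: real
  assumes h: "poly_bdd h" and l: "l > 0" and \<delta>: "\<delta> > 0"
  defines "g \<equiv> (\<lambda>z. h (Y - \<delta> * z) * exp (- (of_real l * of_real (Y - \<delta> * z))))"
  shows "integrable lborel g"
    and "of_real (sqrt (2 * pi)) * (\<integral>z. of_real (std_normal_density z) * g z \<partial>lborel) =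
     (\<integral>u. of_real (std_normal_density u) * (exp (\<i> * of_real (u * Y / \<delta>)) * laplace h (Complex l (u / \<delta>)) / of_real \<delta>) \<partial>lborel)"
proof -
  have hm [measurable]: "h \<in> borel_measurable borel" using h by (rule poly_bdd_measurable)
  have "integrable lborel (\<lambda>y. h y * exp (- (of_real l * of_real y)))"
    by (rule poly_bdd_laplace_integrable[OF h]) (use l in simp)
  from lborel_integrable_real_affine[OF this, of "-\<delta>" Y] show gi: "integrable lborel g"
    using \<delta> by (simp add: g_def)
  hence gm [measurable]: "g \<in> borel_measurable borel" by auto
  have inner: "(\<integral>z. exp (\<i> * of_real (z * u)) * g z \<partial>lborel) = exp (\<i> * of_real (u * Y / \<delta>)) * laplace h (Complex l (u / \<delta>)) / of_real \<delta>" for u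
  proof -
    have "laplace h (Complex l (u / \<delta>)) = \<bar>-\<delta>\<bar> *\<^sub>R (\<integral>z. h (Y + -\<delta> * z) * exp (- (Complex l (u / \<delta>) * of_real (Y + -\<delta> * z))) \<partial>lborel)"
      unfolding laplace_def by (rule lborel_integral_real_affine) (use \<delta> in auto)
    also have "\<dots> = of_real \<delta> * (\<integral>z. exp (- (\<i> * of_real (u * Y / \<delta>))) * (exp (\<i> * of_real (z * u)) * g z) \<partial>lborel)"
    proof -
      have "h (Y + -\<delta> * z) * exp (- (Complex l (u / \<delta>) * of_real (Y + -\<delta> * z))) = 
           exp (- (\<i> * of_real (u * Y / \<delta>))) * (exp (\<i> * of_real (z * u)) * g z)" for z
      proof -
        have "- (Complex l (u / \<delta>) * of_real (Y + -\<delta> * z)) = - (\<i> * of_real (u * Y / \<delta>)) + \<i> * of_real (z * u) + - (of_real l * of_real (Y - \<delta> * z))"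
          using \<delta> by (simp add: complex_eq_iff field_simps)
        thus ?thesis by (simp only: exp_add g_def) (simp add: mult_ac)
      qed
      thus ?thesis using \<delta> by (simp only: scaleR_conv_of_real abs_minus_cancel abs_of_pos)
    qed
    also have "\<dots> = of_real \<delta> * (exp (- (\<i> * of_real (u * Y / \<delta>))) * (\<integral>z. exp (\<i> * of_real (z * u)) * g z \<partial>lborel))"
      by simp
    finally show ?thesis using \<delta> by (simp add: exp_minus field_simps)
  qed
  define F where "F = (\<lambda>(z::real, u::real). of_real (std_normal_density u) * exp (\<i> * of_real (z * u)) * g z)"
  have Fm: "F \<in> borel_measurable (lborel \<Otimes>\<^sub>M lborel)"
    unfolding F_def by measurable
  have Fi: "integrable (lborel \<Otimes>\<^sub>M lborel) F"
  proof (rule lborel_pair.Fubini_integrable[OF Fm])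
    have "(\<lambda>z. \<integral>u. norm (F (z, u)) \<partial>lborel) = (\<lambda>z. norm (g z))"
      by (auto simp: F_def norm_mult)
    thus "integrable lborel (\<lambda>z. \<integral>u. norm (F (z, u)) \<partial>lborel)" using gi by simp
    show "AE z in lborel. integrable lborel (\<lambda>u. F (z, u))"
    proof (intro always_eventually allI)
      fix z
      have "integrable lborel (\<lambda>u. norm (g z) * std_normal_density u)"
        by (intro integrable_mult_right integrable_normal_density) auto
      thus "integrable lborel (\<lambda>u. F (z, u))"
        by (rule Bochner_Integration.integrable_bound) (auto simp: F_def norm_mult)
    qed
  qed
  have "of_real (sqrt (2 * pi)) * (\<integral>z. of_real (std_normal_density z) * g z \<partial>lborel) = 
        (\<integral>z. of_real (sqrt (2 * pi) * std_normal_density z) * g z \<partial>lborel)"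
    by (simp add: mult.assoc)
  also have "\<dots> = (\<integral>z. (\<integral>u. F (z, u) \<partial>lborel) \<partial>lborel)"
    unfolding std_normal_Fourier by (simp add: F_def)
  also have "\<dots> = (\<integral>u. (\<integral>z. F (z, u) \<partial>lborel) \<partial>lborel)"
    using lborel_pair.Fubini_integral[of "\<lambda>z u. F (z, u)"] Fi by simp
  also have "\<dots> = (\<integral>u. of_real (std_normal_density u) * (\<integral>z. exp (\<i> * of_real (z * u)) * g z \<partial>lborel) \<partial>lborel)"
    by (simp add: F_def mult.assoc)
  finally show "of_real (sqrt (2 * pi)) * (\<integral>z. of_real (std_normal_density z) * g z \<partial>lborel) =
     (\<integral>u. of_real (std_normal_density u) * (exp (\<i> * of_real (u * Y / \<delta>)) * laplace h (Complex l (u / \<delta>)) / of_real \<delta>) \<partial>lborel)"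
    unfolding inner .
qed

lemma std_normal_integral_exp_bound:
  fixes f :: "real \<Rightarrow> complex"
  assumes bd: "\<And>z. norm (f z) \<le> K * exp (c * \<bar>z\<bar>)"
  shows "norm (\<integral>z. of_real (std_normal_density z) * f z \<partial>lborel) \<le> K * (\<integral>z. std_normal_density z * exp (c * \<bar>z\<bar>) \<partial>lborel)"
proof (cases "integrable lborel (\<lambda>z. of_real (std_normal_density z) * f z)")
  case True
  have "norm (\<integral>z. of_real (std_normal_density z) * f z \<partial>lborel) \<le> (\<integral>z. K * (std_normal_density z * exp (c * \<bar>z\<bar>)) \<partial>lborel)"
  proof (rule Bochner_Integration.integral_norm_bound_integral[OF True])
    show "integrable lborel (\<lambda>z. K * (std_normal_density z * exp (c * \<bar>z\<bar>)))"
      by (intro integrable_mult_right integrable_std_normal_exp_abs)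
    fix z :: real
    show "norm (of_real (std_normal_density z) * f z) \<le> K * (std_normal_density z * exp (c * \<bar>z\<bar>))"
      using mult_left_mono[OF bd[of z] normal_density_nonneg[of 0 1 z]] by (simp add: norm_mult mult_ac)
  qed
  thus ?thesis by simp
next
  case False
  \<comment> \<open>The integral of a non-integrable function is 0, so a nonnegative right-hand side
    suffices.\<close>
  have "K \<ge> 0" using order.trans[OF norm_ge_zero bd[of 0]] by simp
  thus ?thesis using False by (simp add: not_integrable_integral_eq)
qed

text \<open>Smoothing at scale \<open>Y powr (- B)\<close> costs \<open>Y ^ (2 * B)\<close> on the Laplace side and \<open>Y ^ A / Y ^ B\<close> for undoing it.\<close>

lemma tauber:
  assumes h: "poly_bdd h" and C0: "C0 \<ge> 0" "\<And>y. y \<ge> 0 \<Longrightarrow> norm (h y) \<le> C0 * (1 + y) ^ A"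
    and reg: "\<And>y y'. 0 \<le> y \<Longrightarrow> y' \<le> y \<Longrightarrow> norm (h y - h y') \<le> C0 * (1 + y) ^ A * ((y - y') + exp (- y))"
    and C1: "C1 \<ge> 0" "\<And>Y \<tau>. Y \<ge> Y0 \<Longrightarrow> norm (laplace h (Complex (1 / Y) \<tau>)) \<le> C1 * Y ^ M * (1 + \<bar>\<tau>\<bar>)"
  shows "\<exists>C\<ge>0. \<exists>Y1. \<forall>Y\<ge>Y1. norm (h Y) \<le> C * (Y ^ (M + 2 * B) + Y ^ A / Y ^ B)"
proof -
  define G where "G c = (\<integral>z. std_normal_density z * exp (c * \<bar>z\<bar>) \<partial>lborel)" for c
  have G0: "G c \<ge> 0" for c unfolding G_def by (intro Bochner_Integration.integral_nonneg) auto
  \<comment> \<open>The 2 counts two errors, the change of \<open>h\<close> and that of the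
    exponential weight. \<open>2 ^ A\<close> stems from \<open>1 + Y \<le> 2 * Y\<close>,
    \<open>fact A * exp 1\<close> from \<open>power_le_fact_exp\<close> at
    \<open>1 + \<bar>z\<bar>\<close>, and \<open>fact B\<close> from the bound \<open>eY\<close>.
    Three factors \<open>exp \<bar>z\<bar>\<close> accumulate, hence \<open>G 3\<close>.\<close>
  define K where "K = 2 * C0 * 2 ^ A * fact A * exp 1 * fact B"
  have K0: "K \<ge> 0" using C0(1) by (simp add: K_def)
  define C where "C = exp 1 * C1 * G 1 + K * G 3"
  have "C \<ge> 0" using K0 G0 C1(1) by (simp add: C_def)
  moreover have "\<forall>Y\<ge>max 1 Y0. norm (h Y) \<le> C * (Y ^ (M + 2 * B) + Y ^ A / Y ^ B)"
  proof (intro allI impI)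
    fix Y assume "Y \<ge> max 1 Y0"
    hence Y: "Y \<ge> 1" "Y \<ge> Y0" by auto
    define \<delta> where "\<delta> = 1 / Y ^ B"
    have \<delta>: "\<delta> > 0" "\<delta> \<le> 1" using Y by (auto simp: \<delta>_def)
    \<comment> \<open>With this choice the weight \<open>exp (- (l * y))\<close> equals
      \<open>exp (- 1)\<close> at \<open>y = Y\<close>, so undoing it costs only the constant
      \<open>exp 1\<close>.\<close>
    define l where "l = 1 / Y"
    have l: "l > 0" "l \<le> 1" using Y by (auto simp: l_def)
    define g where "g z = h (Y - \<delta> * z) * exp (- (of_real l * of_real (Y - \<delta> * z)))" for z
    note sm = gaussian_smoothing_Laplace[OF h l(1) \<delta>(1), of Y, folded g_def]
    define J where "J = (\<integral>z. of_real (std_normal_density z) * g z \<partial>lborel)"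
    \<comment> \<open>One factor \<open>1 / \<delta>\<close> belongs to the substitution in the
      smoothing formula, the other to evaluating the transform at height
      \<open>u / \<delta>\<close>.\<close>
    have "norm (of_real (sqrt (2 * pi)) * J) \<le> (C1 * Y ^ M / \<delta> ^ 2) * G 1"
      unfolding J_def sm(2) G_def
    proof (rule std_normal_integral_exp_bound)
      fix u :: real
      have "norm (laplace h (Complex l (u / \<delta>))) \<le> C1 * Y ^ M * (1 + \<bar>u / \<delta>\<bar>)"
        unfolding l_def by (rule C1(2)[OF Y(2)])
      also have "1 + \<bar>u / \<delta>\<bar> \<le> (1 + \<bar>u\<bar>) / \<delta>" using \<delta> by (simp add: field_simps)
      also have "1 + \<bar>u\<bar> \<le> exp (1 * \<bar>u\<bar>)" by simp
      finally have "norm (laplace h (Complex l (u / \<delta>))) \<le> C1 * Y ^ M * (exp (1 * \<bar>u\<bar>) / \<delta>)"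
        using \<delta> C1(1) Y by (auto simp: mult_left_mono divide_right_mono)
      hence "norm (laplace h (Complex l (u / \<delta>))) / \<delta> \<le> C1 * Y ^ M * (exp (1 * \<bar>u\<bar>) / \<delta>) / \<delta>"
        using \<delta> by (intro divide_right_mono) auto
      thus "norm (exp (\<i> * of_real (u * Y / \<delta>)) * laplace h (Complex l (u / \<delta>)) / of_real \<delta>) \<le> C1 * Y ^ M / \<delta> ^ 2 * exp (1 * \<bar>u\<bar>)"
        using \<delta> by (simp add: norm_mult norm_divide power2_eq_square)
    qed
    moreover have "norm J \<le> norm (of_real (sqrt (2 * pi)) * J)"
    proof -
      have "sqrt (2 * pi) \<ge> 1" using pi_ge_two by simp
      thus ?thesis using mult_right_mono[of 1 "sqrt (2 * pi)" "norm J"] by (simp add: norm_mult)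
    qed
    ultimately have J: "norm J \<le> C1 * G 1 * Y ^ (M + 2 * B)"
      using Y by (simp add: \<delta>_def power_divide power_add power_mult mult_ac flip: power_mult)
    have eY: "exp (- Y) \<le> fact B * \<delta>"
      using power_le_fact_exp[of Y B] Y by (simp add: \<delta>_def exp_minus field_simps)
    have "norm (h Y - exp 1 * J) \<le> (K * Y ^ A * \<delta>) * G 3"
    proof -
      have i1: "integrable lborel (\<lambda>z. of_real (std_normal_density z) * h Y)"
        by (intro integrable_mult_left integrable_of_real integrable_normal_density) auto
      have gm [measurable]: "g \<in> borel_measurable borel" using sm(1) by auto
      have i2: "integrable lborel (\<lambda>z. of_real (std_normal_density z) * (exp 1 * g z))"
      proof (rule Bochner_Integration.integrable_bound[OF integrable_mult_right[OF sm(1), of "exp 1"]])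
        show "AE z in lborel. norm (of_real (std_normal_density z) * (exp 1 * g z)) \<le> norm (exp 1 * g z)"
        proof (intro always_eventually allI)
          fix z :: real
          have "1 / sqrt (2 * pi) \<le> 1" using pi_ge_two by simp
          hence "1 / sqrt (2 * pi) * exp (- z\<^sup>2 / 2) \<le> 1 * 1" by (intro mult_mono) auto
          hence "std_normal_density z \<le> 1" by (simp add: std_normal_density_def)
          hence "std_normal_density z * norm (exp 1 * g z) \<le> 1 * norm (exp 1 * g z)" by (intro mult_right_mono) auto
          thus "norm (of_real (std_normal_density z) * (exp 1 * g z)) \<le> norm (exp 1 * g z)"
            by (simp add: norm_mult)
        qed
      qed auto
      have "h Y - exp 1 * J = (\<integral>z. of_real (std_normal_density z) * h Y \<partial>lborel) - (\<integral>z. of_real (std_normal_density z) * (exp 1 * g z) \<partial>lborel)"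
        by (simp add: J_def mult.left_commute)
      also have "\<dots> = (\<integral>z. of_real (std_normal_density z) * (h Y - exp 1 * g z) \<partial>lborel)"
        using Bochner_Integration.integral_diff[OF i1 i2] by (simp add: right_diff_distrib)
      also have "norm \<dots> \<le> (K * Y ^ A * \<delta>) * G 3"
        unfolding G_def
      proof (rule std_normal_integral_exp_bound)
        fix z :: real
        define v where "v = \<delta> * z"
        have v: "\<bar>v\<bar> \<le> \<bar>z\<bar>" using \<delta> by (simp add: v_def abs_mult mult_left_le_one_le)
        have lv: "\<bar>l * v\<bar> \<le> \<bar>v\<bar>" using l by (simp add: abs_mult mult_left_le_one_le)
        define T where "T = C0 * ((1 + Y) * (1 + \<bar>v\<bar>)) ^ A * (\<bar>v\<bar> + exp (- Y))"
        have T0: "T \<ge> 0" using C0(1) Y by (auto simp: T_def)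
        \<comment> \<open>The exponents combine because \<open>l * Y = 1\<close>.\<close>
        have "exp 1 * g z = h (Y - v) * exp (of_real (l * v))"
        proof -
          have "1 + - (of_real l * of_real (Y - \<delta> * z)) = (of_real (l * v) :: complex)"
            using Y by (simp add: l_def v_def complex_eq_iff field_simps)
          thus ?thesis by (simp add: g_def v_def mult.left_commute flip: exp_add)
        qed
        hence "h Y - exp 1 * g z = (h Y - h (Y - v)) * exp (of_real (l * v)) + h Y * (1 - exp (of_real (l * v)))"
          by (simp add: algebra_simps)
        hence "norm (h Y - exp 1 * g z) \<le> norm (h Y - h (Y - v)) * norm (exp (of_real (l * v) :: complex)) + norm (h Y) * norm (1 - exp (of_real (l * v)) :: complex)"
          by (metis norm_mult norm_triangle_ineq)
        also have "\<dots> \<le> T * exp \<bar>v\<bar> + T * exp \<bar>v\<bar>"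
        proof (rule add_mono, rule mult_mono)
          have YY: "1 + Y + \<bar>v\<bar> \<le> (1 + Y) * (1 + \<bar>v\<bar>)" using Y by (simp add: algebra_simps)
          show "norm (h Y - h (Y - v)) \<le> T"
          proof (cases "v \<ge> 0")
            case True
            have "norm (h Y - h (Y - v)) \<le> C0 * (1 + Y) ^ A * ((Y - (Y - v)) + exp (- Y))" using Y True by (intro reg) auto
            also have "\<dots> \<le> T" unfolding T_def using True Y C0(1) YY
              by (intro mult_mono power_mono) auto
            finally show ?thesis .
          next
            case False
            \<comment> \<open>\<open>reg\<close> compares downwards, so for \<open>v < 0\<close> its
              base point is \<open>Y - v\<close>; the larger growth factor is absorbed by
              \<open>1 + \<bar>v\<bar>\<close>.\<close>
            have "norm (h (Y - v) - h Y) \<le> C0 * (1 + (Y - v)) ^ A * (((Y - v) - Y) + exp (- (Y - v)))" using Y False by (intro reg) auto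
            also have "\<dots> \<le> T" unfolding T_def
            proof (intro mult_mono power_mono)
              show "((Y - v) - Y) + exp (- (Y - v)) \<le> \<bar>v\<bar> + exp (- Y)" using False by simp
              show "1 + (Y - v) \<le> (1 + Y) * (1 + \<bar>v\<bar>)" using YY False by simp
              show "0 \<le> ((Y - v) - Y) + exp (- (Y - v))" using False by (intro add_nonneg_nonneg) auto
            qed (use False Y C0(1) in auto)
            finally show ?thesis by (simp add: norm_minus_commute)
          qed
          show "norm (exp (of_real (l * v)) :: complex) \<le> exp \<bar>v\<bar>" using lv by (simp add: norm_exp)
          have "norm (1 - exp (of_real (l * v)) :: complex) = \<bar>exp (l * v) - 1\<bar>"
            by (metis abs_minus_commute exp_of_real norm_of_real of_real_1 of_real_diff)
          also have "\<dots> \<le> \<bar>v\<bar> * exp \<bar>v\<bar>"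
          proof -
            have "\<bar>exp (l * v) - 1\<bar> \<le> \<bar>l * v\<bar> * exp \<bar>l * v\<bar>"
            proof (cases "l * v \<ge> 0")
              case True
              have "1 - l * v \<le> exp (- (l * v))" using exp_ge_add_one_self[of "- (l * v)"] by simp
              hence "(1 - l * v) * exp (l * v) \<le> exp (- (l * v)) * exp (l * v)" by (intro mult_right_mono) auto
              also have "exp (- (l * v)) * exp (l * v) = 1" by (simp flip: exp_add)
              finally show ?thesis using True by (simp add: algebra_simps)
            next
              case False
              have "1 + l * v \<le> exp (l * v)" by (rule exp_ge_add_one_self)
              moreover have "exp (l * v) \<le> 1" using False by simp
              ultimately have "\<bar>exp (l * v) - 1\<bar> \<le> \<bar>l * v\<bar> * 1" using False by linarith
              also have "\<dots> \<le> \<bar>l * v\<bar> * exp \<bar>l * v\<bar>" by (intro mult_left_mono) auto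
              finally show ?thesis .
            qed
            also have "\<dots> \<le> \<bar>v\<bar> * exp \<bar>v\<bar>" using lv by (intro mult_mono) auto
            finally show ?thesis .
          qed
          finally have e1: "norm (1 - exp (of_real (l * v)) :: complex) \<le> \<bar>v\<bar> * exp \<bar>v\<bar>" .
          have hY: "norm (h Y) \<le> C0 * ((1 + Y) * (1 + \<bar>v\<bar>)) ^ A"
            using Y C0 by (intro order.trans[OF C0(2)] mult_left_mono power_mono) auto
          have "norm (h Y) * norm (1 - exp (of_real (l * v)) :: complex) \<le> C0 * ((1 + Y) * (1 + \<bar>v\<bar>)) ^ A * (\<bar>v\<bar> * exp \<bar>v\<bar>)"
            using hY e1 C0(1) Y by (intro mult_mono) auto
          also have "\<dots> \<le> C0 * ((1 + Y) * (1 + \<bar>v\<bar>)) ^ A * ((\<bar>v\<bar> + exp (- Y)) * exp \<bar>v\<bar>)"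
            using C0(1) Y by (intro mult_left_mono mult_right_mono) auto
          finally show "norm (h Y) * norm (1 - exp (of_real (l * v)) :: complex) \<le> T * exp \<bar>v\<bar>" by (simp add: T_def mult_ac)
        qed (use T0 in auto)
        also have "\<dots> = 2 * C0 * (1 + Y) ^ A * ((1 + \<bar>v\<bar>) ^ A * (\<bar>v\<bar> + exp (- Y)) * exp \<bar>v\<bar>)"
          by (simp add: T_def power_mult_distrib)
        also have "\<dots> \<le> 2 * C0 * (2 * Y) ^ A * ((fact A * exp (1 + \<bar>z\<bar>)) * (\<delta> * fact B * exp \<bar>z\<bar>) * exp \<bar>z\<bar>)"
        proof (intro mult_mono)
          have "(1 + \<bar>v\<bar>) ^ A \<le> (1 + \<bar>z\<bar>) ^ A" using v by (intro power_mono) auto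
          also have "\<dots> \<le> fact A * exp (1 + \<bar>z\<bar>)" by (rule power_le_fact_exp) auto
          finally show "(1 + \<bar>v\<bar>) ^ A \<le> fact A * exp (1 + \<bar>z\<bar>)" .
          have "\<bar>v\<bar> + exp (- Y) \<le> \<delta> * \<bar>z\<bar> + fact B * \<delta>" using eY \<delta> by (simp add: v_def abs_mult)
          also have "\<dots> \<le> \<delta> * (fact B * \<bar>z\<bar>) + fact B * \<delta>"
            using \<delta> mult_right_mono[OF fact_ge_1[of B, where ?'a = real], of "\<bar>z\<bar>"] by (intro add_mono mult_left_mono) auto
          also have "\<dots> = \<delta> * fact B * (1 + \<bar>z\<bar>)" by (simp add: algebra_simps)
          also have "\<dots> \<le> \<delta> * fact B * exp \<bar>z\<bar>" using \<delta> by (intro mult_left_mono) auto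
          finally show "\<bar>v\<bar> + exp (- Y) \<le> \<delta> * fact B * exp \<bar>z\<bar>" .
          show "(1 + Y) ^ A \<le> (2 * Y) ^ A" using Y by (intro power_mono) auto
        qed (use Y v \<delta> C0(1) in auto)
        also have "\<dots> = K * Y ^ A * \<delta> * (exp \<bar>z\<bar> * exp \<bar>z\<bar> * exp \<bar>z\<bar>)"
          by (simp add: K_def power_mult_distrib exp_add)
        also have "exp \<bar>z\<bar> * exp \<bar>z\<bar> * exp \<bar>z\<bar> = exp (3 * \<bar>z\<bar>)" by (simp flip: exp_add)
        finally show "norm (h Y - exp 1 * g z) \<le> K * Y ^ A * \<delta> * exp (3 * \<bar>z\<bar>)" .
      qed
      finally show ?thesis .
    qed
    hence 1: "norm (h Y - exp 1 * J) \<le> K * G 3 * (Y ^ A / Y ^ B)" by (simp add: \<delta>_def mult_ac)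
    have "norm (exp 1 * J) = exp 1 * norm J" by (simp add: norm_mult norm_exp)
    also have "\<dots> \<le> exp 1 * (C1 * G 1 * Y ^ (M + 2 * B))" by (intro mult_left_mono J) auto
    finally have 2: "norm (exp 1 * J) \<le> exp 1 * C1 * G 1 * Y ^ (M + 2 * B)" by (simp add: mult.assoc)
    have "norm (h Y) \<le> norm (exp 1 * J) + norm (h Y - exp 1 * J)" by (metis add.commute diff_add_cancel norm_triangle_ineq)
    also have "\<dots> \<le> exp 1 * C1 * G 1 * Y ^ (M + 2 * B) + K * G 3 * (Y ^ A / Y ^ B)" by (rule add_mono[OF 2 1])
    also have "\<dots> \<le> C * Y ^ (M + 2 * B) + C * (Y ^ A / Y ^ B)"
      unfolding C_def using K0 G0 C1(1) Y by (intro add_mono mult_right_mono) auto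
    finally show "norm (h Y) \<le> C * (Y ^ (M + 2 * B) + Y ^ A / Y ^ B)" by (simp add: distrib_left)
  qed
  ultimately show ?thesis by blast
qed


section \<open>The rescaled summatory function\<close>

definition rescaled_M :: "nat \<Rightarrow> real \<Rightarrow> complex" where
  "rescaled_M k y = of_real (M_omega_pow k (exp y) * exp (- y))"

definition mu_omega_coeff :: "nat \<Rightarrow> nat \<Rightarrow> complex" where "mu_omega_coeff k n = mu n * of_nat (big_omega n) ^ k"

lemma moebius_omega_eq: "of_int (moebius_mu n) * of_nat (omega n) ^ k = mu_omega_coeff k n"
proof (cases "squarefree n")
  case True
  thus ?thesis by (simp add: mu_omega_coeff_def mu_def omega_eq_big_omega)
qed (simp add: mu_omega_coeff_def mu_def moebius_mu_def)

lemma mu_omega_coeff_0 [simp]: "mu_omega_coeff k 0 = 0"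
  by (simp add: mu_omega_coeff_def mu_def moebius_mu_def)

lemma norm_mu_omega_coeff_le: "n \<ge> 1 \<Longrightarrow> norm (mu_omega_coeff k n) \<le> (2 * ln (real n)) ^ k"
proof -
  assume n: "n \<ge> 1"
  have "norm (mu_omega_coeff k n) \<le> 1 * real (big_omega n) ^ k"
    unfolding mu_omega_coeff_def norm_mult norm_power norm_of_nat by (intro mult_right_mono norm_mu_le) auto
  also have "\<dots> \<le> 1 * (2 * ln (real n)) ^ k" using n by (intro mult_left_mono power_mono big_omega_le_ln) auto
  finally show ?thesis by simp
qed

definition nats_le_exp :: "real \<Rightarrow> nat set" where "nats_le_exp y = {n. 1 \<le> n \<and> real n \<le> exp y}"

lemma finite_nats_le_exp: "finite (nats_le_exp y)"
  by (rule finite_subset[of _ "{..nat \<lfloor>exp y\<rfloor>}"]) (auto simp: nats_le_exp_def le_nat_floor)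

lemma nats_le_exp_iff_ln: "n \<in> nats_le_exp y \<longleftrightarrow> n \<ge> 1 \<and> ln (real n) \<le> y"
proof (cases "n \<ge> 1")
  case True
  hence "real n \<le> exp y \<longleftrightarrow> ln (real n) \<le> y" using ln_le_cancel_iff[of "real n" "exp y"] by simp
  thus ?thesis using True by (simp add: nats_le_exp_def)
qed (simp add: nats_le_exp_def)

lemma rescaled_M_eq_sum: "rescaled_M k y = (\<Sum>n\<in>nats_le_exp y. mu_omega_coeff k n) * of_real (exp (- y))"
proof -
  have "complex_of_real (M_omega_pow k (exp y)) = (\<Sum>n\<in>nats_le_exp y. of_int (moebius_mu n) * of_nat (omega n) ^ k)"
    by (simp add: M_omega_pow_def nats_le_exp_def)
  thus ?thesis by (simp add: rescaled_M_def moebius_omega_eq)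
qed

lemma nats_le_exp_neg: "y < 0 \<Longrightarrow> nats_le_exp y = {}"
proof (rule ccontr)
  assume y: "y < 0" and "nats_le_exp y \<noteq> {}"
  then obtain n where "n \<ge> 1" "ln (real n) \<le> y" by (auto simp: nats_le_exp_iff_ln)
  moreover from this have "ln (real n) \<ge> 0" by simp
  ultimately show False using y by linarith
qed

lemma card_nats_le_exp_diff:
  assumes "y' \<le> y"
  shows "real (card (nats_le_exp y - nats_le_exp y')) \<le> exp y - exp y' + 1"
proof -
  have "nats_le_exp y - nats_le_exp y' \<subseteq> {nat \<lfloor>exp y'\<rfloor> <.. nat \<lfloor>exp y\<rfloor>}"
  proof
    fix n assume n: "n \<in> nats_le_exp y - nats_le_exp y'"
    hence "real n \<le> exp y" "real n > exp y'" by (auto simp: nats_le_exp_def)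
    thus "n \<in> {nat \<lfloor>exp y'\<rfloor> <.. nat \<lfloor>exp y\<rfloor>}"
      by (auto simp: le_nat_floor nat_less_iff floor_less_iff)
  qed
  hence "card (nats_le_exp y - nats_le_exp y') \<le> card {nat \<lfloor>exp y'\<rfloor> <.. nat \<lfloor>exp y\<rfloor>}" by (rule card_mono[rotated]) auto
  also have "\<dots> = nat \<lfloor>exp y\<rfloor> - nat \<lfloor>exp y'\<rfloor>" by simp
  finally have "real (card (nats_le_exp y - nats_le_exp y')) \<le> real (nat \<lfloor>exp y\<rfloor> - nat \<lfloor>exp y'\<rfloor>)" by simp
  also have "\<dots> = of_int \<lfloor>exp y\<rfloor> - of_int \<lfloor>exp y'\<rfloor>"
  proof -
    have "\<lfloor>exp y'\<rfloor> \<le> \<lfloor>exp y\<rfloor>" using assms by (intro floor_mono) auto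
    moreover have "\<lfloor>exp y'\<rfloor> \<ge> 0" by simp
    ultimately show ?thesis by (simp add: of_nat_diff nat_mono)
  qed
  also have "\<dots> \<le> exp y - exp y' + 1" by linarith
  finally show ?thesis .
qed

lemma card_nats_le_exp: "real (card (nats_le_exp y)) \<le> exp y"
proof -
  have "nats_le_exp y \<subseteq> {1..nat \<lfloor>exp y\<rfloor>}" by (auto simp: nats_le_exp_def le_nat_floor)
  hence "card (nats_le_exp y) \<le> card {1..nat \<lfloor>exp y\<rfloor>}" by (rule card_mono[rotated]) auto
  hence "real (card (nats_le_exp y)) \<le> real (card {1..nat \<lfloor>exp y\<rfloor>})" by (rule of_nat_mono)
  also have "\<dots> = of_int \<lfloor>exp y\<rfloor>" by simp
  also have "\<dots> \<le> exp y" by simp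
  finally show ?thesis .
qed

lemma norm_sum_mu_omega_coeff_le:
  assumes "S \<subseteq> nats_le_exp y"
  shows "norm (\<Sum>n\<in>S. mu_omega_coeff k n) \<le> real (card S) * (2 * y) ^ k"
proof -
  have "norm (\<Sum>n\<in>S. mu_omega_coeff k n) \<le> (\<Sum>n\<in>S. (2 * y) ^ k)"
  proof (rule sum_norm_le)
    fix n assume "n \<in> S"
    hence n: "n \<ge> 1" "ln (real n) \<le> y" using assms by (auto simp: nats_le_exp_iff_ln)
    have "norm (mu_omega_coeff k n) \<le> (2 * ln (real n)) ^ k" by (rule norm_mu_omega_coeff_le[OF n(1)])
    also have "\<dots> \<le> (2 * y) ^ k" using n by (intro power_mono) auto
    finally show "norm (mu_omega_coeff k n) \<le> (2 * y) ^ k" .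
  qed
  thus ?thesis by simp
qed

lemma norm_rescaled_M_le:
  assumes "y \<ge> 0" shows "norm (rescaled_M k y) \<le> 2 ^ k * (1 + y) ^ k"
proof -
  have "norm (rescaled_M k y) = norm (\<Sum>n\<in>nats_le_exp y. mu_omega_coeff k n) * exp (- y)" by (simp add: rescaled_M_eq_sum norm_mult)
  also have "\<dots> \<le> (exp y * (2 * y) ^ k) * exp (- y)"
    using assms card_nats_le_exp by (intro mult_right_mono order.trans[OF norm_sum_mu_omega_coeff_le[OF order.refl]]) auto
  also have "\<dots> = (2 * y) ^ k" by (simp add: exp_minus)
  also have "\<dots> \<le> (2 * (1 + y)) ^ k" using assms by (intro power_mono) auto
  finally show ?thesis unfolding power_mult_distrib .
qed

lemma rescaled_M_neg: "y < 0 \<Longrightarrow> rescaled_M k y = 0"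
  by (simp add: rescaled_M_eq_sum nats_le_exp_neg)

text \<open>Passing from \<open>y'\<close> to \<open>y\<close> adds at most
  \<open>exp y - exp y' + 1\<close> new terms and changes the normalising factor. After division by
  \<open>exp y\<close> both effects are controlled by
  \<open>1 - exp (- (y - y')) \<le> y - y'\<close>, and the 1 in the count becomes the summand
  \<open>exp (- y)\<close>.\<close>

lemma rescaled_M_regular:
  assumes "y \<ge> 0" "y' \<le> y"
  shows "norm (rescaled_M k y - rescaled_M k y') \<le> 2 * 2 ^ k * (1 + y) ^ k * ((y - y') + exp (- y))"
proof -
  have sub: "nats_le_exp y' \<subseteq> nats_le_exp y" using assms by (auto simp: nats_le_exp_iff_ln)
  have e1: "1 - exp (- (y - y')) \<le> y - y'" using exp_ge_add_one_self[of "- (y - y')"] by linarith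
  have P: "(2 * y) ^ k \<le> 2 ^ k * (1 + y) ^ k"
    unfolding power_mult_distrib[symmetric] using assms by (intro power_mono) auto
  have "(\<Sum>n\<in>nats_le_exp y. mu_omega_coeff k n) = (\<Sum>n\<in>nats_le_exp y'. mu_omega_coeff k n) + (\<Sum>n\<in>nats_le_exp y - nats_le_exp y'. mu_omega_coeff k n)"
    using sub finite_nats_le_exp by (metis add.commute sum.subset_diff)
  hence "rescaled_M k y - rescaled_M k y' = (\<Sum>n\<in>nats_le_exp y - nats_le_exp y'. mu_omega_coeff k n) * of_real (exp (- y)) + 
      (\<Sum>n\<in>nats_le_exp y'. mu_omega_coeff k n) * of_real (exp (- y) - exp (- y'))"
    by (simp add: rescaled_M_eq_sum algebra_simps)
  also have "norm \<dots> \<le> norm (\<Sum>n\<in>nats_le_exp y - nats_le_exp y'. mu_omega_coeff k n) * exp (- y) + norm (\<Sum>n\<in>nats_le_exp y'. mu_omega_coeff k n) * \<bar>exp (- y) - exp (- y')\<bar>"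
    by (rule order.trans[OF norm_triangle_ineq]) (simp add: norm_mult del: of_real_diff)
  also have "norm (\<Sum>n\<in>nats_le_exp y - nats_le_exp y'. mu_omega_coeff k n) * exp (- y) \<le> 2 ^ k * (1 + y) ^ k * ((y - y') + exp (- y))"
  proof -
    have "norm (\<Sum>n\<in>nats_le_exp y - nats_le_exp y'. mu_omega_coeff k n) \<le> real (card (nats_le_exp y - nats_le_exp y')) * (2 * y) ^ k"
      by (rule norm_sum_mu_omega_coeff_le) auto
    also have "\<dots> \<le> (exp y - exp y' + 1) * (2 ^ k * (1 + y) ^ k)"
      using card_nats_le_exp_diff[OF assms(2)] assms P by (intro mult_mono) auto
    finally have "norm (\<Sum>n\<in>nats_le_exp y - nats_le_exp y'. mu_omega_coeff k n) * exp (- y) \<le> (exp y - exp y' + 1) * (2 ^ k * (1 + y) ^ k) * exp (- y)"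
      by (intro mult_right_mono) auto
    also have "\<dots> = 2 ^ k * (1 + y) ^ k * ((1 - exp (- (y - y'))) + exp (- y))"
    proof -
      have "(exp y - exp y' + 1) * exp (- y) = (1 - exp (- (y - y'))) + exp (- y)"
        by (simp add: algebra_simps flip: exp_add)
      thus ?thesis by (metis mult.assoc mult.commute)
    qed
    also have "\<dots> \<le> 2 ^ k * (1 + y) ^ k * ((y - y') + exp (- y))"
      using e1 assms by (intro mult_left_mono add_mono) auto
    finally show ?thesis .
  qed
  also have "norm (\<Sum>n\<in>nats_le_exp y'. mu_omega_coeff k n) * \<bar>exp (- y) - exp (- y')\<bar> \<le> 2 ^ k * (1 + y) ^ k * ((y - y') + exp (- y))"
  proof (cases "y' \<ge> 0")
    case True
    have "\<bar>exp (- y) - exp (- y')\<bar> = exp (- y') * (1 - exp (- (y - y')))"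
      using assms by (simp add: abs_if algebra_simps flip: exp_add)
    hence "norm (\<Sum>n\<in>nats_le_exp y'. mu_omega_coeff k n) * \<bar>exp (- y) - exp (- y')\<bar> = norm (rescaled_M k y') * (1 - exp (- (y - y')))"
      by (simp add: rescaled_M_eq_sum norm_mult)
    also have "\<dots> \<le> (2 ^ k * (1 + y') ^ k) * ((y - y') + exp (- y))"
      using e1 assms True by (intro mult_mono norm_rescaled_M_le add_increasing2) auto
    also have "\<dots> \<le> (2 ^ k * (1 + y) ^ k) * ((y - y') + exp (- y))"
      using assms True by (intro mult_right_mono mult_left_mono power_mono) auto
    finally show ?thesis .
  next
    case False
    thus ?thesis using assms by (auto simp: nats_le_exp_neg)
  qed
  finally show ?thesis by (simp add: mult_ac)
qed

text \<open>Writing the finite sum as a series of step functions gives measurability and allows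
  integration term by term. The index 0 does no harm because its coefficient vanishes.\<close>

lemma rescaled_M_suminf: 
  "(\<lambda>n. mu_omega_coeff k n * indicator {ln (real n)..} y * exp (- y)) sums rescaled_M k y"
proof -
  have "(\<lambda>n. mu_omega_coeff k n * indicator {ln (real n)..} y * exp (- y)) sums (\<Sum>n\<in>nats_le_exp y. mu_omega_coeff k n * indicator {ln (real n)..} y * exp (- y))"
    by (rule sums_finite[OF finite_nats_le_exp]) (auto simp: nats_le_exp_iff_ln Suc_le_eq indicator_def intro: ccontr)
  also have "(\<Sum>n\<in>nats_le_exp y. mu_omega_coeff k n * indicator {ln (real n)..} y * exp (- y)) = rescaled_M k y"
    unfolding rescaled_M_eq_sum sum_distrib_right by (rule sum.cong) (auto simp: nats_le_exp_iff_ln)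
  finally show ?thesis .
qed

lemma poly_bdd_rescaled_M: "poly_bdd (rescaled_M k)"
proof -
  have "rescaled_M k = (\<lambda>y. \<Sum>n. mu_omega_coeff k n * indicator {ln (real n)..} y * exp (- y))"
    using rescaled_M_suminf[of k] by (auto simp: sums_iff)
  hence "rescaled_M k \<in> borel_measurable borel" by (simp only:) measurable
  moreover have "\<exists>C\<ge>0. \<exists>A::nat. \<forall>y\<ge>0. norm (rescaled_M k y) \<le> C * (1 + y) ^ A"
    using norm_rescaled_M_le[of _ k] by (intro exI[of _ "2 ^ k"] conjI exI[of _ k]) auto
  ultimately show ?thesis by (simp add: poly_bdd_def rescaled_M_neg)
qed

text \<open>The transform of the unit step has derivative \<open>- 1 / w ^ 2\<close> by
  \<open>laplace_pow_ln_0\<close>, so it is \<open>1 / w\<close> up to a constant, which evaluation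
  at \<open>w = 1\<close> shows to be 0. A translation by \<open>c\<close> gives the general
  case.\<close>

lemma has_bochner_integral_exp_atLeast:
  assumes s: "Re s > 0"
  shows "integrable lborel (\<lambda>y. indicator {c..} y * exp (- (s * of_real y)) :: complex)"
    and "(\<integral>y. indicator {c..} y * exp (- (s * of_real y)) \<partial>lborel) = exp (- (s * of_real c)) / s"
proof -
  define u where "u = (indicator {0..} :: real \<Rightarrow> complex)"
  have u: "poly_bdd u" by (auto simp: poly_bdd_def u_def indicator_def intro!: exI[of _ 1])
  have yu: "(\<lambda>y. of_real y * u y) = pow_ln 1 0" by (auto simp: u_def pow_ln_def fun_eq_iff indicator_def)
  have "\<exists>d. \<forall>w. Re w > 0 \<longrightarrow> laplace u w - 1 / w = d"
  proof (rule constant_on_Re_pos)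
    fix w :: complex assume w: "Re w > 0"
    have "((\<lambda>w. laplace u w - 1 / w) has_field_derivative - laplace (pow_ln 1 0) w - (- 1 / w ^ 2)) (at w)"
      using has_field_derivative_laplace[OF u w] Re_pos_not_nonpos(2)[OF w] unfolding yu
      by (auto intro!: derivative_eq_intros simp: power2_eq_square)
    also have "- laplace (pow_ln 1 0) w - (- 1 / w ^ 2) = 0" using laplace_pow_ln_0[OF w] Re_pos_not_nonpos(2)[OF w] by (simp add: field_simps)
    finally show "((\<lambda>w. laplace u w - 1 / w) has_field_derivative 0) (at w)" .
  qed
  then obtain d where d: "\<And>w. Re w > 0 \<Longrightarrow> laplace u w - 1 / w = d" by blast
  have "laplace u 1 = (\<integral>y. complex_of_real (y ^ 0 * exp (-y) * indicator {0..} y) \<partial>lborel)"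
    unfolding laplace_def by (intro Bochner_Integration.integral_cong) (auto simp: u_def exp_of_real[symmetric] indicator_def)
  also have "\<dots> = of_real (\<integral>y. y ^ 0 * exp (-y) * indicator {0..} y \<partial>lborel)" by (rule integral_complex_of_real)
  also have "(\<integral>y. y ^ 0 * exp (-y) * indicator {0..} y \<partial>lborel) = (\<integral>y. y ^ 0 * exp (-y) * indicator {0<..} y \<partial>lborel :: real)"
    by (intro integral_cong_AE) (use AE_lborel_singleton[of 0] in \<open>auto elim!: eventually_mono simp: indicator_def\<close>)
  also have "\<dots> = 1"
    using has_bochner_integral_integral_eq[OF has_bochner_integral_I0i_power_exp_m[of 0]] by simp
  finally have "d = 0" using d[of 1] by simp
  hence Lu: "laplace u s = 1 / s" using d[OF s] by simp
  have shift: "indicator {c..} (c + 1 * y) * exp (- (s * of_real (c + 1 * y))) = exp (- (s * of_real c)) * (u y * exp (- (s * of_real y)))" for y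
    by (auto simp: u_def indicator_def algebra_simps exp_add exp_diff exp_minus divide_inverse)
  have "integrable lborel (\<lambda>y. exp (- (s * of_real c)) * (u y * exp (- (s * of_real y))))"
    by (intro integrable_mult_right poly_bdd_laplace_integrable u s)
  hence "integrable lborel (\<lambda>y. indicator {c..} (c + 1 * y) * exp (- (s * of_real (c + 1 * y))) :: complex)"
    unfolding shift .
  thus "integrable lborel (\<lambda>y. indicator {c..} y * exp (- (s * of_real y)) :: complex)"
    using lborel_integrable_real_affine_iff[of 1 "\<lambda>y. indicator {c..} y * exp (- (s * of_real y)) :: complex" c] by simp
  have "(\<integral>y. indicator {c..} y * exp (- (s * of_real y)) \<partial>lborel) = 
      \<bar>1\<bar> *\<^sub>R (\<integral>y. indicator {c..} (c + 1 * y) * exp (- (s * of_real (c + 1 * y))) \<partial>lborel :: complex)"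
    by (rule lborel_integral_real_affine) auto
  also have "\<dots> = exp (- (s * of_real c)) * laplace u s" unfolding shift by (simp add: laplace_def)
  finally show "(\<integral>y. indicator {c..} y * exp (- (s * of_real y)) \<partial>lborel) = exp (- (s * of_real c)) / s"
    by (simp add: Lu)
qed

text \<open>The factor \<open>exp (- y)\<close> shifts the argument to \<open>s = 1 + w\<close>, and
  the step beginning at \<open>ln n\<close> contributes \<open>n powr (- s) / s\<close>. Absolute
  convergence of the Dirichlet series for \<open>Re s > 1\<close> justifies exchanging sum and
  integral.\<close>

lemma laplace_rescaled_M:
  assumes w: "Re w > 0"
  shows "laplace (rescaled_M k) w = D_mu k (1 + w) / (1 + w)"
proof -
  define s where "s = 1 + w"
  have s: "Re s > 1" using w by (simp add: s_def)
  have s0: "Re s > 0" using s by simp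
  have ac: "abs_conv (mu_omega_coeff k) 1"
    unfolding mu_omega_coeff_def by (rule abs_conv_big_omega_power[OF abs_conv_mu])
  have powr: "exp (- (s * of_real (ln (real n)))) = of_nat n powr (- s)" if "n \<noteq> 0" for n and s :: complex
    using that by (simp add: powr_def Ln_of_nat)
  define g where "g n y = mu_omega_coeff k n * (indicator {ln (real n)..} y * exp (- (s * of_real y)))" for n and y :: real
  have gi: "integrable lborel (g n)" for n
    unfolding g_def by (intro integrable_mult_right has_bochner_integral_exp_atLeast s0)
  have gI: "(\<integral>y. g n y \<partial>lborel) = mu_omega_coeff k n * of_nat n powr (- s) / s" for n
    by (cases "n = 0") (simp_all add: g_def has_bochner_integral_exp_atLeast[OF s0] powr)
  have gn: "(\<integral>y. norm (g n y) \<partial>lborel) = norm (mu_omega_coeff k n) * real n powr (- Re s) / Re s" for n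
  proof -
    have "(\<integral>y. norm (g n y) \<partial>lborel) = (\<integral>y. norm (mu_omega_coeff k n) * (indicator {ln (real n)..} y * exp (- (Re s * y))) \<partial>lborel)"
      by (intro Bochner_Integration.integral_cong) (auto simp: g_def norm_mult indicator_def)
    hence "complex_of_real (\<integral>y. norm (g n y) \<partial>lborel) = 
       (\<integral>y. complex_of_real (norm (mu_omega_coeff k n) * (indicator {ln (real n)..} y * exp (- (Re s * y)))) \<partial>lborel)"
      by (simp only: integral_complex_of_real)
    also have "\<dots> = (\<integral>y. of_real (norm (mu_omega_coeff k n)) * (indicator {ln (real n)..} y * exp (- (of_real (Re s) * of_real y))) \<partial>lborel)"
      by (intro Bochner_Integration.integral_cong) (auto simp: indicator_def exp_of_real[symmetric])
    also have "\<dots> = of_real (norm (mu_omega_coeff k n)) * (exp (- (of_real (Re s) * of_real (ln (real n)))) / of_real (Re s))"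
      using has_bochner_integral_exp_atLeast(2)[of "of_real (Re s)" "ln (real n)"] s0 by simp
    also have "\<dots> = of_real (norm (mu_omega_coeff k n) * real n powr (- Re s) / Re s)"
      by (cases "n = 0") (auto simp: powr_def exp_of_real[symmetric])
    finally show ?thesis by (simp only: of_real_eq_iff)
  qed
  have sm: "summable (\<lambda>n. norm (mu_omega_coeff k n) * real n powr (- Re s) / Re s)"
    using ac s by (intro summable_divide) (auto simp: abs_conv_def)
  have sums: "(\<lambda>n. g n y) sums (rescaled_M k y * exp (- (w * of_real y)))" for y
  proof -
    have "(\<lambda>n. mu_omega_coeff k n * indicator {ln (real n)..} y * exp (- y) * exp (- (w * of_real y))) sums (rescaled_M k y * exp (- (w * of_real y)))"
      by (rule sums_mult2[OF rescaled_M_suminf])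
    also have "(\<lambda>n. mu_omega_coeff k n * indicator {ln (real n)..} y * exp (- y) * exp (- (w * of_real y))) = (\<lambda>n. g n y)"
      by (auto simp: g_def s_def fun_eq_iff algebra_simps exp_add exp_diff exp_minus divide_inverse exp_of_real[symmetric])
    finally show ?thesis .
  qed
  have "laplace (rescaled_M k) w = (\<integral>y. (\<Sum>n. g n y) \<partial>lborel)"
    unfolding laplace_def using sums by (simp add: sums_iff)
  also have "\<dots> = (\<Sum>n. \<integral>y. g n y \<partial>lborel)"
  proof (rule integral_suminf[OF gi])
    show "summable (\<lambda>n. \<integral>y. norm (g n y) \<partial>lborel)" unfolding gn by (rule sm)
    show "AE y in lborel. summable (\<lambda>n. norm (g n y))"
    proof (intro always_eventually allI)
      fix y
      show "summable (\<lambda>n. norm (g n y))"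
        by (rule summable_finite[OF finite_nats_le_exp[of y]]) 
           (auto simp: g_def nats_le_exp_iff_ln Suc_le_eq indicator_def intro: ccontr)
    qed
  qed
  also have "\<dots> = (\<Sum>n. mu_omega_coeff k n * of_nat n powr (- s) / s)" unfolding gI ..
  also have "\<dots> = D_mu k s / s"
    using sums_divide[OF dser_sums[OF ac s], of s] by (simp add: sums_iff D_mu_def mu_omega_coeff_def[abs_def])
  finally show ?thesis by (simp add: s_def)
qed

text \<open>The mean value inequality; \<open>n \<ge> 2\<close> leaves a factor \<open>y\<close> in
  the derivative, which keeps the logarithms bounded at 0. For \<open>y' \<le> 0\<close> the second
  value is 0 and one factor \<open>y \<le> y - y'\<close> is split off.\<close>

lemma pow_ln_regular:
  assumes n: "n \<ge> 2" and y: "0 \<le> y" "y' \<le> y"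
  shows "norm (pow_ln n i y - pow_ln n i y') \<le> (real n + real i) * fact i * (1 + y) ^ (n - 1 + i) * (y - y')"
proof (cases "y = 0")
  case False
  with y have y0: "y > 0" by simp
  define D where "D = (real n + real i) * fact i * (1 + y) ^ (n - 1 + i)"
  show ?thesis
  proof (cases "y' > 0")
    case False
    have "norm (pow_ln n i y) = y * norm (pow_ln (n - 1) i y)"
      using n y0 mult_pow_ln[of y "n - 1" i] by (metis One_nat_def Suc_diff_le Suc_leD abs_of_pos diff_Suc_Suc diff_zero norm_mult norm_of_real numeral_2_eq_2)
    also have "\<dots> \<le> (y - y') * (fact i * (1 + y) ^ (n - 1 + i))"
      using False n y by (intro mult_mono pow_ln_bound) auto
    also have "\<dots> \<le> (y - y') * ((real n + real i) * (fact i * (1 + y) ^ (n - 1 + i)))"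
    proof (rule mult_left_mono)
      have "1 * (fact i * (1 + y) ^ (n - 1 + i)) \<le> (real n + real i) * (fact i * (1 + y) ^ (n - 1 + i))"
        using n y by (intro mult_right_mono) auto
      thus "fact i * (1 + y) ^ (n - 1 + i) \<le> (real n + real i) * (fact i * (1 + y) ^ (n - 1 + i))" by simp
    qed (use y in auto)
    finally show ?thesis using False by (simp add: pow_ln_def mult_ac)
  next
    case True
    define F where "F x = x ^ n * ln x ^ i" for x :: real
    have "norm (F y - F y') \<le> D * norm (y - y')"
    proof (rule field_differentiable_bound[of "{y'..y}" _ "\<lambda>x. real n * x ^ (n - 1) * ln x ^ i + real i * ln x ^ (i - 1) * (1 / x) * x ^ n"])
      fix x assume x: "x \<in> {y'..y}"
      hence x0: "x > 0" using True by auto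
      show "(F has_field_derivative real n * x ^ (n - 1) * ln x ^ i + real i * ln x ^ (i - 1) * (1 / x) * x ^ n) (at x within {y'..y})"
        unfolding F_def using x0 by (auto intro!: derivative_eq_intros simp: algebra_simps)
      have b: "x ^ (n - 1) * \<bar>ln x\<bar> ^ j \<le> fact i * (1 + y) ^ (n - 1 + i)" if "j \<le> i" for j
      proof -
        have "x ^ (n - 1) * \<bar>ln x\<bar> ^ j = norm (pow_ln (n - 1) j x)"
          using x0 by (simp add: pow_ln_def norm_mult norm_power)
        also have "\<dots> \<le> fact j * (1 + x) ^ (n - 1 + j)" using n x0 by (intro pow_ln_bound) auto
        also have "\<dots> \<le> fact i * (1 + y) ^ (n - 1 + j)" using x x0 that by (intro mult_mono power_mono fact_mono) auto
        also have "\<dots> \<le> fact i * (1 + y) ^ (n - 1 + i)" using y that by (intro mult_left_mono power_increasing) auto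
        finally show ?thesis .
      qed
      have "x ^ n = x * x ^ (n - 1)" using n by (cases n) auto
      hence eq: "real n * x ^ (n - 1) * ln x ^ i + real i * ln x ^ (i - 1) * (1 / x) * x ^ n = 
         real n * (x ^ (n - 1) * ln x ^ i) + real i * (x ^ (n - 1) * ln x ^ (i - 1))" using x0 by simp
      have "norm (real n * (x ^ (n - 1) * ln x ^ i) + real i * (x ^ (n - 1) * ln x ^ (i - 1))) \<le> 
         real n * (x ^ (n - 1) * \<bar>ln x\<bar> ^ i) + real i * (x ^ (n - 1) * \<bar>ln x\<bar> ^ (i - 1))"
        by (rule order.trans[OF norm_triangle_ineq]) (use x0 in \<open>simp add: abs_mult power_abs\<close>)
      also have "\<dots> \<le> real n * (fact i * (1 + y) ^ (n - 1 + i)) + real i * (fact i * (1 + y) ^ (n - 1 + i))"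
        by (intro add_mono mult_left_mono b) auto
      finally show "norm (real n * x ^ (n - 1) * ln x ^ i + real i * ln x ^ (i - 1) * (1 / x) * x ^ n) \<le> D"
        unfolding eq by (simp add: D_def algebra_simps)
    qed (use y in auto)
    moreover have "pow_ln n i y - pow_ln n i y' = of_real (F y - F y')" using True y0 by (simp add: pow_ln_def F_def)
    ultimately show ?thesis using y by (simp only: norm_of_real) (simp add: D_def)
  qed
next
  case True
  thus ?thesis using y by (auto simp: pow_ln_def intro!: mult_nonneg_nonpos)
qed


section \<open>Estimates for the Tauberian theorem\<close>

text \<open>Obtained from \<open>x ^ i \<le> fact i * exp x\<close>. The bound is crude, a whole
  power of \<open>norm w\<close> at 0 and at infinity, but independent of \<open>i\<close> up to a
  constant; the factor \<open>w\<close> in front of each \<open>H i w\<close> makes up for it at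
  0.\<close>

lemma norm_Ln_power_le:
  assumes w: "w \<noteq> 0"
  shows "norm (Ln w) ^ i \<le> fact i * exp pi * (norm w + 1 / norm w)"
proof -
  have n: "norm w > 0" using w by simp
  have "norm (Ln w) \<le> \<bar>Re (Ln w)\<bar> + \<bar>Im (Ln w)\<bar>" by (rule cmod_le)
  also have "\<dots> \<le> \<bar>ln (norm w)\<bar> + pi"
    using Im_Ln_le_pi[OF w] mpi_less_Im_Ln[OF w] w by (simp add: Re_Ln)
  finally have "norm (Ln w) ^ i \<le> (\<bar>ln (norm w)\<bar> + pi) ^ i" by (intro power_mono) auto
  also have "\<dots> \<le> fact i * exp (\<bar>ln (norm w)\<bar> + pi)" by (intro power_le_fact_exp) (auto intro!: add_nonneg_nonneg)
  also have "exp \<bar>ln (norm w)\<bar> \<le> norm w + 1 / norm w"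
  proof (cases "ln (norm w) \<ge> 0")
    case True
    thus ?thesis using n by simp
  next
    case False
    hence "exp \<bar>ln (norm w)\<bar> = 1 / norm w" using n by (simp add: abs_if exp_minus inverse_eq_divide)
    thus ?thesis by simp
  qed
  hence "fact i * exp (\<bar>ln (norm w)\<bar> + pi) \<le> fact i * exp pi * (norm w + 1 / norm w)"
    by (simp add: exp_add mult_ac)
  finally show ?thesis .
qed

text \<open>Nonpositive reals lie at distance at least \<open>norm w\<close> from a point of the
  right half-plane, so half that radius stays in the domain of \<open>Ln\<close>. A radius
  proportional to \<open>norm w\<close> is used so that Cauchy's estimates cost exactly one power of
  \<open>norm w\<close> per derivative.\<close>

lemma cball_half_norm:
  assumes w: "Re w > 0" and z: "z \<in> cball w (norm w / 2)"
  shows "z \<notin> \<real>\<^sub>\<le>\<^sub>0" "norm w / 2 \<le> norm z" "norm z \<le> 3 / 2 * norm w" "z \<noteq> 0"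
proof -
  have w0: "norm w > 0" using w by auto
  have d: "norm (w - z) \<le> norm w / 2" using z by (simp add: dist_norm)
  show 1: "norm w / 2 \<le> norm z" using norm_triangle_ineq2[of w z] d by linarith
  show "norm z \<le> 3 / 2 * norm w" using norm_triangle_ineq2[of z w] d by (simp add: norm_minus_commute)
  show "z \<noteq> 0" using 1 w0 by auto
  show "z \<notin> \<real>\<^sub>\<le>\<^sub>0"
  proof
    assume "z \<in> \<real>\<^sub>\<le>\<^sub>0"
    hence zz: "Re z \<le> 0" "Im z = 0" by (auto simp: complex_nonpos_Reals_iff)
    have "(Re w)\<^sup>2 \<le> (Re w - Re z)\<^sup>2" using zz w by (intro power_mono) auto
    hence "norm w ^ 2 \<le> norm (w - z) ^ 2" using zz by (simp add: cmod_power2)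
    also have "\<dots> \<le> (norm w / 2) ^ 2" using d by (intro power_mono) auto
    finally show False using mult_pos_pos[OF w0 w0] by (simp add: power2_eq_square)
  qed
qed

lemma Cauchy_half_norm:
  assumes w: "Re w > 0" and hol: "f holomorphic_on S" and S: "cball w (norm w / 2) \<subseteq> S"
    and bd: "\<And>z. z \<in> cball w (norm w / 2) \<Longrightarrow> norm (f z) \<le> K"
  shows "norm ((deriv ^^ N) f w) \<le> fact N * K * 2 ^ N / norm w ^ N"
proof -
  have "norm ((deriv ^^ N) f w) \<le> fact N * K / (norm w / 2) ^ N"
  proof (rule Cauchy_inequality)
    show "f holomorphic_on ball w (norm w / 2)" 
      by (rule holomorphic_on_subset[OF hol]) (use S ball_subset_cball in blast)
    show "continuous_on (cball w (norm w / 2)) f"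
      by (rule holomorphic_on_imp_continuous_on[OF holomorphic_on_subset[OF hol S]])
    show "0 < norm w / 2" using w by auto
    show "norm (f x) \<le> K" if "norm (w - x) = norm w / 2" for x using that by (intro bd) (simp add: dist_norm)
  qed
  thus ?thesis by (simp add: power_divide)
qed

text \<open>For \<open>r = norm w \<ge> t0\<close> the function is of size at most
  \<open>r ^ (m + 1)\<close>, the logarithm being charged with one power. Cauchy's estimate divides
  by \<open>r ^ N\<close>.\<close>

lemma higher_deriv_power_Ln_bound:
  assumes t0: "t0 > 0" and N: "N \<ge> m + 1"
  shows "\<exists>C\<ge>0. \<forall>w. Re w > 0 \<and> norm w \<ge> t0 \<longrightarrow> norm ((deriv ^^ N) (\<lambda>w. w ^ m * Ln w ^ i) w) \<le> C"
proof -
  define a where "a = N - (m + 1)"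
  have Na: "N = (m + 1) + a" using N by (simp add: a_def)
  define K where "K = fact N * ((3 / 2) ^ m * (fact i * exp pi)) * 2 ^ N"
  have K0: "K \<ge> 0" by (simp add: K_def)
  define C where "C = K * (3 / 2 + 2 / t0 ^ 2) / t0 ^ a"
  show ?thesis
  proof (intro exI[of _ C] conjI allI impI)
    show "C \<ge> 0" using K0 t0 by (simp add: C_def)
    fix w assume "Re w > 0 \<and> norm w \<ge> t0"
    hence w: "Re w > 0" and wt: "norm w \<ge> t0" by auto
    define r where "r = norm w"
    have r: "r > 0" "r \<ge> t0" using wt t0 by (auto simp: r_def)
    have "norm ((deriv ^^ N) (\<lambda>w. w ^ m * Ln w ^ i) w) \<le> fact N * ((3 / 2 * r) ^ m * (fact i * exp pi * (3 / 2 * r + 2 / r))) * 2 ^ N / norm w ^ N"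
    proof (rule Cauchy_half_norm[OF w])
      show "(\<lambda>w. w ^ m * Ln w ^ i) holomorphic_on - \<real>\<^sub>\<le>\<^sub>0" by (intro holomorphic_intros) auto
      show "cball w (norm w / 2) \<subseteq> - \<real>\<^sub>\<le>\<^sub>0" using cball_half_norm(1)[OF w] by blast
      fix z assume z: "z \<in> cball w (norm w / 2)"
      note zz = cball_half_norm[OF w z, folded r_def]
      have "1 / norm z \<le> 1 / (r / 2)" using zz r by (intro divide_left_mono) (auto intro!: mult_pos_pos)
      hence "norm z + 1 / norm z \<le> 3 / 2 * r + 2 / r" using zz(3) by simp
      hence "fact i * exp pi * (norm z + 1 / norm z) \<le> fact i * exp pi * (3 / 2 * r + 2 / r)" by (intro mult_left_mono) auto
      hence "norm (Ln z) ^ i \<le> fact i * exp pi * (3 / 2 * r + 2 / r)" using norm_Ln_power_le[OF zz(4), of i] by linarith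
      thus "norm (z ^ m * Ln z ^ i) \<le> (3 / 2 * r) ^ m * (fact i * exp pi * (3 / 2 * r + 2 / r))"
        unfolding norm_mult norm_power using zz(3) r by (intro mult_mono power_mono) auto
    qed
    also have "\<dots> = K * (r ^ m * (3 / 2 * r + 2 / r)) / r ^ N"
      unfolding power_mult_distrib K_def r_def by (simp add: mult_ac)
    also have "\<dots> \<le> K * (r ^ m * (r * (3 / 2 + 2 / t0 ^ 2))) / r ^ N"
    proof -
      have "2 / r = r * (2 / r ^ 2)" using r by (simp add: power2_eq_square)
      also have "\<dots> \<le> r * (2 / t0 ^ 2)" using r t0 by (intro mult_left_mono divide_left_mono power_mono mult_pos_pos) auto
      finally have "3 / 2 * r + 2 / r \<le> r * (3 / 2 + 2 / t0 ^ 2)" by (simp add: algebra_simps)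
      thus ?thesis using K0 r by (intro divide_right_mono mult_left_mono) auto
    qed
    also have "\<dots> = K * (3 / 2 + 2 / t0 ^ 2) / r ^ a"
      using r unfolding Na power_add by (simp add: field_simps)
    also have "\<dots> \<le> C" unfolding C_def using r t0 K0
      by (intro divide_left_mono power_mono mult_pos_pos mult_nonneg_nonneg) auto
    finally show "norm ((deriv ^^ N) (\<lambda>w. w ^ m * Ln w ^ i) w) \<le> C" .
  qed
qed

text \<open>The radius \<open>3 / 4 * \<rho>\<close> is as far as the disc of radius
  \<open>norm w / 2\<close> about \<open>w\<close> can reach when
  \<open>norm w \<le> \<rho> / 2\<close>.\<close>

lemma holomorphic_Taylor_remainder:
  assumes hol: "H holomorphic_on ball 0 \<rho>" and \<rho>: "0 < \<rho>"
  shows "\<exists>C\<ge>0. \<forall>w\<in>cball 0 (3 / 4 * \<rho>). norm (H w - (\<Sum>j\<le>n. (deriv ^^ j) H 0 / fact j * w ^ j)) \<le> C * norm w ^ Suc n"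
proof -
  let ?S = "cball (0::complex) (3 / 4 * \<rho>)"
  have sub: "?S \<subseteq> ball 0 \<rho>" using \<rho> by auto
  have hd: "(deriv ^^ j) H holomorphic_on ball 0 \<rho>" for j by (rule holomorphic_higher_deriv[OF hol]) auto
  have "bounded ((deriv ^^ Suc n) H ` ?S)"
    by (intro compact_imp_bounded compact_continuous_image holomorphic_on_imp_continuous_on holomorphic_on_subset[OF hd sub]) auto
  then obtain B where B: "B > 0" "\<And>x. x \<in> ?S \<Longrightarrow> norm ((deriv ^^ Suc n) H x) \<le> B"
    unfolding bounded_pos by (metis imageI)
  show ?thesis
  proof (intro exI[of _ "B / fact n"] conjI ballI)
    show "0 \<le> B / fact n" using B(1) by simp
    fix w assume w: "w \<in> ?S"
    have "norm ((deriv ^^ 0) H w - (\<Sum>j\<le>n. (deriv ^^ j) H 0 * (w - 0) ^ j / fact j)) \<le> B * norm (w - 0) ^ Suc n / fact n"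
    proof (rule complex_Taylor[of ?S])
      fix i x assume x: "x \<in> ?S"
      have "((deriv ^^ i) H has_field_derivative deriv ((deriv ^^ i) H) x) (at x)"
        by (rule holomorphic_derivI[OF hd]) (use x sub in auto)
      thus "((deriv ^^ i) H has_field_derivative (deriv ^^ Suc i) H x) (at x within ?S)"
        by (simp add: has_field_derivative_at_within)
    qed (use w \<rho> B(2) in auto)
    thus "norm (H w - (\<Sum>j\<le>n. (deriv ^^ j) H 0 / fact j * w ^ j)) \<le> B / fact n * norm w ^ Suc n"
      by simp
  qed
qed

lemma higher_deriv_linear_combination:
  assumes "open S" "finite I" "\<And>j. j \<in> I \<Longrightarrow> f j holomorphic_on S" "w \<in> S"
  shows "(deriv ^^ N) (\<lambda>w. \<Sum>j\<in>I. c j * f j w) w = (\<Sum>j\<in>I. c j * (deriv ^^ N) (f j) w)"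
  using assms(2,3)
proof (induction I rule: finite_induct)
  case empty
  show ?case by simp
next
  case (insert a I)
  have "(deriv ^^ N) (\<lambda>w. c a * f a w + (\<Sum>j\<in>I. c j * f j w)) w = 
        (deriv ^^ N) (\<lambda>w. c a * f a w) w + (deriv ^^ N) (\<lambda>w. \<Sum>j\<in>I. c j * f j w) w"
    using insert.prems assms by (intro higher_deriv_add[OF _ _ assms(1)] holomorphic_intros) auto
  also have "(deriv ^^ N) (\<lambda>w. c a * f a w) w = c a * (deriv ^^ N) (f a) w"
    by (rule higher_deriv_cmult[OF _ assms(4,1)]) (use insert.prems in auto)
  finally show ?case using insert by simp
qed

text \<open>A Lipschitz condition relaxed by \<open>exp (- y)\<close>, which makes room for the
  jumps of \<open>rescaled_M\<close>. The point \<open>y'\<close> may be negative, so the start at 0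
  is covered too.\<close>

definition poly_regular :: "nat \<Rightarrow> (real \<Rightarrow> complex) \<Rightarrow> bool" where
  "poly_regular A h \<longleftrightarrow> (\<exists>C\<ge>0. \<forall>y y'. 0 \<le> y \<and> y' \<le> y \<longrightarrow> norm (h y - h y') \<le> C * (1 + y) ^ A * ((y - y') + exp (- y)))"

lemma poly_regular_cmult: 
  assumes "poly_regular A h" shows "poly_regular A (\<lambda>y. c * h y)"
proof -
  from assms obtain C where C: "C \<ge> 0" "\<And>y y'. 0 \<le> y \<Longrightarrow> y' \<le> y \<Longrightarrow> norm (h y - h y') \<le> C * (1 + y) ^ A * ((y - y') + exp (- y))"
    unfolding poly_regular_def by blast
  have "norm (c * h y - c * h y') \<le> (norm c * C) * (1 + y) ^ A * ((y - y') + exp (- y))" if "0 \<le> y" "y' \<le> y" for y y'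
    using mult_left_mono[OF C(2)[OF that], of "norm c"] by (simp add: mult.assoc flip: right_diff_distrib norm_mult)
  thus ?thesis unfolding poly_regular_def using C(1) by (intro exI[of _ "norm c * C"]) auto
qed

lemma poly_regular_add: 
  assumes "poly_regular A h" "poly_regular A g" shows "poly_regular A (\<lambda>y. h y + g y)"
proof -
  from assms obtain C where C: "C \<ge> 0" "\<And>y y'. 0 \<le> y \<Longrightarrow> y' \<le> y \<Longrightarrow> norm (h y - h y') \<le> C * (1 + y) ^ A * ((y - y') + exp (- y))"
    unfolding poly_regular_def by blast
  from assms obtain D where D: "D \<ge> 0" "\<And>y y'. 0 \<le> y \<Longrightarrow> y' \<le> y \<Longrightarrow> norm (g y - g y') \<le> D * (1 + y) ^ A * ((y - y') + exp (- y))"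
    unfolding poly_regular_def by blast
  have "norm ((h y + g y) - (h y' + g y')) \<le> (C + D) * (1 + y) ^ A * ((y - y') + exp (- y))" if "0 \<le> y" "y' \<le> y" for y y'
  proof -
    have "norm ((h y + g y) - (h y' + g y')) \<le> norm (h y - h y') + norm (g y - g y')"
      by (metis add_diff_add norm_triangle_ineq)
    thus ?thesis using C(2)[OF that] D(2)[OF that] unfolding distrib_right by linarith
  qed
  thus ?thesis unfolding poly_regular_def using C(1) D(1) by (intro exI[of _ "C + D"]) auto
qed

lemma poly_regular_zero: "poly_regular A (\<lambda>_. 0)"
  unfolding poly_regular_def by (auto intro!: exI[of _ 0])

lemma poly_regular_sum: "(\<And>i. i \<in> I \<Longrightarrow> poly_regular A (h i)) \<Longrightarrow> poly_regular A (\<lambda>y. \<Sum>i\<in>I. h i y)"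
  by (induction I rule: infinite_finite_induct) (auto intro: poly_regular_zero poly_regular_add)

lemma poly_regular_pow_ln:
  assumes "n \<ge> 2" "n - 1 + i \<le> A"
  shows "poly_regular A (pow_ln n i)"
  unfolding poly_regular_def
proof (intro exI[of _ "(real n + real i) * fact i"] conjI allI impI)
  fix y y' :: real assume y: "0 \<le> y \<and> y' \<le> y"
  have "norm (pow_ln n i y - pow_ln n i y') \<le> (real n + real i) * fact i * (1 + y) ^ (n - 1 + i) * (y - y')"
    using y assms by (intro pow_ln_regular) auto
  also have "\<dots> \<le> (real n + real i) * fact i * (1 + y) ^ A * ((y - y') + exp (- y))"
    using y assms by (intro mult_mono power_increasing) auto
  finally show "norm (pow_ln n i y - pow_ln n i y') \<le> (real n + real i) * fact i * (1 + y) ^ A * ((y - y') + exp (- y))" .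
qed auto

lemma poly_regular_pow_ln_poly:
  assumes "n \<ge> 2" "n - 1 + degree q \<le> A"
  shows "poly_regular A (pow_ln_poly n q)"
  unfolding pow_ln_poly_eq_sum using assms by (intro poly_regular_sum poly_regular_cmult poly_regular_pow_ln) auto

lemma power_diff_bound:
  assumes "0 \<le> y'" "y' \<le> (y::real)"
  shows "y ^ N - y' ^ N \<le> real N * (1 + y) ^ N * (y - y')"
proof (induction N)
  case (Suc N)
  have "y ^ Suc N - y' ^ Suc N = y * (y ^ N - y' ^ N) + y' ^ N * (y - y')" by (simp add: algebra_simps)
  also have "\<dots> \<le> (1 + y) * (real N * (1 + y) ^ N * (y - y')) + (1 + y) ^ Suc N * (y - y')"
  proof (intro add_mono mult_mono Suc.IH mult_right_mono)
    have "y' ^ N \<le> (1 + y) ^ N" using assms by (intro power_mono) auto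
    also have "\<dots> \<le> (1 + y) ^ Suc N" using assms by (intro power_increasing) auto
    finally show "y' ^ N \<le> (1 + y) ^ Suc N" .
    show "0 \<le> y ^ N - y' ^ N" using assms by (simp add: power_mono)
  qed (use assms in auto)
  also have "\<dots> = real (Suc N) * (1 + y) ^ Suc N * (y - y')" by (simp add: algebra_simps)
  finally show ?case .
qed simp

lemma poly_regular_power_rescaled_M: "poly_regular (N + k) (\<lambda>y. of_real y ^ N * rescaled_M k y)"
  unfolding poly_regular_def
proof (intro exI[of _ "2 * 2 ^ k + real N * 2 ^ k"] conjI allI impI)
  fix y y' :: real assume "0 \<le> y \<and> y' \<le> y"
  hence y: "0 \<le> y" "y' \<le> y" by auto
  have "of_real y ^ N * rescaled_M k y - of_real y' ^ N * rescaled_M k y' = of_real (y ^ N) * (rescaled_M k y - rescaled_M k y') + of_real (y ^ N - y' ^ N) * rescaled_M k y'"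
    by (simp add: algebra_simps)
  also have "norm \<dots> \<le> y ^ N * norm (rescaled_M k y - rescaled_M k y') + \<bar>y ^ N - y' ^ N\<bar> * norm (rescaled_M k y')"
    by (rule order.trans[OF norm_triangle_ineq]) (use y in \<open>simp add: norm_mult del: of_real_diff of_real_power\<close>)
  also have "\<dots> \<le> 2 * 2 ^ k * (1 + y) ^ (N + k) * ((y - y') + exp (- y)) + real N * 2 ^ k * (1 + y) ^ (N + k) * ((y - y') + exp (- y))"
  proof (rule add_mono)
    have "y ^ N * norm (rescaled_M k y - rescaled_M k y') \<le> (1 + y) ^ N * (2 * 2 ^ k * (1 + y) ^ k * ((y - y') + exp (- y)))"
      using y by (intro mult_mono rescaled_M_regular power_mono) auto
    thus "y ^ N * norm (rescaled_M k y - rescaled_M k y') \<le> 2 * 2 ^ k * (1 + y) ^ (N + k) * ((y - y') + exp (- y))"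
      by (simp add: power_add mult_ac)
    show "\<bar>y ^ N - y' ^ N\<bar> * norm (rescaled_M k y') \<le> real N * 2 ^ k * (1 + y) ^ (N + k) * ((y - y') + exp (- y))"
    proof (cases "y' \<ge> 0")
      case True
      have "\<bar>y ^ N - y' ^ N\<bar> * norm (rescaled_M k y') \<le> (real N * (1 + y) ^ N * (y - y')) * (2 ^ k * (1 + y') ^ k)"
        using True y power_diff_bound[OF True y(2), of N] by (intro mult_mono norm_rescaled_M_le) (auto simp: power_mono)
      also have "\<dots> \<le> (real N * (1 + y) ^ N * ((y - y') + exp (- y))) * (2 ^ k * (1 + y) ^ k)"
        using True y by (intro mult_mono power_mono) auto
      finally show ?thesis by (simp add: power_add mult_ac)
    next
      case False
      thus ?thesis using y by (simp add: rescaled_M_neg)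
    qed
  qed
  finally show "norm (of_real y ^ N * rescaled_M k y - of_real y' ^ N * rescaled_M k y') \<le> 
    (2 * 2 ^ k + real N * 2 ^ k) * (1 + y) ^ (N + k) * ((y - y') + exp (- y))"
    unfolding distrib_right .
qed auto

text \<open>Comparison with \<open>y' = -1\<close>, where \<open>h\<close> vanishes, turns
  regularity into a growth bound at the cost of one power of \<open>1 + y\<close>. The same exponent
  is then used for both, as \<open>tauber\<close> expects.\<close>

lemma poly_regular_bounds:
  assumes "poly_regular A h" "poly_bdd h"
  obtains C where "C \<ge> 0" "\<And>y. y \<ge> 0 \<Longrightarrow> norm (h y) \<le> C * (1 + y) ^ Suc A"
    "\<And>y y'. 0 \<le> y \<Longrightarrow> y' \<le> y \<Longrightarrow> norm (h y - h y') \<le> C * (1 + y) ^ Suc A * ((y - y') + exp (- y))"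
proof -
  from assms obtain C where C: "C \<ge> 0" "\<And>y y'. 0 \<le> y \<Longrightarrow> y' \<le> y \<Longrightarrow> norm (h y - h y') \<le> C * (1 + y) ^ A * ((y - y') + exp (- y))"
    unfolding poly_regular_def by blast
  show ?thesis
  proof (rule that[of "2 * C"])
    fix y :: real assume y: "y \<ge> 0"
    have "h (-1) = 0" using assms(2) by (simp add: poly_bdd_def)
    hence "norm (h y) \<le> C * (1 + y) ^ A * ((y - (-1)) + exp (- y))" using C(2)[OF y, of "-1"] y by simp
    also have "\<dots> \<le> C * (1 + y) ^ A * (2 * (1 + y))"
    proof (rule mult_left_mono)
      have le: "(y - (-1)) + e \<le> 2 * (1 + y)" if "e \<le> 1" for e using y that by simp
      show "(y - (-1)) + exp (- y) \<le> 2 * (1 + y)" by (rule le) (use y in simp)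
    qed (use y C in auto)
    also have "\<dots> = 2 * C * (1 + y) ^ Suc A" by (simp add: algebra_simps)
    finally show "norm (h y) \<le> 2 * C * (1 + y) ^ Suc A" .
  next
    fix y y' :: real assume y: "y \<ge> 0" "y' \<le> y"
    have "(1 + y) ^ A \<le> (1 + y) ^ Suc A" using y by (intro power_increasing) auto
    hence "C * (1 + y) ^ A * ((y - y') + exp (- y)) \<le> (2 * C) * (1 + y) ^ Suc A * ((y - y') + exp (- y))"
      using y C(1) by (intro mult_mono) auto
    thus "norm (h y - h y') \<le> 2 * C * (1 + y) ^ Suc A * ((y - y') + exp (- y))" using C(2)[OF y] by linarith
  qed (use C in auto)
qed


section \<open>The asymptotic expansion\<close>

text \<open>Arbitrarily small exponents were needed to form products; here \<open>e = 1\<close> is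
  taken, the linear growth that \<open>tauber\<close> admits.\<close>

lemma higher_deriv_laplace_rescaled_M_bound:
  assumes t0: "t0 > 0"
  shows "\<exists>C\<ge>0. \<forall>w. 0 < Re w \<and> Re w \<le> 1 \<and> t0 \<le> \<bar>Im w\<bar> \<longrightarrow> norm ((deriv ^^ N) (laplace (rescaled_M k)) w) \<le> C * (1 + \<bar>Im w\<bar>)"
proof -
  define \<Phi> where "\<Phi> s = D_mu k s * (1 / s)" for s
  have sl: "slow t0 \<Phi>" unfolding \<Phi>_def by (intro slow_mult slow_D_mu slow_inverse_id t0)
  hence hol: "\<Phi> holomorphic_on {s. Re s > 1}" and sN: "slow_at t0 N \<Phi>" by (auto simp: slow_def)
  obtain C where C: "C \<ge> 0" "\<And>s. 1 < Re s \<Longrightarrow> Re s \<le> 2 \<Longrightarrow> t0 \<le> \<bar>Im s\<bar> \<Longrightarrow> norm ((deriv ^^ N) \<Phi> s) \<le> C * (1 + \<bar>Im s\<bar>) powr 1"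
    using slow_atD[OF sN zero_less_one] by blast
  have eq: "(deriv ^^ N) (laplace (rescaled_M k)) w = (deriv ^^ N) \<Phi> (1 + w)" if w: "Re w > 0" for w
  proof -
    have "(\<Phi> \<circ> (\<lambda>w. 1 * w + 1)) holomorphic_on {w. Re w > 0}"
      by (rule holomorphic_on_compose_gen[OF _ hol]) (auto intro!: holomorphic_intros)
    hence h2: "(\<lambda>w. \<Phi> (1 * w + 1)) holomorphic_on {w. Re w > 0}" by (simp only: o_def)
    have "(deriv ^^ N) (laplace (rescaled_M k)) w = (deriv ^^ N) (\<lambda>w. \<Phi> (1 * w + 1)) w"
      by (rule higher_deriv_transform_within_open[OF holomorphic_laplace[OF poly_bdd_rescaled_M] h2 open_Re_pos])
         (use w in \<open>auto simp: laplace_rescaled_M \<Phi>_def add.commute\<close>)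
    also have "\<dots> = 1 ^ N * (deriv ^^ N) \<Phi> (1 * w + 1)"
      by (rule higher_deriv_compose_linear'[OF hol open_Re_pos open_Re_gt_1]) (use w in auto)
    finally show ?thesis by (simp add: add.commute)
  qed
  show ?thesis
  proof (intro exI[of _ C] conjI allI impI)
    fix w assume w: "0 < Re w \<and> Re w \<le> 1 \<and> t0 \<le> \<bar>Im w\<bar>"
    thus "norm ((deriv ^^ N) (laplace (rescaled_M k)) w) \<le> C * (1 + \<bar>Im w\<bar>)"
      using C(2)[of "1 + w"] eq[of w] by simp
  qed (use C in auto)
qed

text \<open>\<open>c m i\<close> is the coefficient of \<open>w ^ m\<close> in the Taylor series of
  \<open>w * H i w\<close>. Once these are removed up to \<open>w ^ V\<close>, the bracket is of
  order \<open>V + 1\<close>; one order is spent on the bound for \<open>Ln w ^ i\<close>, and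
  \<open>V + M\<close> derivatives leave \<open>M\<close> negative powers of
  \<open>norm w\<close>.\<close>

lemma expansion_remainder_bound:
  fixes H :: "nat \<Rightarrow> complex \<Rightarrow> complex" and c :: "nat \<Rightarrow> nat \<Rightarrow> complex" and k V M :: nat
  assumes \<rho>: "0 < \<rho>" "\<rho> \<le> 1" and H: "\<And>i. H i holomorphic_on ball 0 \<rho>" and V: "V \<ge> 1"
    and c: "\<And>m i. c m i = (deriv ^^ (m - 1)) (H i) 0 / fact (m - 1)"
  defines "G \<equiv> (\<lambda>w. \<Sum>i\<le>k. (w * H i w - (\<Sum>m=1..V. c m i * w ^ m)) * Ln w ^ i)"
  shows "G holomorphic_on (ball 0 \<rho> - \<real>\<^sub>\<le>\<^sub>0)"
    and "\<exists>C\<ge>0. \<forall>w. Re w > 0 \<and> norm w \<le> \<rho> / 2 \<longrightarrow> norm ((deriv ^^ (V + M)) G w) \<le> C / norm w ^ M"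
proof -
  show hG: "G holomorphic_on (ball 0 \<rho> - \<real>\<^sub>\<le>\<^sub>0)"
    unfolding G_def by (intro holomorphic_intros holomorphic_on_subset[OF H]) auto
  obtain V' where V': "V = Suc V'" using V by (cases V) auto
  have ex: "\<forall>i. \<exists>C\<ge>0. \<forall>w\<in>cball 0 (3 / 4 * \<rho>). norm (H i w - (\<Sum>j\<le>V'. (deriv ^^ j) (H i) 0 / fact j * w ^ j)) \<le> C * norm w ^ V"
    using holomorphic_Taylor_remainder[OF H \<rho>(1)] V' by blast
  from choice[OF ex] obtain C where C: "\<And>i. C i \<ge> 0" "\<And>i w. w \<in> cball 0 (3 / 4 * \<rho>) \<Longrightarrow> norm (H i w - (\<Sum>j\<le>V'. (deriv ^^ j) (H i) 0 / fact j * w ^ j)) \<le> C i * norm w ^ V"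
    by blast
  define K where "K = (\<Sum>i\<le>k. 2 * C i * (fact i * exp pi))"
  have K0: "K \<ge> 0" unfolding K_def using C(1) by (intro sum_nonneg) auto
  have bd: "norm (G z) \<le> K * norm z ^ V" if z: "z \<in> cball 0 (3 / 4 * \<rho>)" "z \<noteq> 0" for z
  proof -
    have nz: "norm z > 0" "norm z \<le> 1" using z \<rho> by auto
    have "norm (G z) \<le> (\<Sum>i\<le>k. 2 * C i * (fact i * exp pi) * norm z ^ V)"
      unfolding G_def
    proof (rule sum_norm_le)
      fix i
      have "(\<Sum>m=1..V. c m i * z ^ m) = (\<Sum>j\<le>V'. c (Suc j) i * z ^ Suc j)"
        unfolding V' One_nat_def sum.atLeast1_atMost_eq lessThan_Suc_atMost ..
      also have "\<dots> = z * (\<Sum>j\<le>V'. (deriv ^^ j) (H i) 0 / fact j * z ^ j)"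
        by (simp add: c sum_distrib_left mult_ac)
      finally have "z * H i z - (\<Sum>m=1..V. c m i * z ^ m) = z * (H i z - (\<Sum>j\<le>V'. (deriv ^^ j) (H i) 0 / fact j * z ^ j))"
        by (simp add: right_diff_distrib)
      hence "norm ((z * H i z - (\<Sum>m=1..V. c m i * z ^ m)) * Ln z ^ i) = 
          norm z * norm (H i z - (\<Sum>j\<le>V'. (deriv ^^ j) (H i) 0 / fact j * z ^ j)) * norm (Ln z) ^ i"
        by (simp add: norm_mult norm_power)
      also have "\<dots> \<le> norm z * (C i * norm z ^ V) * (fact i * exp pi * (norm z + 1 / norm z))"
        using C z by (intro mult_mono norm_Ln_power_le) auto
      also have "\<dots> \<le> norm z * (C i * norm z ^ V) * (fact i * exp pi * (2 / norm z))"
      proof (intro mult_left_mono)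
        have "norm z * norm z \<le> 1 * 1" using nz by (intro mult_mono) auto
        hence "norm z \<le> 1 / norm z" using nz by (simp add: field_simps)
        thus "norm z + 1 / norm z \<le> 2 / norm z" by simp
      qed (use C nz in auto)
      also have "\<dots> = 2 * C i * (fact i * exp pi) * norm z ^ V" using nz by simp
      finally show "norm ((z * H i z - (\<Sum>m=1..V. c m i * z ^ m)) * Ln z ^ i) \<le> 2 * C i * (fact i * exp pi) * norm z ^ V" .
    qed
    thus ?thesis by (simp add: K_def sum_distrib_right)
  qed
  define C' where "C' = fact (V + M) * (K * (3 / 2) ^ V) * 2 ^ (V + M)"
  show "\<exists>C\<ge>0. \<forall>w. Re w > 0 \<and> norm w \<le> \<rho> / 2 \<longrightarrow> norm ((deriv ^^ (V + M)) G w) \<le> C / norm w ^ M"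
  proof (intro exI[of _ C'] conjI allI impI)
    show "C' \<ge> 0" using K0 by (simp add: C'_def)
    fix w assume "Re w > 0 \<and> norm w \<le> \<rho> / 2"
    hence w: "Re w > 0" "norm w \<le> \<rho> / 2" by auto
    have w0: "norm w > 0" using w by auto
    have "norm ((deriv ^^ (V + M)) G w) \<le> fact (V + M) * (K * (3 / 2 * norm w) ^ V) * 2 ^ (V + M) / norm w ^ (V + M)"
    proof (rule Cauchy_half_norm[OF w(1) hG])
      show "cball w (norm w / 2) \<subseteq> ball 0 \<rho> - \<real>\<^sub>\<le>\<^sub>0"
      proof
        fix z assume z: "z \<in> cball w (norm w / 2)"
        from cball_half_norm[OF w(1) z] w(2) \<rho> show "z \<in> ball 0 \<rho> - \<real>\<^sub>\<le>\<^sub>0" by auto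
      qed
      fix z assume z: "z \<in> cball w (norm w / 2)"
      note zz = cball_half_norm[OF w(1) z]
      have "norm (G z) \<le> K * norm z ^ V" using zz w(2) by (intro bd) auto
      also have "\<dots> \<le> K * (3 / 2 * norm w) ^ V" using zz K0 by (intro mult_left_mono power_mono) auto
      finally show "norm (G z) \<le> K * (3 / 2 * norm w) ^ V" .
    qed
    also have "\<dots> = C' / norm w ^ M"
      using w0 unfolding power_mult_distrib C'_def power_add by (simp add: field_simps)
    finally show "norm ((deriv ^^ (V + M)) G w) \<le> C' / norm w ^ M" .
  qed
qed

text \<open>\<open>V\<close> may exceed \<open>\<nu>\<close> because the Tauberian step loses powers
  of \<open>Y\<close> that only a longer expansion can restore. The polynomials are quantified
  before \<open>\<nu>\<close>, so one family serves all orders.\<close>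

lemma rescaled_M_expansion:
  assumes k: "k \<ge> 1"
  shows "\<exists>PC :: nat \<Rightarrow> complex poly. (\<forall>m. degree (PC m) \<le> k - 1) \<and> coeff (PC 1) (k - 1) = (-1) ^ (1 + k) * of_nat k \<and>
    (\<forall>\<nu>. \<exists>V\<ge>\<nu>. \<exists>C. \<forall>\<^sub>F Y in at_top. norm (rescaled_M k Y - (\<Sum>m=1..V. poly (PC m) (of_real (ln Y)) / of_real Y ^ (m + 1))) \<le> C / Y ^ (\<nu> + 1))"
proof -
  obtain \<rho> H where \<rho>: "0 < \<rho>" "\<rho> \<le> 1/4" and H: "\<And>i. H i holomorphic_on ball 0 \<rho>" and Hk: "H k 0 = 1"
    and exp: "\<And>w. w \<in> ball 0 \<rho> \<Longrightarrow> Re w > 0 \<Longrightarrow> D_mu k (1 + w) / (1 + w) = (\<Sum>i\<le>k. w * H i w * Ln w ^ i)"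
    using D_mu_expansion by blast
  define c where "c m i = (deriv ^^ (m - 1)) (H i) 0 / fact (m - 1)" for m i
  define S where "S m i = (\<lambda>w. w ^ m * Ln w ^ i)" for m i
  define P where "P m i q \<longleftrightarrow> degree q \<le> i - 1 \<and> (i \<ge> 1 \<longrightarrow> coeff q (i - 1) = (-1) ^ (m + i) * of_nat i * fact m) \<and> (i = 0 \<longrightarrow> q = 0) \<and>
     (\<forall>N w. N \<ge> m + 2 \<longrightarrow> Re w > 0 \<longrightarrow> laplace (pow_ln_poly (N - m - 1) q) w = (-1) ^ N * (deriv ^^ N) (S m i) w)" for m i q
  \<comment> \<open>The choice depends on \<open>m\<close> and \<open>i\<close> alone, not on
    \<open>\<nu>\<close> or \<open>N\<close>.\<close>
  define q where "q m i = (SOME q. P m i q)" for m i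
  have "P m i (q m i)" for m i
    unfolding q_def by (rule someI_ex) (use exists_main_term[of i m] in \<open>simp only: P_def S_def\<close>)
  hence q: "\<And>m i. degree (q m i) \<le> i - 1" 
     "\<And>m i. i \<ge> 1 \<Longrightarrow> coeff (q m i) (i - 1) = (-1) ^ (m + i) * of_nat i * fact m"
     "\<And>m. q m 0 = 0"
     "\<And>m i N w. N \<ge> m + 2 \<Longrightarrow> Re w > 0 \<Longrightarrow> laplace (pow_ln_poly (N - m - 1) (q m i)) w = (-1) ^ N * (deriv ^^ N) (S m i) w"
    unfolding P_def by blast+
  define PC where "PC m = (\<Sum>i\<le>k. smult (c m i) (q m i))" for m
  have deg: "degree (PC m) \<le> k - 1" for m
    unfolding PC_def
  proof (intro degree_sum_le)
    fix i assume "i \<in> {..k}"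
    thus "degree (smult (c m i) (q m i)) \<le> k - 1"
      using order.trans[OF degree_smult_le q(1)[of m i]] by (meson atMost_iff diff_le_mono order.trans)
  qed auto
  \<comment> \<open>\<open>c 1 k = H k 0 = 1\<close>, and \<open>q 1 i\<close> has too small a
    degree for \<open>0 < i < k\<close>. The index \<open>i = 0\<close> needs
    \<open>q 1 0 = 0\<close>, since truncated subtraction gives only the bound 0 for its
    degree.\<close>
  have lead: "coeff (PC 1) (k - 1) = (-1) ^ (1 + k) * of_nat k"
  proof -
    have "coeff (smult (c 1 i) (q 1 i)) (k - 1) = (if i = k then (-1) ^ (1 + k) * of_nat k else 0)" if "i \<le> k" for i
    proof (cases "i = k")
      case True
      thus ?thesis using q(2)[of k 1] k by (simp add: c_def Hk)
    next
      case False
      show ?thesis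
      proof (cases "i = 0")
        case True
        thus ?thesis using False q(3) by simp
      next
        case i0: False
        hence "degree (q 1 i) < k - 1" using q(1)[of 1 i] False that by linarith
        thus ?thesis using False by (simp add: coeff_eq_0)
      qed
    qed
    hence "coeff (PC 1) (k - 1) = (\<Sum>i\<le>k. if i = k then (-1) ^ (1 + k) * of_nat k else 0)"
      unfolding PC_def coeff_sum by (intro sum.cong) auto
    thus ?thesis by simp
  qed
  have lpPC: "pow_ln_poly n (PC m) = (\<lambda>y. \<Sum>i\<le>k. c m i * pow_ln_poly n (q m i) y)" for n m
    by (auto simp: pow_ln_poly_def PC_def poly_sum sum_distrib_left mult_ac fun_eq_iff)
  have main: "\<exists>V\<ge>\<nu>. \<exists>C. \<forall>\<^sub>F Y in at_top. norm (rescaled_M k Y - (\<Sum>m=1..V. poly (PC m) (of_real (ln Y)) / of_real Y ^ (m + 1))) \<le> C / Y ^ (\<nu> + 1)" for \<nu>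
  proof -
    \<comment> \<open>\<open>B\<close>, \<open>V\<close> and \<open>N\<close> are balanced:
      \<open>tauber\<close> yields \<open>Y ^ (3 + 2 * B)\<close> and
      \<open>Y ^ Suc (N + k) / Y ^ B\<close>, and both then equal
      \<open>Y ^ (N - \<nu> - 1)\<close>.\<close>
    define B where "B = k + \<nu> + 2"
    define V where "V = \<nu> + 1 + 2 * B"
    \<comment> \<open>The surplus 3 makes every exponent \<open>N - m - 1\<close> at least 2, as the
      regularity of \<open>pow_ln\<close> requires, and ensures
      \<open>N \<ge> m + 2\<close>.\<close>
    define N where "N = V + 3"
    define h where "h y = of_real y ^ N * rescaled_M k y - (\<Sum>m=1..V. pow_ln_poly (N - m - 1) (PC m) y)" for y
    have V1: "V \<ge> 1" by (simp add: V_def)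
    have ph: "poly_bdd h"
      unfolding h_def by (intro poly_bdd_diff poly_bdd_mult_power poly_bdd_rescaled_M poly_bdd_sum poly_bdd_pow_ln_poly) (auto simp: N_def)
    have "poly_regular (N + k) (\<lambda>y. \<Sum>m=1..V. pow_ln_poly (N - m - 1) (PC m) y)"
    proof (intro poly_regular_sum poly_regular_pow_ln_poly)
      fix m assume "m \<in> {1..V}"
      thus "N - m - 1 - 1 + degree (PC m) \<le> N + k" "N - m - 1 \<ge> 2" using deg[of m] by (auto simp: N_def)
    qed
    hence "poly_regular (N + k) (\<lambda>y. of_real y ^ N * rescaled_M k y + (-1) * (\<Sum>m=1..V. pow_ln_poly (N - m - 1) (PC m) y))"
      by (intro poly_regular_add poly_regular_cmult poly_regular_power_rescaled_M)
    hence "poly_regular (N + k) h" by (simp add: h_def[abs_def])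
    then obtain C0 where C0: "C0 \<ge> 0" "\<And>y. y \<ge> 0 \<Longrightarrow> norm (h y) \<le> C0 * (1 + y) ^ Suc (N + k)"
      "\<And>y y'. 0 \<le> y \<Longrightarrow> y' \<le> y \<Longrightarrow> norm (h y - h y') \<le> C0 * (1 + y) ^ Suc (N + k) * ((y - y') + exp (- y))"
      using poly_regular_bounds[OF _ ph] by blast
    define I where "I = {1..V} \<times> {..k}"
    have I: "finite I" by (simp add: I_def)
    have holS: "S m i holomorphic_on {w. Re w > 0}" for m i
      unfolding S_def using Re_pos_not_nonpos(1) by (intro holomorphic_intros) auto
    have Lh: "laplace h w = (-1) ^ N * ((deriv ^^ N) (laplace (rescaled_M k)) w - (\<Sum>(m,i)\<in>I. c m i * (deriv ^^ N) (S m i) w))"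
      if w: "Re w > 0" for w
    proof -
      have "laplace h w = laplace (\<lambda>y. of_real y ^ N * rescaled_M k y) w - laplace (\<lambda>y. \<Sum>m=1..V. pow_ln_poly (N - m - 1) (PC m) y) w"
        unfolding h_def by (intro laplace_diff poly_bdd_mult_power poly_bdd_rescaled_M poly_bdd_sum poly_bdd_pow_ln_poly w) (auto simp: N_def)
      also have "laplace (\<lambda>y. \<Sum>m=1..V. pow_ln_poly (N - m - 1) (PC m) y) w = (\<Sum>m=1..V. laplace (pow_ln_poly (N - m - 1) (PC m)) w)"
        by (intro laplace_sum w poly_bdd_pow_ln_poly) (auto simp: N_def)
      also have "\<dots> = (\<Sum>m=1..V. \<Sum>i\<le>k. (-1) ^ N * (c m i * (deriv ^^ N) (S m i) w))"
      proof (rule sum.cong)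
        fix m assume m: "m \<in> {1..V}"
        have "laplace (pow_ln_poly (N - m - 1) (PC m)) w = (\<Sum>i\<le>k. c m i * laplace (pow_ln_poly (N - m - 1) (q m i)) w)"
          unfolding lpPC using m by (subst laplace_sum[OF w]) (auto intro!: poly_bdd_cmult poly_bdd_pow_ln_poly simp: N_def laplace_cmult)
        also have "\<dots> = (\<Sum>i\<le>k. (-1) ^ N * (c m i * (deriv ^^ N) (S m i) w))"
        proof -
          have "N \<ge> m + 2" using m by (simp add: N_def)
          from q(4)[OF this w] show ?thesis by (simp only: mult.left_commute)
        qed
        finally show "laplace (pow_ln_poly (N - m - 1) (PC m)) w = (\<Sum>i\<le>k. (-1) ^ N * (c m i * (deriv ^^ N) (S m i) w))" .
      qed auto
      also have "\<dots> = (-1) ^ N * (\<Sum>(m,i)\<in>I. c m i * (deriv ^^ N) (S m i) w)"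
        by (simp add: I_def sum_distrib_left sum.cartesian_product case_prod_unfold)
      also have "laplace (\<lambda>y. of_real y ^ N * rescaled_M k y) w = (-1) ^ N * (deriv ^^ N) (laplace (rescaled_M k)) w"
        using higher_deriv_laplace[OF poly_bdd_rescaled_M w, of N k] by (simp flip: mult.assoc power_mult_distrib)
      finally show ?thesis by (simp add: right_diff_distrib)
    qed
    \<comment> \<open>Below height \<open>t0\<close> and with
      \<open>Re w = 1 / Y \<le> \<rho> / 4\<close> one has \<open>norm w \<le> \<rho> / 2\<close>,
      so that \<open>far\<close> and \<open>near\<close> together cover the line.\<close>
    define t0 where "t0 = \<rho> / 4"
    have t0: "t0 > 0" using \<rho> by (simp add: t0_def)
    obtain C2 where C2: "C2 \<ge> 0" "\<And>w. 0 < Re w \<Longrightarrow> Re w \<le> 1 \<Longrightarrow> t0 \<le> \<bar>Im w\<bar> \<Longrightarrow> norm ((deriv ^^ N) (laplace (rescaled_M k)) w) \<le> C2 * (1 + \<bar>Im w\<bar>)"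
      using higher_deriv_laplace_rescaled_M_bound[OF t0, of N k] by blast
    have ex: "\<forall>p\<in>I. \<exists>C\<ge>0. \<forall>w. Re w > 0 \<and> norm w \<ge> t0 \<longrightarrow> norm ((deriv ^^ N) (S (fst p) (snd p)) w) \<le> C"
      unfolding S_def by (intro ballI higher_deriv_power_Ln_bound t0) (auto simp: I_def N_def)
    from bchoice[OF ex] obtain D where D: "\<And>p. p \<in> I \<Longrightarrow> D p \<ge> 0" "\<And>p w. p \<in> I \<Longrightarrow> Re w > 0 \<Longrightarrow> norm w \<ge> t0 \<Longrightarrow> norm ((deriv ^^ N) (S (fst p) (snd p)) w) \<le> D p"
      by blast
    define E where "E = (\<Sum>p\<in>I. norm (c (fst p) (snd p)) * D p)"
    have E0: "E \<ge> 0" unfolding E_def using D(1) by (intro sum_nonneg mult_nonneg_nonneg) auto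
    have far: "norm (laplace h w) \<le> (C2 + E) * (1 + \<bar>Im w\<bar>)" if w: "Re w > 0" "Re w \<le> 1" "t0 \<le> \<bar>Im w\<bar>" for w
    proof -
      have "norm (\<Sum>(m,i)\<in>I. c m i * (deriv ^^ N) (S m i) w) \<le> E"
        unfolding E_def
      proof (rule sum_norm_le)
        fix p assume p: "p \<in> I"
        have "norm w \<ge> t0" using w(3) abs_Im_le_cmod[of w] by linarith
        thus "norm (case p of (m, i) \<Rightarrow> c m i * (deriv ^^ N) (S m i) w) \<le> norm (c (fst p) (snd p)) * D p"
          using D(2)[OF p w(1)] by (auto simp: case_prod_unfold norm_mult intro!: mult_left_mono)
      qed
      moreover have "norm ((deriv ^^ N) (laplace (rescaled_M k)) w) \<le> C2 * (1 + \<bar>Im w\<bar>)" by (rule C2(2)[OF w])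
      moreover have "norm (laplace h w) \<le> norm ((deriv ^^ N) (laplace (rescaled_M k)) w) + norm (\<Sum>(m,i)\<in>I. c m i * (deriv ^^ N) (S m i) w)"
        unfolding Lh[OF w(1)] norm_mult norm_power by (simp add: norm_triangle_ineq4)
      moreover have "E \<le> E * (1 + \<bar>Im w\<bar>)" using E0 by (simp add: algebra_simps)
      ultimately show ?thesis unfolding distrib_right by linarith
    qed
    define G where "G w = (\<Sum>i\<le>k. (w * H i w - (\<Sum>m=1..V. c m i * w ^ m)) * Ln w ^ i)" for w
    have hG: "G holomorphic_on (ball 0 \<rho> - \<real>\<^sub>\<le>\<^sub>0)"
      unfolding G_def by (rule expansion_remainder_bound(1)[OF \<rho>(1) _ H V1 c_def]) (use \<rho> in auto)
    have "\<exists>C\<ge>0. \<forall>w. Re w > 0 \<and> norm w \<le> \<rho> / 2 \<longrightarrow> norm ((deriv ^^ (V + 3)) G w) \<le> C / norm w ^ 3"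
      unfolding G_def by (rule expansion_remainder_bound(2)[OF \<rho>(1) _ H V1 c_def]) (use \<rho> in auto)
    then obtain C3 where C3: "C3 \<ge> 0" "\<And>w. Re w > 0 \<Longrightarrow> norm w \<le> \<rho> / 2 \<Longrightarrow> norm ((deriv ^^ N) G w) \<le> C3 / norm w ^ 3"
      unfolding N_def by blast
    have near: "norm (laplace h w) \<le> C3 / norm w ^ 3" if w: "Re w > 0" "norm w \<le> \<rho> / 2" for w
    proof -
      let ?U = "ball 0 \<rho> \<inter> {w. Re w > 0}"
      have U: "open ?U" "w \<in> ?U" using w \<rho> by (auto intro!: open_Int open_Re_pos)
      have hR: "(\<lambda>w. laplace (rescaled_M k) w - (\<Sum>p\<in>I. c (fst p) (snd p) * S (fst p) (snd p) w)) holomorphic_on {w. Re w > 0}"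
        by (intro holomorphic_intros holomorphic_laplace poly_bdd_rescaled_M holS)
      have "(\<Sum>(m,i)\<in>I. c m i * (deriv ^^ N) (S m i) w) = (deriv ^^ N) (\<lambda>w. \<Sum>p\<in>I. c (fst p) (snd p) * S (fst p) (snd p) w) w"
        by (subst higher_deriv_linear_combination[OF open_Re_pos I holS]) (use w in \<open>auto simp: case_prod_unfold\<close>)
      hence "(deriv ^^ N) (laplace (rescaled_M k)) w - (\<Sum>(m,i)\<in>I. c m i * (deriv ^^ N) (S m i) w) = 
         (deriv ^^ N) (\<lambda>w. laplace (rescaled_M k) w - (\<Sum>p\<in>I. c (fst p) (snd p) * S (fst p) (snd p) w)) w"
        by (subst higher_deriv_diff[OF _ _ open_Re_pos]) (use w in \<open>auto intro!: holomorphic_intros holomorphic_laplace poly_bdd_rescaled_M holS\<close>)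
      also have "\<dots> = (deriv ^^ N) G w"
      proof (rule higher_deriv_transform_within_open[OF holomorphic_on_subset[OF hR] holomorphic_on_subset[OF hG] U])
        show "?U \<subseteq> ball 0 \<rho> - \<real>\<^sub>\<le>\<^sub>0" using Re_pos_not_nonpos(1) by auto
        fix z assume z: "z \<in> ?U"
        have "(\<Sum>p\<in>I. c (fst p) (snd p) * S (fst p) (snd p) z) = (\<Sum>m=1..V. \<Sum>i\<le>k. c m i * S m i z)"
          unfolding I_def by (simp add: sum.cartesian_product case_prod_unfold)
        also have "\<dots> = (\<Sum>i\<le>k. \<Sum>m=1..V. c m i * S m i z)" by (rule sum.swap)
        also have "laplace (rescaled_M k) z - \<dots> = G z"
          using z by (simp add: laplace_rescaled_M exp G_def S_def left_diff_distrib sum_subtractf sum_distrib_right mult.assoc)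
        finally show "laplace (rescaled_M k) z - (\<Sum>p\<in>I. c (fst p) (snd p) * S (fst p) (snd p) z) = G z" .
      qed auto
      finally have "norm (laplace h w) = norm ((deriv ^^ N) G w)" unfolding Lh[OF w(1)] norm_mult norm_power by simp
      thus ?thesis using C3(2)[OF w] by simp
    qed
    define C1 where "C1 = C2 + E + C3"
    have C1: "norm (laplace h (Complex (1 / Y) \<tau>)) \<le> C1 * Y ^ 3 * (1 + \<bar>\<tau>\<bar>)" if Y: "Y \<ge> 4 / \<rho>" for Y \<tau>
    proof -
      define w where "w = Complex (1 / Y) \<tau>"
      have "4 / \<rho> > 1" using \<rho> by simp
      hence Y1: "Y > 1" using Y by linarith
      have Yr: "1 / Y \<le> \<rho> / 4" using Y Y1 \<rho> by (simp add: field_simps)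
      have w: "Re w > 0" "Re w \<le> 1" using Y1 by (auto simp: w_def)
      have Y3: "1 \<le> Y ^ 3" using Y1 by (intro one_le_power) auto
      show ?thesis
      proof (cases "t0 \<le> \<bar>\<tau>\<bar>")
        case True
        hence "norm (laplace h w) \<le> (C2 + E) * 1 * (1 + \<bar>\<tau>\<bar>)" using far[OF w] by (simp add: w_def)
        also have "\<dots> \<le> C1 * Y ^ 3 * (1 + \<bar>\<tau>\<bar>)"
          using Y3 C2(1) E0 C3(1) by (intro mult_right_mono mult_mono) (auto simp: C1_def)
        finally show ?thesis by (simp add: w_def)
      next
        case False
        have "norm w \<le> \<bar>Re w\<bar> + \<bar>Im w\<bar>" by (rule cmod_le)
        also have "\<dots> \<le> \<rho> / 4 + \<rho> / 4" using False Yr Y1 by (intro add_mono) (auto simp: w_def t0_def)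
        finally have nw: "norm w \<le> \<rho> / 2" by simp
        \<comment> \<open>The singularity at 0 is at distance at least \<open>1 / Y\<close>, so the
          third-order bound costs \<open>Y ^ 3\<close>; this is the exponent \<open>M = 3\<close> in
          \<open>tauber\<close>.\<close>
        have "norm w \<ge> 1 / Y" using abs_Re_le_cmod[of w] Y1 by (simp add: w_def)
        hence "(1 / Y) ^ 3 \<le> norm w ^ 3" using Y1 by (intro power_mono) auto
        hence "C3 / norm w ^ 3 \<le> C3 / (1 / Y) ^ 3" using C3(1) Y1 w by (intro divide_left_mono mult_pos_pos) auto
        also have "\<dots> = C3 * Y ^ 3 * 1" using Y1 by (simp add: power_divide)
        also have "\<dots> \<le> C1 * Y ^ 3 * (1 + \<bar>\<tau>\<bar>)"
          using Y1 C2(1) E0 C3(1) by (intro mult_mono) (auto simp: C1_def)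
        finally show ?thesis using near[OF w(1) nw] by (simp add: w_def)
      qed
    qed
    have C10: "C1 \<ge> 0" using C2(1) E0 C3(1) by (simp add: C1_def)
    have "\<exists>C\<ge>0. \<exists>Y1. \<forall>Y\<ge>Y1. norm (h Y) \<le> C * (Y ^ (3 + 2 * B) + Y ^ Suc (N + k) / Y ^ B)"
      by (rule tauber[OF ph C0 C10 C1])
    then obtain C Y1 where CY: "C \<ge> 0" "\<And>Y. Y \<ge> Y1 \<Longrightarrow> norm (h Y) \<le> C * (Y ^ (3 + 2 * B) + Y ^ Suc (N + k) / Y ^ B)"
      by blast
    show ?thesis
    proof (intro exI[of _ V] conjI exI[of _ "2 * C"])
      show "\<nu> \<le> V" by (simp add: V_def)
      show "\<forall>\<^sub>F Y in at_top. norm (rescaled_M k Y - (\<Sum>m=1..V. poly (PC m) (of_real (ln Y)) / of_real Y ^ (m + 1))) \<le> 2 * C / Y ^ (\<nu> + 1)"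
        using eventually_ge_at_top[of Y1] eventually_gt_at_top[of 0]
      proof eventually_elim
        case (elim Y)
        define P where "P = 3 + 2 * B"
        have log_coeff_poly: "N = P + (\<nu> + 1)" "Suc (N + k) = P + B" by (simp_all add: P_def N_def V_def B_def)
        have "h Y / of_real Y ^ N = rescaled_M k Y - (\<Sum>m=1..V. pow_ln_poly (N - m - 1) (PC m) Y / of_real Y ^ N)"
          using elim by (simp add: h_def diff_divide_distrib sum_divide_distrib)
        also have "(\<Sum>m=1..V. pow_ln_poly (N - m - 1) (PC m) Y / of_real Y ^ N) = (\<Sum>m=1..V. poly (PC m) (of_real (ln Y)) / of_real Y ^ (m + 1))"
        proof (rule sum.cong)
          fix m assume "m \<in> {1..V}"
          hence "N = (N - m - 1) + (m + 1)" by (auto simp: N_def)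
          hence "complex_of_real Y ^ N = of_real Y ^ (N - m - 1) * of_real Y ^ (m + 1)" by (metis power_add)
          thus "pow_ln_poly (N - m - 1) (PC m) Y / of_real Y ^ N = poly (PC m) (of_real (ln Y)) / of_real Y ^ (m + 1)"
            using elim by (simp add: pow_ln_poly_def)
        qed auto
        finally have eq: "h Y / of_real Y ^ N = rescaled_M k Y - (\<Sum>m=1..V. poly (PC m) (of_real (ln Y)) / of_real Y ^ (m + 1))" .
        have "norm (rescaled_M k Y - (\<Sum>m=1..V. poly (PC m) (of_real (ln Y)) / of_real Y ^ (m + 1))) = norm (h Y) / Y ^ N"
          unfolding eq[symmetric] norm_divide norm_power norm_of_real using elim by simp
        also have "\<dots> \<le> C * (Y ^ P + Y ^ (P + B) / Y ^ B) / Y ^ N"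
          using CY(2)[OF elim(1)] elim unfolding log_coeff_poly(2) P_def by (intro divide_right_mono) auto
        also have "\<dots> = 2 * C / Y ^ (\<nu> + 1)"
          using elim unfolding log_coeff_poly(1) power_add by (simp add: field_simps)
        finally show ?case .
      qed
    qed
  qed
  show ?thesis using deg lead main by blast
qed

section \<open>Passage from the complex expansion in \<open>Y = ln x\<close> to the real
  statement\<close>

lemma Re_poly_of_real: "Re (poly P (of_real t)) = poly (map_poly Re P) t"
  by (induction P) (auto simp: map_poly_pCons)

lemma abs_poly_le:
  fixes p :: "real poly"
  assumes "degree p \<le> d" "t \<ge> 1"
  shows "\<bar>poly p t\<bar> \<le> (\<Sum>i\<le>degree p. \<bar>coeff p i\<bar>) * t ^ d"
proof -
  have "\<bar>poly p t\<bar> \<le> (\<Sum>i\<le>degree p. \<bar>coeff p i * t ^ i\<bar>)" unfolding poly_altdef by (rule sum_abs)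
  also have "\<dots> \<le> (\<Sum>i\<le>degree p. \<bar>coeff p i\<bar> * t ^ d)"
    using assms by (intro sum_mono) (auto simp: abs_mult power_abs intro!: mult_left_mono power_increasing)
  finally show ?thesis by (simp add: sum_distrib_right)
qed

theorem theorem2:
  fixes k :: nat
  assumes "k \<ge> 3"
  shows "\<exists>Q :: nat \<Rightarrow> real poly.
           (\<forall>j\<ge>2. degree (Q j) \<le> k - 1) \<and>
           degree (Q 2) = k - 1 \<and>
           (\<forall>\<nu>::nat. \<nu> \<ge> 1 \<longrightarrow>
              (\<lambda>x::real. M_omega_pow k x
                 - (x * poly (Q 2) (ln (ln x)) / ln x ^ 2
                    + (\<Sum>j=3..\<nu>. x * poly (Q j) (ln (ln x)) / ln x ^ j)))
              \<in> O[at_top](\<lambda>x. x * ln (ln x) ^ (k * \<nu> + 2 * k) / ln x ^ (\<nu> + 1)))"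
proof -
  obtain PC :: "nat \<Rightarrow> complex poly" where deg: "\<And>m. degree (PC m) \<le> k - 1" 
    and lead: "coeff (PC 1) (k - 1) = (-1) ^ (1 + k) * of_nat k"
    and main: "\<And>\<nu>. \<exists>V\<ge>\<nu>. \<exists>C. \<forall>\<^sub>F Y in at_top. norm (rescaled_M k Y - (\<Sum>m=1..V. poly (PC m) (of_real (ln Y)) / of_real Y ^ (m + 1))) \<le> C / Y ^ (\<nu> + 1)"
    using rescaled_M_expansion[of k] assms by auto
  \<comment> \<open>The shift \<open>j = m + 1\<close> turns \<open>Y ^ (m + 1)\<close> into
    \<open>ln x ^ j\<close>. Taking real parts is compatible with the expansion because
    \<open>Y\<close>, \<open>ln Y\<close> and \<open>M_omega_pow\<close> are real.\<close>
  define Q where "Q j = map_poly Re (PC (j - 1))" for j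
  have degQ: "degree (Q j) \<le> k - 1" for j
  proof (rule degree_le, intro allI impI)
    fix i assume "k - 1 < i"
    hence "degree (PC (j - 1)) < i" using deg[of "j - 1"] by simp
    thus "coeff (Q j) i = 0" by (simp add: Q_def coeff_map_poly coeff_eq_0)
  qed
  have "coeff (PC 1) (k - 1) = of_real ((-1) ^ (1 + k) * real k)" unfolding lead by simp
  moreover have "coeff (Q 2) (k - 1) = Re (coeff (PC 1) (k - 1))" by (simp add: Q_def coeff_map_poly)
  ultimately have "coeff (Q 2) (k - 1) = (-1) ^ (1 + k) * real k" by (simp only: Re_complex_of_real)
  hence "coeff (Q 2) (k - 1) \<noteq> 0" using assms by simp
  hence degQ2: "degree (Q 2) = k - 1" using degQ[of 2] le_degree[of "Q 2" "k - 1"] by simp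
  have "(\<lambda>x::real. M_omega_pow k x - (x * poly (Q 2) (ln (ln x)) / ln x ^ 2 + (\<Sum>j=3..\<nu>. x * poly (Q j) (ln (ln x)) / ln x ^ j)))
      \<in> O[at_top](\<lambda>x. x * ln (ln x) ^ (k * \<nu> + 2 * k) / ln x ^ (\<nu> + 1))" if \<nu>: "\<nu> \<ge> 1" for \<nu> :: nat
  proof -
    obtain V C where V: "V \<ge> \<nu>" 
      and C: "\<forall>\<^sub>F Y in at_top. norm (rescaled_M k Y - (\<Sum>m=1..V. poly (PC m) (of_real (ln Y)) / of_real Y ^ (m + 1))) \<le> C / Y ^ (\<nu> + 1)"
      using main by blast
    define T where "T j x = x * poly (Q j) (ln (ln x)) / ln x ^ j" for j and x :: real
    define J where "J = {2..V+1}"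
    \<comment> \<open>The index 2 is kept even for \<open>\<nu> = 1\<close>, where it already lies
      beyond \<open>\<nu>\<close>; all indices left out are at least
      \<open>\<nu> + 1\<close>.\<close>
    define J0 where "J0 = insert 2 {3..\<nu>}"
    have J0: "J0 \<subseteq> J" "finite J" using V \<nu> by (auto simp: J0_def J_def)
    have JJ: "j \<ge> \<nu> + 1" if "j \<in> J - J0" for j using that \<nu> by (auto simp: J_def J0_def)
    define E where "E = k * \<nu> + 2 * k"
    define K where "K j = (\<Sum>i\<le>degree (Q j). \<bar>coeff (Q j) i\<bar>)" for j
    have K0: "K j \<ge> 0" for j unfolding K_def by (intro sum_nonneg) auto
    show ?thesis
    proof (rule bigoI[where c = "\<bar>C\<bar> + (\<Sum>j\<in>J - J0. K j)"])
      have "filterlim (\<lambda>x::real. ln (ln x)) at_top at_top" by real_asymp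
      hence ev: "\<forall>\<^sub>F x::real in at_top. ln (ln x) \<ge> 1" by (simp add: filterlim_at_top)
      show "\<forall>\<^sub>F x in at_top. norm (M_omega_pow k x - (x * poly (Q 2) (ln (ln x)) / ln x ^ 2 + (\<Sum>j=3..\<nu>. x * poly (Q j) (ln (ln x)) / ln x ^ j)))
          \<le> (\<bar>C\<bar> + (\<Sum>j\<in>J - J0. K j)) * norm (x * ln (ln x) ^ (k * \<nu> + 2 * k) / ln x ^ (\<nu> + 1))"
        using eventually_compose_filterlim[OF C ln_at_top] ev eventually_gt_at_top[of "exp 1"]
      proof eventually_elim
        case (elim x)
        define Y where "Y = ln x"
        have x0: "x > 0" using elim(3) less_trans[of 0 "exp 1" x] by simp
        have Y1: "Y > 1" using elim(3) x0 by (simp add: Y_def ln_ge_iff flip: exp_less_cancel_iff[of 1])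
        have aY: "\<bar>ln x\<bar> = ln x" using Y1 by (simp add: Y_def)
        have lY: "ln Y \<ge> 1" using elim(2) by (simp add: Y_def)
        have lE: "ln Y ^ E \<ge> 1" using lY by (rule one_le_power)
        have "(\<Sum>j=3..\<nu>. T j x) + T 2 x = (\<Sum>j\<in>J0. T j x)"
          unfolding J0_def by (subst sum.insert) auto
        moreover have "(\<Sum>j\<in>J. T j x) = (\<Sum>j\<in>J - J0. T j x) + (\<Sum>j\<in>J0. T j x)"
          by (rule sum.subset_diff[OF J0])
        ultimately have eq: "M_omega_pow k x - (T 2 x + (\<Sum>j=3..\<nu>. T j x)) = (M_omega_pow k x - (\<Sum>j\<in>J. T j x)) + (\<Sum>j\<in>J - J0. T j x)"
          by simp
        have main: "\<bar>M_omega_pow k x - (\<Sum>j\<in>J. T j x)\<bar> \<le> \<bar>C\<bar> * (x * ln Y ^ E / Y ^ (\<nu> + 1))"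
        proof -
          have "Re (rescaled_M k Y) = M_omega_pow k x / x"
            using x0 by (simp add: rescaled_M_def Y_def exp_minus field_simps)
          moreover have "Re (\<Sum>m=1..V. poly (PC m) (of_real (ln Y)) / of_real Y ^ (m + 1)) = (\<Sum>j\<in>J. T j x) / x"
          proof -
            have "(\<Sum>j\<in>J. T j x) = (\<Sum>m=1..V. T (Suc m) x)"
              unfolding J_def using sum.shift_bounds_cl_Suc_ivl[of "\<lambda>j. T j x" 1 V] by (simp only: numeral_2_eq_2 One_nat_def Suc_eq_plus1_left[symmetric] add_Suc_right add_0_right)
            also have "\<dots> = (\<Sum>m=1..V. x * Re (poly (PC m) (of_real (ln Y)) / of_real Y ^ (m + 1)))"
            proof (rule sum.cong)
              fix m
              have "poly (PC m) (of_real (ln Y)) / of_real Y ^ (m + 1) = poly (PC m) (of_real (ln Y)) / of_real (Y ^ (m + 1))" by simp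
              hence R: "Re (poly (PC m) (of_real (ln Y)) / of_real Y ^ (m + 1)) = poly (Q (Suc m)) (ln Y) / Y ^ (m + 1)"
                by (simp only: Re_divide_of_real Re_poly_of_real Q_def diff_Suc_1)
              show "T (Suc m) x = x * Re (poly (PC m) (of_real (ln Y)) / of_real Y ^ (m + 1))"
                unfolding R by (simp add: T_def Y_def)
            qed auto
            also have "\<dots> = x * Re (\<Sum>m=1..V. poly (PC m) (of_real (ln Y)) / of_real Y ^ (m + 1))"
              unfolding Re_sum sum_distrib_left ..
            finally show ?thesis using x0 by simp
          qed
          ultimately have "Re (rescaled_M k Y - (\<Sum>m=1..V. poly (PC m) (of_real (ln Y)) / of_real Y ^ (m + 1))) = (M_omega_pow k x - (\<Sum>j\<in>J. T j x)) / x"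
            by (simp add: diff_divide_distrib)
          hence "\<bar>(M_omega_pow k x - (\<Sum>j\<in>J. T j x)) / x\<bar> \<le> norm (rescaled_M k Y - (\<Sum>m=1..V. poly (PC m) (of_real (ln Y)) / of_real Y ^ (m + 1)))"
            using abs_Re_le_cmod[of "rescaled_M k Y - (\<Sum>m=1..V. poly (PC m) (of_real (ln Y)) / of_real Y ^ (m + 1))"] by (simp only:)
          also have "\<dots> \<le> C / Y ^ (\<nu> + 1)" using elim(1) by (simp only: Y_def)
          finally have "\<bar>(M_omega_pow k x - (\<Sum>j\<in>J. T j x)) / x\<bar> \<le> C / Y ^ (\<nu> + 1)" .
          hence "\<bar>M_omega_pow k x - (\<Sum>j\<in>J. T j x)\<bar> \<le> C / Y ^ (\<nu> + 1) * x"
            using x0 by (simp add: abs_divide pos_divide_le_eq)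
          also have "\<dots> \<le> \<bar>C\<bar> / Y ^ (\<nu> + 1) * (x * ln Y ^ E)"
            using x0 Y1 lE by (intro mult_mono divide_right_mono) auto
          finally show ?thesis by simp
        qed
        \<comment> \<open>The surplus terms go into the error: \<open>j \<ge> \<nu> + 1\<close>
          supplies the power of \<open>ln x\<close>, and as
          \<open>degree (Q j) \<le> k - 1 \<le> E\<close> the power of \<open>ln Y\<close> in the
          error dominates the polynomial.\<close>
        have "\<bar>\<Sum>j\<in>J - J0. T j x\<bar> \<le> (\<Sum>j\<in>J - J0. K j * (x * ln Y ^ E / Y ^ (\<nu> + 1)))"
        proof (rule order.trans[OF sum_abs sum_mono])
          fix j assume j: "j \<in> J - J0"
          have "degree (Q j) \<le> E" using degQ[of j] by (simp add: E_def)
          hence "\<bar>poly (Q j) (ln Y)\<bar> \<le> K j * ln Y ^ E" unfolding K_def using lY by (rule abs_poly_le)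
          moreover have "Y ^ (\<nu> + 1) \<le> Y ^ j" using Y1 JJ[OF j] by (intro power_increasing) auto
          ultimately have "x * \<bar>poly (Q j) (ln Y)\<bar> / Y ^ j \<le> x * (K j * ln Y ^ E) / Y ^ (\<nu> + 1)"
            using x0 Y1 K0[of j] lY by (intro frac_le mult_left_mono) auto
          moreover have "\<bar>T j x\<bar> = x * \<bar>poly (Q j) (ln Y)\<bar> / Y ^ j" using x0 Y1 by (simp add: T_def Y_def abs_mult power_abs aY)
          ultimately show "\<bar>T j x\<bar> \<le> K j * (x * ln Y ^ E / Y ^ (\<nu> + 1))" by (simp add: mult_ac)
        qed
        also have "\<dots> = (\<Sum>j\<in>J - J0. K j) * (x * ln Y ^ E / Y ^ (\<nu> + 1))" unfolding sum_distrib_right ..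
        finally have "\<bar>M_omega_pow k x - (T 2 x + (\<Sum>j=3..\<nu>. T j x))\<bar> \<le> 
            \<bar>C\<bar> * (x * ln Y ^ E / Y ^ (\<nu> + 1)) + (\<Sum>j\<in>J - J0. K j) * (x * ln Y ^ E / Y ^ (\<nu> + 1))"
          unfolding eq using main by linarith
        also have "\<dots> = (\<bar>C\<bar> + (\<Sum>j\<in>J - J0. K j)) * (x * ln Y ^ E / Y ^ (\<nu> + 1))" by (simp only: distrib_right)
        also have "x * ln Y ^ E / Y ^ (\<nu> + 1) = norm (x * ln (ln x) ^ (k * \<nu> + 2 * k) / ln x ^ (\<nu> + 1))"
          using x0 Y1 lY by (simp add: E_def Y_def abs_mult power_abs aY)
        finally show ?case by (simp add: T_def)
      qed
    qed
  qed
  thus ?thesis using degQ degQ2 by blast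
qed

end
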